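(* There is an isomorphism of $\mathbb{K}$-algebras $\mathcal{S}\otimes_{\mathbb{F}}\mathbb{K}\cong \mathbb{K}^{\oplus 9}\oplus M_3(\mathbb{K})$. Thus, for generic $x\in\mathbb{P}^3$ (i.e. for all $x$ in some nonempty Zariski-open subset), the algebra $S_x$ is isomorphic to $k^{\oplus 9}\oplus M_3(k)$.
   Context: $k$ is an algebraically closed field of characteristic zero; all algebras are unital and associative; $[a,b]=ab-ba$. $\mathbb{F}=k(y_1,y_2,y_3)$ is the field of rational functions in three variables. $\mathcal{S}$ is the unital $\mathbb{F}$-algebra generated by $p_1,p_2,q_1,q_2$ subject to $p_ip_j=\delta_{ij}p_i$, $q_iq_j=\delta_{ij}q_i$ ($i,j=1,2$) and $[p_1,q_1]+y_1[p_1,q_2]+y_2[p_2,q_1]+y_3[p_2,q_2]=0$. For $x=(x_{11}:x_{12}:x_{21}:x_{22})\in\mathbb{P}^3=\mathbb{P}^3(k)$, $S_x$ is the unital $k$-algebra generated by $p_1,p_2,q_1,q_2$ subject to $p_ip_j=\delta_{ij}p_i$, $q_iq_j=\delta_{ij}q_i$ ($i,j=1,2$) and $\sum_{i,j=1}^2x_{ij}[p_i,q_j]=0$. The field $\mathbb{K}$: consider the three polynomials in $z_1,z_2$ over $\mathbb{F}$ $$c_1=(y_1y_2+y_3)z_1z_2+y_2y_3z_2^2+y_1z_1^2-y_2y_3z_2-y_1z_1,$$ $$c_2=z_1^2+y_2^2z_2^2+2y_2z_1z_2+(-y_1y_2-1+y_3)z_1+(-y_1y_2^2-y_2^2+y_2y_3)z_2+y_2^2+y_1y_2-y_2-y_2y_3,$$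 $$c_3=y_1^2z_1^2+y_3^2z_2^2+2y_1y_3z_1z_2+(y_1^2y_2-y_1^2-y_1y_3)z_1+(y_1y_2y_3-2y_3^2)z_2+y_1y_3-y_1^2y_3-y_1y_2y_3+y_1y_3^2.$$ These have exactly three common zeros over an algebraic closure $\overline{\mathbb{F}}$. Fix one, $(z_1^{(1)},z_2^{(1)})\in\overline{\mathbb{F}}^2$, and set $\mathbb{K}=\mathbb{F}(z_1^{(1)},z_2^{(1)})$, an extension of $\mathbb{F}$ of degree $3$. *)

theory Defs
  imports
    "HOL-Analysis.Analysis"
    "HOL-Algebra.Algebra"
    "HOL-Algebra.Algebraic_Closure_Type"
    "HOL-Computational_Algebra.Computational_Algebra"
    "HOL-Library.Poly_Mapping"
begin

text \<open>
  An algebra over a commutative ring \<open>R\<close> is represented by a record of type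
  \<open>('r, 'a) module\<close>, i.e. a (not necessarily commutative) unital ring together with a scalar
  multiplication.  The locale \<open>algebra\<close> of HOL-Algebra is not used because it only covers
  commutative algebras.
\<close>

definition alg_isomorphic ::
    "('r, 'm) ring_scheme \<Rightarrow> ('r, 'a) module \<Rightarrow> ('r, 'b) module \<Rightarrow> bool"
  where "alg_isomorphic R A B \<longleftrightarrow>
    (\<exists>h\<in>ring_iso A B. \<forall>c\<in>carrier R. \<forall>a\<in>carrier A. h (c \<odot>\<^bsub>A\<^esub> a) = c \<odot>\<^bsub>B\<^esub> h a)"

definition alg_quot :: "('r, 'a) module \<Rightarrow> 'a set \<Rightarrow> ('r, 'a set) module"  (infixl \<open>QuotA\<close> 65)
  where "A QuotA I =
    ring.extend (A Quot I) (module.fields (\<lambda>c Y. \<Union>a\<in>Y. I +>\<^bsub>A\<^esub> (c \<odot>\<^bsub>A\<^esub> a)))"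

definition alg_dirprod :: "('r, 'a) module \<Rightarrow> ('r, 'b) module \<Rightarrow> ('r, 'a \<times> 'b) module"
  where "alg_dirprod A B =
    ring.extend (RDirProd A B) (module.fields (\<lambda>c (a, b). (c \<odot>\<^bsub>A\<^esub> a, c \<odot>\<^bsub>B\<^esub> b)))"


subsection \<open>Monoid algebras and algebras given by generators and relations\<close>

definition monoid_algebra :: "('g, 'm) monoid_scheme \<Rightarrow> ('c :: comm_ring_1, 'g \<Rightarrow>\<^sub>0 'c) module"
  where "monoid_algebra G =
    \<lparr> carrier = {f. Poly_Mapping.keys f \<subseteq> carrier G},
      monoid.mult = (\<lambda>f g. \<Sum>a\<in>Poly_Mapping.keys f. \<Sum>b\<in>Poly_Mapping.keys g.
        Poly_Mapping.single (a \<otimes>\<^bsub>G\<^esub> b) (Poly_Mapping.lookup f a * Poly_Mapping.lookup g b)),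
      one = Poly_Mapping.single \<one>\<^bsub>G\<^esub> 1,
      ring.zero = 0,
      add = (+),
      smult = (\<lambda>c. Poly_Mapping.map ((*) c)) \<rparr>"

definition free_monoid :: "'x list monoid"
  where "free_monoid = \<lparr> carrier = UNIV, monoid.mult = (@), one = [] \<rparr>"

abbreviation free_algebra :: "('c :: comm_ring_1, 'x list \<Rightarrow>\<^sub>0 'c) module"
  where "free_algebra \<equiv> monoid_algebra free_monoid"

definition gen :: "'x \<Rightarrow> ('x list \<Rightarrow>\<^sub>0 'c :: comm_ring_1)"
  where "gen v = Poly_Mapping.single [v] 1"

definition ring_commutator :: "('a, 'm) ring_scheme \<Rightarrow> 'a \<Rightarrow> 'a \<Rightarrow> 'a"
  where "ring_commutator A a b = (a \<otimes>\<^bsub>A\<^esub> b) \<ominus>\<^bsub>A\<^esub> (b \<otimes>\<^bsub>A\<^esub> a)"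

text \<open>The elements of the index type \<^typ>\<open>2\<close> are \<open>1\<close> and \<open>2\<close>.\<close>

datatype pq = P 2 | Q 2

definition idem_rels :: "(2 \<Rightarrow> 'x) \<Rightarrow> ('x list \<Rightarrow>\<^sub>0 'c :: comm_ring_1) set"
  where "idem_rels v =
    {gen (v i) \<otimes>\<^bsub>free_algebra\<^esub> gen (v j) \<ominus>\<^bsub>free_algebra\<^esub> (if i = j then gen (v i) else 0) | i j. True}"

definition comm_rel :: "'c ^ (2 \<times> 2) \<Rightarrow> (pq list \<Rightarrow>\<^sub>0 'c :: comm_ring_1)"
  where "comm_rel x = (\<Sum>i\<in>UNIV. \<Sum>j\<in>UNIV.
    (x $ (i, j)) \<odot>\<^bsub>free_algebra\<^esub> ring_commutator free_algebra (gen (P i)) (gen (Q j)))"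

definition S_alg :: "'c ^ (2 \<times> 2) \<Rightarrow> ('c :: comm_ring_1, (pq list \<Rightarrow>\<^sub>0 'c) set) module"
  where "S_alg x =
    free_algebra QuotA (Idl\<^bsub>free_algebra\<^esub> (idem_rels P \<union> idem_rels Q \<union> {comm_rel x}))"


subsection \<open>Base change\<close>

text \<open>
  The tensor product of two \<open>R\<close>-algebras \<open>A\<close> and \<open>B\<close>, viewed as a \<open>B\<close>-algebra through the second
  factor.  The free abelian group on \<open>A \<times> B\<close>, with the multiplication determined by
  \<open>(a, b) (a', b') = (a a', b b')\<close>, is the integral monoid ring of the multiplicative monoid of
  \<open>A \<times> B\<close>.  The additive subgroup generated by the balancing relations is stable under
  multiplication by basis elements on both sides, so it agrees with the ideal generated by them.
\<close>

abbreviation pure :: "'a \<Rightarrow> 'b \<Rightarrow> ('a \<times> 'b \<Rightarrow>\<^sub>0 int)"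
  where "pure a b \<equiv> Poly_Mapping.single (a, b) 1"

definition tensor_rels ::
    "('r, 'm) ring_scheme \<Rightarrow> ('r, 'a) module \<Rightarrow> ('r, 'b) module \<Rightarrow> ('a \<times> 'b \<Rightarrow>\<^sub>0 int) set"
  where "tensor_rels R A B =
    {pure (a \<oplus>\<^bsub>A\<^esub> a') b - pure a b - pure a' b |
        a a' b. a \<in> carrier A \<and> a' \<in> carrier A \<and> b \<in> carrier B} \<union>
    {pure a (b \<oplus>\<^bsub>B\<^esub> b') - pure a b - pure a b' |
        a b b'. a \<in> carrier A \<and> b \<in> carrier B \<and> b' \<in> carrier B} \<union>
    {pure (r \<odot>\<^bsub>A\<^esub> a) b - pure a (r \<odot>\<^bsub>B\<^esub> b) |
        r a b. r \<in> carrier R \<and> a \<in> carrier A \<and> b \<in> carrier B}"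

definition tensor_ideal ::
    "('r, 'm) ring_scheme \<Rightarrow> ('r, 'a) module \<Rightarrow> ('r, 'b) module \<Rightarrow> ('a \<times> 'b \<Rightarrow>\<^sub>0 int) set"
  where "tensor_ideal R A B =
    Idl\<^bsub>(monoid_algebra (A \<times>\<times> B) :: (int, _) module)\<^esub> (tensor_rels R A B)"

definition tensor_ring ::
    "('r, 'm) ring_scheme \<Rightarrow> ('r, 'a) module \<Rightarrow> ('r, 'b) module \<Rightarrow> ('a \<times> 'b \<Rightarrow>\<^sub>0 int) set ring"
  where "tensor_ring R A B =
    (monoid_algebra (A \<times>\<times> B) :: (int, _) module) Quot tensor_ideal R A B"

definition tensor_mk ::
    "('r, 'm) ring_scheme \<Rightarrow> ('r, 'a) module \<Rightarrow> ('r, 'b) module \<Rightarrow> 'a \<Rightarrow> 'b \<Rightarrow> ('a \<times> 'b \<Rightarrow>\<^sub>0 int) set"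
  where "tensor_mk R A B a b =
    tensor_ideal R A B +>\<^bsub>(monoid_algebra (A \<times>\<times> B) :: (int, _) module)\<^esub> pure a b"

definition base_change ::
    "('r, 'm) ring_scheme \<Rightarrow> ('r, 'a) module \<Rightarrow> ('r, 'b) module \<Rightarrow> ('b, ('a \<times> 'b \<Rightarrow>\<^sub>0 int) set) module"
  where "base_change R A B = ring.extend (tensor_ring R A B)
    (module.fields (\<lambda>b t. tensor_mk R A B \<one>\<^bsub>A\<^esub> b \<otimes>\<^bsub>tensor_ring R A B\<^esub> t))"


subsection \<open>Split algebras over a subfield\<close>

definition subfield_ring :: "'a :: field set \<Rightarrow> 'a ring"
  where "subfield_ring K = ring_of_type_algebra \<lparr> carrier := K \<rparr>"

definition diag_algebra :: "'a :: field set \<Rightarrow> ('a, 'a ^ 'n) module"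
  where "diag_algebra K =
    \<lparr> carrier = {v. \<forall>i. v $ i \<in> K}, monoid.mult = (*), one = 1, ring.zero = 0, add = (+),
      smult = (*s) \<rparr>"

definition mat_algebra :: "'a :: field set \<Rightarrow> ('a, 'a ^ 'n ^ 'n) module"
  where "mat_algebra K =
    \<lparr> carrier = {A. \<forall>i j. A $ i $ j \<in> K}, monoid.mult = (**), one = Finite_Cartesian_Product.mat 1,
      ring.zero = 0, add = (+), smult = (\<lambda>c A. \<chi> i j. c * A $ i $ j) \<rparr>"

definition split_9_3 :: "'a :: field set \<Rightarrow> ('a, ('a ^ 9) \<times> ('a ^ 3 ^ 3)) module"
  where "split_9_3 K = alg_dirprod (diag_algebra K) (mat_algebra K)"


subsection \<open>The generic algebra and the splitting field\<close>

text \<open>The field of rational functions in three variables, as the fraction field of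
  \<open>k[y\<^sub>1][y\<^sub>2][y\<^sub>3]\<close>.\<close>

type_synonym 'k ratfun3 = "'k poly poly poly fract"

definition ratvar1 :: "'k :: field ratfun3" where "ratvar1 = to_fract [:[:[:0, 1:]:]:]"
definition ratvar2 :: "'k :: field ratfun3" where "ratvar2 = to_fract [:[:0, 1:]:]"
definition ratvar3 :: "'k :: field ratfun3" where "ratvar3 = to_fract [:0, 1:]"

definition y_point :: "('k :: field ratfun3) ^ (2 \<times> 2)"
  where "y_point = (\<chi> ij. if ij = (1, 1) then 1 else if ij = (1, 2) then ratvar1
                          else if ij = (2, 1) then ratvar2 else ratvar3)"

definition generic_S ::
    "('k :: field ratfun3, (pq list \<Rightarrow>\<^sub>0 'k ratfun3) set) module"
  where "generic_S = S_alg y_point"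

definition c1 :: "'a \<Rightarrow> 'a \<Rightarrow> 'a \<Rightarrow> 'a \<Rightarrow> 'a \<Rightarrow> 'a :: comm_ring_1"
  where "c1 y1 y2 y3 z1 z2 =
    (y1*y2 + y3)*z1*z2 + y2*y3*z2^2 + y1*z1^2 - y2*y3*z2 - y1*z1"

definition c2 :: "'a \<Rightarrow> 'a \<Rightarrow> 'a \<Rightarrow> 'a \<Rightarrow> 'a \<Rightarrow> 'a :: comm_ring_1"
  where "c2 y1 y2 y3 z1 z2 =
    z1^2 + y2^2*z2^2 + 2*y2*z1*z2 + (- y1*y2 - 1 + y3)*z1
      + (- y1*y2^2 - y2^2 + y2*y3)*z2 + y2^2 + y1*y2 - y2 - y2*y3"

definition c3 :: "'a \<Rightarrow> 'a \<Rightarrow> 'a \<Rightarrow> 'a \<Rightarrow> 'a \<Rightarrow> 'a :: comm_ring_1"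
  where "c3 y1 y2 y3 z1 z2 =
    y1^2*z1^2 + y3^2*z2^2 + 2*y1*y3*z1*z2 + (y1^2*y2 - y1^2 - y1*y3)*z1
      + (y1*y2*y3 - 2*y3^2)*z2 + y1*y3 - y1^2*y3 - y1*y2*y3 + y1*y3^2"

definition common_zero ::
    "'k :: field ratfun3 alg_closure \<Rightarrow> 'k ratfun3 alg_closure \<Rightarrow> bool"
  where "common_zero z1 z2 \<longleftrightarrow>
    c1 (to_ac ratvar1) (to_ac ratvar2) (to_ac ratvar3) z1 z2 = 0 \<and>
    c2 (to_ac ratvar1) (to_ac ratvar2) (to_ac ratvar3) z1 z2 = 0 \<and>
    c3 (to_ac ratvar1) (to_ac ratvar2) (to_ac ratvar3) z1 z2 = 0"

definition field_adjoin2 :: "'a :: field alg_closure \<Rightarrow> 'a alg_closure \<Rightarrow> 'a alg_closure set"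
  where "field_adjoin2 z1 z2 = generate_field ring_of_type_algebra (range to_ac \<union> {z1, z2})"

text \<open>An intermediate field of a field and its algebraic closure, as an algebra over the base field.\<close>

definition ext_algebra :: "'a :: field alg_closure set \<Rightarrow> ('a, 'a alg_closure) module"
  where "ext_algebra K =
    ring.extend (subfield_ring K) (module.fields (\<lambda>c b. to_ac c * b))"


subsection \<open>Projective space and its Zariski topology\<close>

definition proj_rel :: "('k :: field ^ 'n) rel"
  where "proj_rel = {(x, y). x \<noteq> 0 \<and> y \<noteq> 0 \<and> (\<exists>c. c \<noteq> 0 \<and> y = c *s x)}"

definition proj_space :: "('k :: field ^ 'n) set set"
  where "proj_space = (UNIV - {0}) // proj_rel"

text \<open>Polynomials in variables indexed by \<open>'n\<close>: finitely supported functions from exponent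
  vectors to coefficients.\<close>

type_synonym ('n, 'k) mpol = "('n \<Rightarrow>\<^sub>0 nat) \<Rightarrow>\<^sub>0 'k"

definition mpol_eval :: "('n :: finite, 'k :: comm_ring_1) mpol \<Rightarrow> 'k ^ 'n \<Rightarrow> 'k"
  where "mpol_eval f x = (\<Sum>m\<in>Poly_Mapping.keys f.
    Poly_Mapping.lookup f m * (\<Prod>i\<in>UNIV. (x $ i) ^ Poly_Mapping.lookup m i))"

definition mpol_homogeneous :: "('n :: finite, 'k :: comm_ring_1) mpol \<Rightarrow> bool"
  where "mpol_homogeneous f \<longleftrightarrow>
    (\<exists>d. \<forall>m\<in>Poly_Mapping.keys f. (\<Sum>i\<in>UNIV. Poly_Mapping.lookup m i) = d)"

definition zariski_closed :: "('k :: field ^ 'n :: finite) set set \<Rightarrow> bool"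
  where "zariski_closed C \<longleftrightarrow>
    (\<exists>T :: ('n, 'k) mpol set. (\<forall>f\<in>T. mpol_homogeneous f) \<and>
       C = {Y \<in> proj_space. \<forall>x\<in>Y. \<forall>f\<in>T. mpol_eval f x = 0})"

definition zariski_open :: "('k :: field ^ 'n :: finite) set set \<Rightarrow> bool"
  where "zariski_open U \<longleftrightarrow> U \<subseteq> proj_space \<and> zariski_closed (proj_space - U)"

end

theory Submission
  imports Defs
begin

text \<open>
  Put \<open>p\<^sub>3 = 1 - p\<^sub>1 - p\<^sub>2\<close>, \<open>q\<^sub>3 = 1 - q\<^sub>1 - q\<^sub>2\<close> and pad \<open>x\<close> by zeros to a \<open>3 \<times> 3\<close> matrix.  For \<open>k \<noteq> l\<close>
  the commutator relation, multiplied by \<open>p\<^sub>k\<close> on the left and \<open>p\<^sub>l\<close> on the right, says that the three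
  elements \<open>p\<^sub>k q\<^sub>j p\<^sub>l\<close> are fixed multiples of a single \<open>e\<^sub>k\<^sub>l\<close>.  Sandwiching \<open>q\<^sub>i q\<^sub>j = \<delta>\<^sub>i\<^sub>j q\<^sub>i\<close> in the
  same way forces \<open>e\<^sub>k\<^sub>m e\<^sub>m\<^sub>l = e\<^sub>k\<^sub>l\<close> for distinct indices, so the \<open>e\<^sub>k\<^sub>l\<close> extend to \<open>3 \<times> 3\<close> matrix units,
  and what is left of the nine elements \<open>p\<^sub>k q\<^sub>j p\<^sub>k\<close> after removing their matrix unit component are
  orthogonal idempotents that annihilate the matrix units.  These 18 elements span \<open>S\<^sub>x\<close>.
  Conversely \<open>S\<^sub>x\<close> has nine characters and, as soon as \<open>x\<close> avoids ten explicit hypersurfaces, a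
  representation on \<open>k\<^sup>3\<close> with \<open>p\<^sub>k = E\<^sub>k\<^sub>k\<close> and \<open>q\<^sub>j\<close> of rank one, given by rational functions of \<open>x\<close>.
  These send the 18 elements to the standard basis of \<open>k\<^sup>9 \<oplus> M\<^sub>3(k)\<close>.

  The argument works over every field in which \<open>2 \<noteq> 0\<close>.  In particular the generic algebra already
  splits over the field of rational functions, and the first claim follows by extension of scalars.
\<close>

subsection \<open>Congruence modulo an ideal\<close>

text \<open>The quotient by \<open>I\<close> is handled through representatives and the relation
  \<open>cong\<close>: sums and differences stay those of the type \<open>'r\<close>, and no coset
  appears in the calculations.\<close>

locale cong_algebra =
  fixes mult :: "'r::ab_group_add \<Rightarrow> 'r \<Rightarrow> 'r" (infixl \<open>\<star>\<close> 70)
    and unit :: 'r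
    and scale :: "'c::field \<Rightarrow> 'r \<Rightarrow> 'r" (infixr \<open>*\<^sub>c\<close> 75)
    and I :: "'r set"
  assumes mult_assoc: "(a \<star> b) \<star> c = a \<star> (b \<star> c)"
    and mult_distrib_right: "(a + b) \<star> c = a \<star> c + b \<star> c"
    and mult_distrib_left: "a \<star> (b + c) = a \<star> b + a \<star> c"
    and unit_left [simp]: "unit \<star> a = a"
    and unit_right [simp]: "a \<star> unit = a"
    and scale_add_left: "(s + t) *\<^sub>c a = s *\<^sub>c a + t *\<^sub>c a"
    and scale_add_right: "s *\<^sub>c (a + b) = s *\<^sub>c a + s *\<^sub>c b"
    and scale_scale [simp]: "s *\<^sub>c t *\<^sub>c a = (s * t) *\<^sub>c a"
    and scale_one [simp]: "1 *\<^sub>c a = a"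
    and scale_mult_left: "(s *\<^sub>c a) \<star> b = s *\<^sub>c (a \<star> b)"
    and scale_mult_right: "a \<star> (s *\<^sub>c b) = s *\<^sub>c (a \<star> b)"
    and I_zero: "0 \<in> I"
    and I_add: "a \<in> I \<Longrightarrow> b \<in> I \<Longrightarrow> a + b \<in> I"
    and I_mult_left: "a \<in> I \<Longrightarrow> b \<star> a \<in> I"
    and I_mult_right: "a \<in> I \<Longrightarrow> a \<star> b \<in> I"
begin

lemma mult_zero_right [simp]: "a \<star> 0 = 0"
  using mult_distrib_left[of a 0 0] by simp

lemma mult_zero_left [simp]: "0 \<star> a = 0"
  using mult_distrib_right[of 0 0 a] by simp

lemma scale_zero_left [simp]: "0 *\<^sub>c a = 0"
  using scale_add_left[of 0 0 a] by simp

lemma scale_zero_right [simp]: "s *\<^sub>c 0 = 0"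
  using scale_add_right[of s 0 0] by simp

lemma mult_minus_right: "a \<star> (- b) = - (a \<star> b)"
  using mult_distrib_left[of a b "- b"] by (simp add: minus_unique)

lemma mult_minus_left: "(- a) \<star> b = - (a \<star> b)"
  using mult_distrib_right[of a "- a" b] by (simp add: minus_unique)

lemma scale_minus_right: "s *\<^sub>c (- a) = - (s *\<^sub>c a)"
  using scale_add_right[of s a "- a"] by (simp add: minus_unique)

lemma scale_minus_left: "(- s) *\<^sub>c a = - (s *\<^sub>c a)"
  using scale_add_left[of s "- s" a] by (simp add: minus_unique)

lemma mult_diff_right: "a \<star> (b - c) = a \<star> b - a \<star> c"
  using mult_distrib_left[of a b "- c"] by (simp add: mult_minus_right)

lemma mult_diff_left: "(a - b) \<star> c = a \<star> c - b \<star> c"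
  using mult_distrib_right[of a "- b" c] by (simp add: mult_minus_left)

lemma scale_diff_right: "s *\<^sub>c (a - b) = s *\<^sub>c a - s *\<^sub>c b"
  using scale_add_right[of s a "- b"] by (simp add: scale_minus_right)

lemma scale_diff_left: "(s - t) *\<^sub>c a = s *\<^sub>c a - t *\<^sub>c a"
  using scale_add_left[of s "- t" a] by (simp add: scale_minus_left)

lemmas distribs = mult_distrib_right mult_distrib_left mult_diff_right mult_diff_left
  mult_minus_left mult_minus_right scale_add_right scale_diff_right scale_minus_right
  scale_mult_left scale_mult_right

lemma mult_sum_right: "a \<star> (\<Sum>i\<in>A. f i) = (\<Sum>i\<in>A. a \<star> f i)"
  by (induction A rule: infinite_finite_induct) (simp_all add: mult_distrib_left)

lemma mult_sum_left: "(\<Sum>i\<in>A. f i) \<star> a = (\<Sum>i\<in>A. f i \<star> a)"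
  by (induction A rule: infinite_finite_induct) (simp_all add: mult_distrib_right)

lemma scale_sum_right: "s *\<^sub>c (\<Sum>i\<in>A. f i) = (\<Sum>i\<in>A. s *\<^sub>c f i)"
  by (induction A rule: infinite_finite_induct) (simp_all add: scale_add_right)

lemma scale_sum_left: "(\<Sum>i\<in>A. f i) *\<^sub>c a = (\<Sum>i\<in>A. f i *\<^sub>c a)"
  by (induction A rule: infinite_finite_induct) (simp_all add: scale_add_left)

lemma I_scale: "a \<in> I \<Longrightarrow> s *\<^sub>c a \<in> I"
  using I_mult_left[of a "s *\<^sub>c unit"] by (simp add: scale_mult_left)

lemma I_minus: "a \<in> I \<Longrightarrow> - a \<in> I"
  using I_scale[of a "- 1"] by (simp add: scale_minus_left)

definition cong :: "'r \<Rightarrow> 'r \<Rightarrow> bool"  (infix \<open>\<doteq>\<close> 50)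
  where "a \<doteq> b \<longleftrightarrow> a - b \<in> I"

lemma cong_refl [simp, intro!]: "a \<doteq> a"
  by (simp add: cong_def I_zero)

lemma cong_sym: "a \<doteq> b \<Longrightarrow> b \<doteq> a"
  using I_minus[of "a - b"] by (simp add: cong_def)

lemma cong_trans [trans]: "a \<doteq> b \<Longrightarrow> b \<doteq> c \<Longrightarrow> a \<doteq> c"
  using I_add[of "a - b" "b - c"] by (simp add: cong_def)

lemma cong_eq_trans [trans]: "a \<doteq> b \<Longrightarrow> b = c \<Longrightarrow> a \<doteq> c"
  and eq_cong_trans [trans]: "a = b \<Longrightarrow> b \<doteq> c \<Longrightarrow> a \<doteq> c"
  by simp_all

lemma cong_add: "a \<doteq> b \<Longrightarrow> c \<doteq> d \<Longrightarrow> a + c \<doteq> b + d"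
  using I_add[of "a - b" "c - d"] by (simp add: cong_def algebra_simps)

lemma cong_minus: "a \<doteq> b \<Longrightarrow> - a \<doteq> - b"
  using I_minus[of "a - b"] by (simp add: cong_def algebra_simps)

lemma cong_diff: "a \<doteq> b \<Longrightarrow> c \<doteq> d \<Longrightarrow> a - c \<doteq> b - d"
  using cong_add[of a b "- c" "- d"] cong_minus by simp

lemma cong_scale: "a \<doteq> b \<Longrightarrow> s *\<^sub>c a \<doteq> s *\<^sub>c b"
  using I_scale[of "a - b" s] by (simp add: cong_def scale_diff_right)

lemma cong_mult: "a \<doteq> b \<Longrightarrow> c \<doteq> d \<Longrightarrow> a \<star> c \<doteq> b \<star> d"
proof -
  assume "a \<doteq> b" "c \<doteq> d"
  then have "(a - b) \<star> c + b \<star> (c - d) \<in> I"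
    by (auto simp: cong_def intro: I_add I_mult_left I_mult_right)
  then show ?thesis by (simp add: cong_def mult_diff_left mult_diff_right)
qed

lemma cong_sum: "(\<And>i. i \<in> A \<Longrightarrow> f i \<doteq> g i) \<Longrightarrow> (\<Sum>i\<in>A. f i) \<doteq> (\<Sum>i\<in>A. g i)"
  by (induction A rule: infinite_finite_induct) (simp_all add: cong_add)

lemma cong_scale_cancel: "s *\<^sub>c a \<doteq> s *\<^sub>c b \<Longrightarrow> s \<noteq> 0 \<Longrightarrow> a \<doteq> b"
  using cong_scale[of "s *\<^sub>c a" "s *\<^sub>c b" "inverse s"] by simp

lemma cong_iff_diff: "a \<doteq> b \<longleftrightarrow> a - b \<doteq> 0"
  by (simp add: cong_def)

lemmas congs = cong_add cong_minus cong_diff cong_scale cong_mult cong_sum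

end

subsection \<open>Matrix units from the relations\<close>

lemma third_index: "\<exists>m::3. m \<noteq> k \<and> m \<noteq> l"
proof -
  have "card {k, l} < CARD(3)"
    by (rule le_less_trans[OF card_insert_le_m1[of 2]]) auto
  then have "UNIV \<noteq> {k, l}" by auto
  then show ?thesis by auto
qed

lemma UNIV_3_distinct:
  assumes "distinct [k, l, m :: 3]"
  shows "(UNIV :: 3 set) = {k, l, m}"
  by (rule sym, rule card_subset_eq) (use assms in auto)

lemma sum_3_distinct:
  assumes "distinct [k, l, m :: 3]"
  shows "(\<Sum>i\<in>UNIV. f i) = f k + f l + (f m :: 'a :: comm_monoid_add)"
  unfolding UNIV_3_distinct[OF assms] using assms by (simp add: add.assoc)

text \<open>
  In the representation on \<open>k\<^sup>3\<close>, \<open>q j\<close> is the rank one matrix with entries \<open>g k j * h j l\<close>.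
\<close>

locale idem_pairs = cong_algebra mult unit scale I
  for mult :: "'r::ab_group_add \<Rightarrow> 'r \<Rightarrow> 'r" (infixl \<open>\<star>\<close> 70)
    and unit :: 'r
    and scale :: "'c::field \<Rightarrow> 'r \<Rightarrow> 'r" (infixr \<open>*\<^sub>c\<close> 75)
    and I :: "'r set" +
  fixes p q :: "3 \<Rightarrow> 'r" and y g h :: "3 \<Rightarrow> 3 \<Rightarrow> 'c"
  assumes p_idem: "p i \<star> p j \<doteq> (if i = j then p i else 0)"
    and q_idem: "q i \<star> q j \<doteq> (if i = j then q i else 0)"
    and p_sum: "(\<Sum>i\<in>UNIV. p i) = unit"
    and q_sum: "(\<Sum>i\<in>UNIV. q i) = unit"
    and pq_rel: "(\<Sum>i\<in>UNIV. \<Sum>j\<in>UNIV. y i j *\<^sub>c (p i \<star> q j - q j \<star> p i)) \<doteq> 0"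
    and gh: "(\<Sum>j\<in>UNIV. g k j * h j l) = (if k = l then 1 else 0)"
    and hg: "(\<Sum>k\<in>UNIV. h i k * g k j) = (if i = j then 1 else 0)"
    and ygh: "k \<noteq> l \<Longrightarrow> (\<Sum>j\<in>UNIV. (y k j - y l j) * (g k j * h j l)) = 0"
    and y_nz: "k \<noteq> l \<Longrightarrow> y k 2 - y l 2 \<noteq> y k 3 - y l 3"
    and g_nz: "g k j \<noteq> 0" and h_nz: "h j k \<noteq> 0"
    and g_minor: "k \<noteq> l \<Longrightarrow> g k 1 * g l 2 \<noteq> g l 1 * g k 2"
    and h_minor: "k \<noteq> l \<Longrightarrow> h 1 k * h 2 l \<noteq> h 1 l * h 2 k"
    and two_nz: "(2 :: 'c) \<noteq> 0"
begin

text \<open>The scaling of \<open>e\<close> is chosen such that it represents a matrix unit.\<close>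

definition B :: "3 \<Rightarrow> 3 \<Rightarrow> 3 \<Rightarrow> 'r" where "B j k l = p k \<star> (q j \<star> p l)"
definition C :: "3 \<Rightarrow> 3 \<Rightarrow> 3 \<Rightarrow> 'c" where "C j k l = g k j * h j l"
definition e :: "3 \<Rightarrow> 3 \<Rightarrow> 'r" where "e k l = (1 / C 1 k l) *\<^sub>c B 1 k l"

lemma C_nz [simp]: "C j k l \<noteq> 0"
  by (simp add: C_def g_nz h_nz)

text \<open>As matrices, the \<open>C j\<close> are column j of g times row j of h. Since h g is the
  identity, they are orthogonal idempotents and satisfy the relations of the q's.\<close>

lemma C_comp: "(\<Sum>m\<in>UNIV. C i k m * C j m l) = (if i = j then C i k l else 0)"
proof -
  have "(\<Sum>m\<in>UNIV. C i k m * C j m l) = g k i * (\<Sum>m\<in>UNIV. h i m * g m j) * h j l"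
    by (simp add: C_def sum_distrib_left sum_distrib_right mult.assoc)
  also have "\<dots> = (if i = j then C i k l else 0)"
    by (simp add: hg C_def)
  finally show ?thesis .
qed

section \<open>Sandwiching the relations between two p's\<close>

lemma B_sum: "(\<Sum>j\<in>UNIV. B j k l) \<doteq> (if k = l then p k else 0)"
proof -
  have "(\<Sum>j\<in>UNIV. B j k l) = p k \<star> ((\<Sum>j\<in>UNIV. q j) \<star> p l)"
    by (simp add: B_def mult_sum_left mult_sum_right)
  also have "\<dots> = p k \<star> p l" by (simp add: q_sum)
  also have "\<dots> \<doteq> (if k = l then p k else 0)" by (rule p_idem)
  finally show ?thesis .
qed

text \<open>Multiply the commutator relation by \<open>p k\<close> on the left and
  \<open>p l\<close> on the right. Only row k of \<open>y\<close> survives in the first product and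
  only row l in the second.\<close>

lemma B_rel:
  assumes "k \<noteq> l"
  shows "(\<Sum>j\<in>UNIV. (y k j - y l j) *\<^sub>c B j k l) \<doteq> 0"
proof -
  \<comment> \<open>The Kronecker deltas are introduced so that they can be replaced by the products
    of p's they stand for, which rebuilds the sandwiched relation.\<close>
  have "(\<Sum>j\<in>UNIV. (y k j - y l j) *\<^sub>c B j k l) =
      (\<Sum>i\<in>UNIV. \<Sum>j\<in>UNIV. y i j *\<^sub>c ((if k = i then p k else 0) \<star> (q j \<star> p l)
        - (p k \<star> q j) \<star> (if i = l then p i else 0)))"
    by (simp add: sum_subtractf scale_diff_right scale_diff_left B_def mult_assoc if_distrib[of "\<lambda>x. x \<star> _"]
          if_distrib[of "\<lambda>x. _ \<star> x"] if_distrib[of "(*\<^sub>c) _"] sum.swap[of _ UNIV UNIV] cong: if_cong)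
  also have "\<dots> \<doteq> (\<Sum>i\<in>UNIV. \<Sum>j\<in>UNIV. y i j *\<^sub>c ((p k \<star> p i) \<star> (q j \<star> p l)
        - (p k \<star> q j) \<star> (p i \<star> p l)))"
    by (intro congs cong_refl cong_sym[OF p_idem])
  also have "\<dots> = p k \<star> ((\<Sum>i\<in>UNIV. \<Sum>j\<in>UNIV. y i j *\<^sub>c (p i \<star> q j - q j \<star> p i)) \<star> p l)"
    by (simp add: mult_sum_left mult_sum_right distribs mult_assoc)
  also have "\<dots> \<doteq> p k \<star> (0 \<star> p l)"
    by (intro congs cong_refl pq_rel)
  finally show ?thesis by simp
qed

lemma p_idem_mult: "p i \<star> (p j \<star> a) \<doteq> (if i = j then p i \<star> a else 0)"
  using cong_mult[OF p_idem cong_refl, of i j a] by (simp add: mult_assoc split: if_splits)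

lemma q_idem_mult: "q i \<star> (q j \<star> a) \<doteq> (if i = j then q i \<star> a else 0)"
  using cong_mult[OF q_idem cong_refl, of i j a] by (simp add: mult_assoc split: if_splits)

lemma p_B: "p k \<star> B j k l \<doteq> B j k l"
  using p_idem_mult[of k k "q j \<star> p l"] by (simp add: B_def)

lemma B_p: "B j k l \<star> p l \<doteq> B j k l"
  using cong_mult[OF cong_refl p_idem, of "p k \<star> q j" l l] by (simp add: B_def mult_assoc)

text \<open>Insert \<open>unit\<close> as the sum of the \<open>p m\<close> between the two q's and
  use each \<open>p m\<close> twice, so that every term splits into two sandwiches.\<close>

lemma B_comp: "(\<Sum>m\<in>UNIV. B i k m \<star> B j m l) \<doteq> (if i = j then B i k l else 0)"
proof -
  have "(\<Sum>m\<in>UNIV. B i k m \<star> B j m l) = (\<Sum>m\<in>UNIV. p k \<star> (q i \<star> (p m \<star> (p m \<star> (q j \<star> p l)))))"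
    by (simp add: B_def mult_assoc)
  also have "\<dots> \<doteq> (\<Sum>m\<in>UNIV. p k \<star> (q i \<star> (p m \<star> (q j \<star> p l))))"
    by (intro congs cong_refl cong_eq_trans[OF p_idem_mult]) simp
  also have "\<dots> = p k \<star> (q i \<star> ((\<Sum>m\<in>UNIV. p m) \<star> (q j \<star> p l)))"
    by (simp add: mult_sum_left mult_sum_right)
  also have "\<dots> = p k \<star> (q i \<star> (q j \<star> p l))" by (simp add: p_sum)
  also have "\<dots> \<doteq> p k \<star> (if i = j then q i \<star> p l else 0)"
    by (intro congs cong_refl q_idem_mult)
  also have "\<dots> = (if i = j then B i k l else 0)" by (simp add: B_def)
  finally show ?thesis .
qed

text \<open>The errors \<open>Z j\<close> satisfy the two linear relations \<open>B_sum\<close> and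
  \<open>B_rel\<close>, because the \<open>C j k l\<close> satisfy them too by \<open>gh\<close> and
  \<open>ygh\<close>. With \<open>Z 1 = 0\<close>, this is a 2 by 2 system for \<open>Z 2\<close>
  and \<open>Z 3\<close> whose determinant is nonzero by \<open>y_nz\<close>.\<close>

lemma B_eq_e:
  assumes "k \<noteq> l"
  shows "B j k l \<doteq> C j k l *\<^sub>c e k l"
proof -
  define Z where "Z i = B i k l - C i k l *\<^sub>c e k l" for i
  have Z1: "Z 1 = 0" by (simp add: Z_def e_def)
  have C0: "(\<Sum>i\<in>UNIV. C i k l) = 0"
    using gh[of k l] assms by (simp add: C_def)
  have "(\<Sum>i\<in>UNIV. Z i) = (\<Sum>i\<in>UNIV. B i k l) - (\<Sum>i\<in>UNIV. C i k l) *\<^sub>c e k l"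
    by (simp add: Z_def sum_subtractf scale_sum_left)
  also have "\<dots> \<doteq> 0" using B_sum[of k l] assms C0 by simp
  finally have s1: "Z 2 + Z 3 \<doteq> 0" by (simp add: sum_3 Z1)
  have "(\<Sum>i\<in>UNIV. (y k i - y l i) *\<^sub>c Z i) = (\<Sum>i\<in>UNIV. (y k i - y l i) *\<^sub>c B i k l)
      - (\<Sum>i\<in>UNIV. (y k i - y l i) * C i k l) *\<^sub>c e k l"
    by (simp add: Z_def sum_subtractf scale_sum_left scale_diff_right)
  also have "\<dots> \<doteq> 0"
    using B_rel[OF assms] ygh[OF assms] by (simp add: C_def)
  finally have s2: "(y k 2 - y l 2) *\<^sub>c Z 2 + (y k 3 - y l 3) *\<^sub>c Z 3 \<doteq> 0"
    by (simp add: sum_3 Z1)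
  have "((y k 2 - y l 2) - (y k 3 - y l 3)) *\<^sub>c Z 2 =
      ((y k 2 - y l 2) *\<^sub>c Z 2 + (y k 3 - y l 3) *\<^sub>c Z 3) - (y k 3 - y l 3) *\<^sub>c (Z 2 + Z 3)"
    by (simp only: scale_diff_left scale_add_right) simp
  also have "\<dots> \<doteq> 0 - (y k 3 - y l 3) *\<^sub>c 0" by (intro congs s1 s2)
  finally have "((y k 2 - y l 2) - (y k 3 - y l 3)) *\<^sub>c Z 2 \<doteq>
      ((y k 2 - y l 2) - (y k 3 - y l 3)) *\<^sub>c 0" by simp
  then have Z2: "Z 2 \<doteq> 0"
    by (rule cong_scale_cancel) (use y_nz[OF assms] in simp)
  have "Z 3 = (Z 2 + Z 3) - Z 2" by simp
  also have "\<dots> \<doteq> 0 - 0" by (intro congs s1 Z2)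
  finally have "Z 3 \<doteq> 0" by simp
  then have "Z j \<doteq> 0" using Z1 Z2 exhaust_3[of j] by auto
  then show ?thesis by (subst cong_iff_diff) (simp add: Z_def)
qed

lemma p_e: "p k \<star> e k l \<doteq> e k l" and e_p: "e k l \<star> p l \<doteq> e k l"
  by (simp_all add: e_def distribs cong_scale p_B B_p)

text \<open>This is the (k, l) entry of \<open>q i \<star> q j\<close>, expanded over the middle
  indices k, l and m, minus the same expansion for the scalars C. Off-diagonal factors have become
  multiples of the e's, so each summand measures one multiplication rule still to be proved.\<close>

lemma diag_cancel:
  assumes klm: "distinct [k, l, m]"
  shows "C j k l *\<^sub>c (B i k k \<star> e k l - C i k k *\<^sub>c e k l)
    + C i k l *\<^sub>c (e k l \<star> B j l l - C j l l *\<^sub>c e k l)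
    + (C i k m * C j m l) *\<^sub>c (e k m \<star> e m l - e k l) \<doteq> 0" (is "?L \<doteq> 0")
proof -
  from klm have ne: "k \<noteq> l" "k \<noteq> m" "m \<noteq> l" by auto
  let ?d = "if i = j then C i k l else 0"
  have "C i k k * C j k l + C i k l * C j l l + C i k m * C j m l = ?d"
    using C_comp[of i k j l] by (simp add: sum_3_distinct[OF klm])
  then have d: "C j k l * C i k k = ?d - C i k l * C j l l - C i k m * C j m l"
    by (simp add: algebra_simps)
  have "?L = (B i k k \<star> (C j k l *\<^sub>c e k l) + (C i k l *\<^sub>c e k l) \<star> B j l l
      + (C i k m *\<^sub>c e k m) \<star> (C j m l *\<^sub>c e m l)) - ?d *\<^sub>c e k l"
    unfolding scale_diff_right scale_scale d
    by (simp add: distribs scale_diff_left del: if_distrib) (simp add: algebra_simps)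
  also have "\<dots> \<doteq> (B i k k \<star> B j k l + B i k l \<star> B j l l + B i k m \<star> B j m l) - ?d *\<^sub>c e k l"
    by (intro congs cong_refl cong_sym[OF B_eq_e] ne)
  also have "\<dots> = (\<Sum>m\<in>UNIV. B i k m \<star> B j m l) - ?d *\<^sub>c e k l"
    by (simp add: sum_3_distinct[OF klm])
  also have "\<dots> \<doteq> (if i = j then B i k l else 0) - ?d *\<^sub>c e k l"
    by (intro congs cong_refl B_comp)
  also have "\<dots> \<doteq> (if i = j then C i k l *\<^sub>c e k l else 0) - ?d *\<^sub>c e k l"
    using B_eq_e[OF ne(1)] by (intro congs cong_refl) auto
  finally show ?thesis by (simp split: if_splits)
qed

text \<open>
  Dividing \<open>diag_cancel\<close> by \<open>C i k l * C j k l\<close> gives \<open>F i + G j + \<sigma> i j *\<^sub>c w \<doteq> 0\<close>; the alternating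
  sum over \<open>i, j \<in> {1, 2}\<close> eliminates \<open>F\<close> and \<open>G\<close>, and the coefficient of \<open>w\<close> that remains is a
  product of two minors.
\<close>

lemma e_e:
  assumes klm: "distinct [k, l, m]"
  shows "e k m \<star> e m l \<doteq> e k l"
proof -
  from klm have ne: "k \<noteq> l" "k \<noteq> m" "m \<noteq> l" by auto
  define w where "w = e k m \<star> e m l - e k l"
  define F where "F i = (1 / C i k l) *\<^sub>c (B i k k \<star> e k l - C i k k *\<^sub>c e k l)" for i
  define G where "G j = (1 / C j k l) *\<^sub>c (e k l \<star> B j l l - C j l l *\<^sub>c e k l)" for j
  define \<sigma> where "\<sigma> i j = (C i k m * C j m l) / (C i k l * C j k l)" for i j
  have FG: "F i + G j + \<sigma> i j *\<^sub>c w \<doteq> 0" for i j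
    using cong_scale[OF diag_cancel[OF klm, where i = i and j = j], of "1 / (C i k l * C j k l)"]
    by (simp add: F_def G_def \<sigma>_def w_def scale_add_right)
  have "(\<sigma> 1 1 - \<sigma> 1 2 - \<sigma> 2 1 + \<sigma> 2 2) *\<^sub>c w = (F 1 + G 1 + \<sigma> 1 1 *\<^sub>c w) - (F 1 + G 2 + \<sigma> 1 2 *\<^sub>c w)
      - (F 2 + G 1 + \<sigma> 2 1 *\<^sub>c w) + (F 2 + G 2 + \<sigma> 2 2 *\<^sub>c w)"
    by (simp add: scale_diff_left scale_add_left)
  also have "\<dots> \<doteq> 0 - 0 - 0 + 0" by (intro congs FG)
  finally have "(\<sigma> 1 1 - \<sigma> 1 2 - \<sigma> 2 1 + \<sigma> 2 2) *\<^sub>c w \<doteq> (\<sigma> 1 1 - \<sigma> 1 2 - \<sigma> 2 1 + \<sigma> 2 2) *\<^sub>c 0"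
    by simp
  moreover have "\<sigma> 1 1 - \<sigma> 1 2 - \<sigma> 2 1 + \<sigma> 2 2 =
      (h 1 m / h 1 l - h 2 m / h 2 l) * (g m 1 / g k 1 - g m 2 / g k 2)"
    using g_nz h_nz by (simp add: \<sigma>_def C_def field_simps)
  moreover have "h 1 m / h 1 l - h 2 m / h 2 l \<noteq> 0" "g m 1 / g k 1 - g m 2 / g k 2 \<noteq> 0"
    using g_minor[of m k] h_minor[of m l] ne g_nz h_nz by (auto simp: field_simps)
  ultimately have "w \<doteq> 0"
    using cong_scale_cancel by (metis mult_eq_0_iff)
  then show ?thesis by (subst cong_iff_diff) (simp add: w_def)
qed

definition f :: "3 \<Rightarrow> 3 \<Rightarrow> 'r" where "f i k = B i k k - C i k k *\<^sub>c p k"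

text \<open>Take \<open>i = j\<close> in \<open>diag_cancel\<close>: the third summand vanishes by
  \<open>e_e\<close>, and the first two carry the same nonzero factor \<open>C i k l\<close>. The
  scalar parts of f involve \<open>p k\<close> and \<open>p l\<close>, which act as identities on
  \<open>e k l\<close>.\<close>

lemma f_e_anti:
  assumes "k \<noteq> l"
  shows "f i k \<star> e k l \<doteq> - (e k l \<star> f i l)"
proof -
  obtain m where "m \<noteq> k" "m \<noteq> l" using third_index by blast
  with assms have klm: "distinct [k, l, m]" by auto
  let ?F = "B i k k \<star> e k l - C i k k *\<^sub>c e k l"
  let ?G = "e k l \<star> B i l l - C i l l *\<^sub>c e k l"
  have "C i k l *\<^sub>c (?F + ?G) = (C i k l *\<^sub>c ?F + C i k l *\<^sub>c ?G
      + (C i k m * C i m l) *\<^sub>c (e k m \<star> e m l - e k l)) - (C i k m * C i m l) *\<^sub>c (e k m \<star> e m l - e k l)"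
    by (simp add: scale_add_right)
  also have "\<dots> \<doteq> 0 - (C i k m * C i m l) *\<^sub>c (e k l - e k l)"
    by (intro congs diag_cancel[OF klm] e_e[OF klm] cong_refl)
  finally have "C i k l *\<^sub>c (?F + ?G) \<doteq> C i k l *\<^sub>c 0" by simp
  then have FG: "?F + ?G \<doteq> 0" by (rule cong_scale_cancel) simp
  have "f i k \<star> e k l + e k l \<star> f i l = B i k k \<star> e k l - C i k k *\<^sub>c (p k \<star> e k l)
      + (e k l \<star> B i l l - C i l l *\<^sub>c (e k l \<star> p l))"
    by (simp add: f_def distribs)
  also have "\<dots> \<doteq> ?F + ?G" by (intro congs cong_refl p_e e_p)
  also note FG
  finally show ?thesis by (subst cong_iff_diff) simp
qed

text \<open>Moving \<open>f\<close> past \<open>e k l\<close> changes the sign once, past \<open>e k m \<star> e m l\<close> twice.\<close>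

lemma f_e:
  assumes "k \<noteq> l"
  shows "f i k \<star> e k l \<doteq> 0"
proof -
  obtain m where "m \<noteq> k" "m \<noteq> l" using third_index by blast
  with assms have klm: "distinct [k, l, m]" and ne: "k \<noteq> m" "m \<noteq> l" by auto
  have "f i k \<star> e k l \<doteq> f i k \<star> (e k m \<star> e m l)"
    by (intro congs cong_refl cong_sym[OF e_e] klm)
  also have "\<dots> = (f i k \<star> e k m) \<star> e m l" by (simp add: mult_assoc)
  also have "\<dots> \<doteq> - (e k m \<star> f i m) \<star> e m l" by (intro congs cong_refl f_e_anti ne)
  also have "\<dots> = - (e k m \<star> (f i m \<star> e m l))" by (simp add: mult_assoc mult_minus_left)
  also have "\<dots> \<doteq> - (e k m \<star> (- (e m l \<star> f i l)))" by (intro congs cong_refl f_e_anti ne)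
  also have "\<dots> = (e k m \<star> e m l) \<star> f i l" by (simp add: mult_assoc mult_minus_right)
  also have "\<dots> \<doteq> e k l \<star> f i l" by (intro congs cong_refl e_e klm)
  also have "\<dots> = - (- (e k l \<star> f i l))" by simp
  also have "\<dots> \<doteq> - (f i k \<star> e k l)" by (intro congs cong_sym[OF f_e_anti] assms)
  finally have "f i k \<star> e k l \<doteq> - (f i k \<star> e k l)" .
  from cong_add[OF cong_refl[of "f i k \<star> e k l"] this]
  have "(1 + 1) *\<^sub>c (f i k \<star> e k l) \<doteq> (1 + 1) *\<^sub>c 0" by (simp only: scale_add_left) simp
  then show ?thesis by (rule cong_scale_cancel) (use two_nz in simp)
qed

lemma e_f: "k \<noteq> l \<Longrightarrow> e k l \<star> f i l \<doteq> 0"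
  using cong_trans[OF cong_minus[OF cong_sym[OF f_e_anti]] cong_minus[OF f_e]] by simp

lemma B_e: "k \<noteq> l \<Longrightarrow> B i k k \<star> e k l \<doteq> C i k k *\<^sub>c e k l"
proof -
  assume "k \<noteq> l"
  have "B i k k \<star> e k l = f i k \<star> e k l + C i k k *\<^sub>c (p k \<star> e k l)"
    by (simp add: f_def distribs)
  also have "\<dots> \<doteq> 0 + C i k k *\<^sub>c e k l" by (intro congs f_e p_e \<open>k \<noteq> l\<close>)
  finally show ?thesis by simp
qed

lemma e_B: "k \<noteq> l \<Longrightarrow> e k l \<star> B i l l \<doteq> C i l l *\<^sub>c e k l"
proof -
  assume "k \<noteq> l"
  have "e k l \<star> B i l l = e k l \<star> f i l + C i l l *\<^sub>c (e k l \<star> p l)"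
    by (simp add: f_def distribs)
  also have "\<dots> \<doteq> 0 + C i l l *\<^sub>c e k l" by (intro congs e_f e_p \<open>k \<noteq> l\<close>)
  finally show ?thesis by simp
qed

section \<open>The diagonal matrix units\<close>

lemma e_loop:
  assumes "l \<noteq> k" "m \<noteq> k"
  shows "e k l \<star> e l k \<doteq> e k m \<star> e m k"
proof (cases "l = m")
  case False
  with assms have klm: "distinct [k, l, m]" "distinct [m, k, l]" by auto
  have "e k l \<star> e l k \<doteq> (e k m \<star> e m l) \<star> e l k"
    by (intro congs cong_refl cong_sym[OF e_e] klm)
  also have "\<dots> = e k m \<star> (e m l \<star> e l k)" by (simp add: mult_assoc)
  also have "\<dots> \<doteq> e k m \<star> e m k" by (intro congs cong_refl e_e klm)
  finally show ?thesis .
qed simp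

text \<open>Addition in the type \<open>3\<close> is modulo 3, so \<open>k + 1\<close> is just some
  index different from k; by \<open>e_loop\<close> every other choice gives the same class.\<close>

definition u :: "3 \<Rightarrow> 3 \<Rightarrow> 'r"
  where "u k l = (if k = l then e k (k + 1) \<star> e (k + 1) k else e k l)"

lemma u_off: "k \<noteq> l \<Longrightarrow> u k l = e k l"
  by (simp add: u_def)

lemma u_diag: "l \<noteq> k \<Longrightarrow> u k k \<doteq> e k l \<star> e l k"
  unfolding u_def by (simp, rule e_loop) auto

lemma p_u: "p k \<star> u k l \<doteq> u k l"
  using cong_mult[OF p_e cong_refl] by (auto simp: u_def p_e mult_assoc[symmetric])

lemma u_p: "u k l \<star> p l \<doteq> u k l"
  using cong_mult[OF cong_refl e_p] by (auto simp: u_def e_p mult_assoc)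

text \<open>The intermediate index l is chosen different from m as well, so that \<open>e_e\<close>
  applies twice: \<open>e l k \<star> e k m\<close> becomes \<open>e l m\<close>, then
  \<open>e k l \<star> e l m\<close> becomes \<open>e k m\<close>.\<close>

lemma u_diag_e:
  assumes "k \<noteq> m"
  shows "u k k \<star> e k m \<doteq> e k m"
proof -
  obtain l where "l \<noteq> k" "l \<noteq> m" using third_index by blast
  with assms have d: "distinct [l, m, k]" "distinct [k, m, l]" by auto
  have "u k k \<star> e k m \<doteq> (e k l \<star> e l k) \<star> e k m"
    by (intro congs cong_refl u_diag \<open>l \<noteq> k\<close>)
  also have "\<dots> = e k l \<star> (e l k \<star> e k m)" by (simp add: mult_assoc)
  also have "\<dots> \<doteq> e k l \<star> e l m" by (intro congs cong_refl e_e d)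
  also have "\<dots> \<doteq> e k m" by (intro e_e d)
  finally show ?thesis .
qed

lemma e_u_diag:
  assumes "m \<noteq> k"
  shows "e m k \<star> u k k \<doteq> e m k"
proof -
  obtain l where "l \<noteq> k" "l \<noteq> m" using third_index by blast
  with assms have d: "distinct [m, l, k]" "distinct [m, k, l]" by auto
  have "e m k \<star> u k k \<doteq> e m k \<star> (e k l \<star> e l k)"
    by (intro congs cong_refl u_diag \<open>l \<noteq> k\<close>)
  also have "\<dots> = (e m k \<star> e k l) \<star> e l k" by (simp add: mult_assoc)
  also have "\<dots> \<doteq> e m l \<star> e l k" by (intro congs cong_refl e_e d)
  also have "\<dots> \<doteq> e m k" by (intro e_e d)
  finally show ?thesis .
qed

lemma u_diag_u: "u k k \<star> u k m \<doteq> u k m"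
proof (cases "k = m")
  case True
  obtain l where l: "l \<noteq> k" using third_index by blast
  have "u k k \<star> u k k \<doteq> (e k l \<star> e l k) \<star> u k k"
    by (intro congs cong_refl u_diag l)
  also have "\<dots> = e k l \<star> (e l k \<star> u k k)" by (simp add: mult_assoc)
  also have "\<dots> \<doteq> e k l \<star> e l k" by (intro congs cong_refl e_u_diag l)
  also have "\<dots> \<doteq> u k k" by (intro cong_sym[OF u_diag] l)
  finally show ?thesis using True by simp
qed (simp add: u_off u_diag_e)

lemma orthogonal:
  assumes "a \<star> p m \<doteq> a" "p n \<star> b \<doteq> b" "m \<noteq> n"
  shows "a \<star> b \<doteq> 0"
proof -
  have "a \<star> b \<doteq> (a \<star> p m) \<star> (p n \<star> b)"
    by (intro congs cong_sym[OF assms(1)] cong_sym[OF assms(2)])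
  also have "\<dots> = a \<star> (p m \<star> (p n \<star> b))" by (simp add: mult_assoc)
  also have "\<dots> \<doteq> a \<star> (if m = n then p m \<star> b else 0)" by (intro congs cong_refl p_idem_mult)
  finally show ?thesis using assms(3) by simp
qed

lemma u_u: "u k l \<star> u m n \<doteq> (if l = m then u k n else 0)"
proof (cases "l = m")
  case True
  consider "k = l" | "k \<noteq> l" "l = n" | "k \<noteq> l" "l \<noteq> n" "k = n" | "distinct [k, n, l]"
    by auto
  then have "u k l \<star> u l n \<doteq> u k n"
  proof cases
    case 3
    then show ?thesis using cong_sym[OF u_diag[of l k]] by (simp add: u_off)
  qed (auto simp: u_diag_u u_off e_u_diag e_e)
  with True show ?thesis by simp
next
  case False
  then show ?thesis using orthogonal[OF u_p p_u] by simp
qed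

text \<open>Modulo \<open>I\<close> this is the idempotent of the character that sends
  \<open>p k\<close> and \<open>q i\<close> to 1 and the other p's and q's to 0.\<close>

definition eps :: "3 \<Rightarrow> 3 \<Rightarrow> 'r" where "eps i k = B i k k - C i k k *\<^sub>c u k k"

lemma B_u: "B i k k \<star> u k l \<doteq> C i k k *\<^sub>c u k l"
proof (cases "k = l")
  case True
  obtain m where m: "m \<noteq> k" using third_index by blast
  have "B i k k \<star> u k k \<doteq> B i k k \<star> (e k m \<star> e m k)"
    by (intro congs cong_refl u_diag m)
  also have "\<dots> = (B i k k \<star> e k m) \<star> e m k" by (simp add: mult_assoc)
  also have "\<dots> \<doteq> (C i k k *\<^sub>c e k m) \<star> e m k" by (intro congs cong_refl B_e) (use m in auto)
  also have "\<dots> = C i k k *\<^sub>c (e k m \<star> e m k)" by (simp add: distribs)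
  also have "\<dots> \<doteq> C i k k *\<^sub>c u k k" by (intro congs cong_sym[OF u_diag] m)
  finally show ?thesis using True by simp
qed (simp add: u_off B_e)

lemma u_B: "u k l \<star> B i l l \<doteq> C i l l *\<^sub>c u k l"
proof (cases "k = l")
  case True
  obtain m where m: "m \<noteq> k" using third_index by blast
  have "u k k \<star> B i k k \<doteq> (e k m \<star> e m k) \<star> B i k k"
    by (intro congs cong_refl u_diag m)
  also have "\<dots> = e k m \<star> (e m k \<star> B i k k)" by (simp add: mult_assoc)
  also have "\<dots> \<doteq> e k m \<star> (C i k k *\<^sub>c e m k)" by (intro congs cong_refl e_B m)
  also have "\<dots> = C i k k *\<^sub>c (e k m \<star> e m k)" by (simp add: distribs)
  also have "\<dots> \<doteq> C i k k *\<^sub>c u k k" by (intro congs cong_sym[OF u_diag] m)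
  finally show ?thesis using True by simp
qed (simp add: u_off e_B)

lemma p_eps: "p k \<star> eps i k \<doteq> eps i k"
  unfolding eps_def distribs by (intro congs p_B p_u)

lemma eps_p: "eps i k \<star> p k \<doteq> eps i k"
  unfolding eps_def distribs by (intro congs B_p u_p)

lemma eps_u: "eps i k \<star> u l m \<doteq> 0"
proof (cases "k = l")
  case True
  have "eps i k \<star> u k m = B i k k \<star> u k m - C i k k *\<^sub>c (u k k \<star> u k m)"
    by (simp add: eps_def distribs)
  also have "\<dots> \<doteq> C i k k *\<^sub>c u k m - C i k k *\<^sub>c u k m"
    by (intro congs B_u u_diag_u)
  finally show ?thesis using True by simp
qed (rule orthogonal[OF eps_p p_u])

lemma u_eps: "u l m \<star> eps i k \<doteq> 0"
proof (cases "m = k")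
  case True
  have "u l k \<star> eps i k = u l k \<star> B i k k - C i k k *\<^sub>c (u l k \<star> u k k)"
    by (simp add: eps_def distribs)
  also have "\<dots> \<doteq> C i k k *\<^sub>c u l k - C i k k *\<^sub>c (if k = k then u l k else 0)"
    by (intro congs u_B u_u)
  finally show ?thesis using True by simp
qed (rule orthogonal[OF u_p p_eps])

text \<open>In \<open>B_comp\<close> with equal outer indices, the two summands passing through
  other indices are multiples of \<open>u k k\<close>. Their coefficients are summed by
  \<open>C_comp\<close>, leaving the product of the two diagonal sandwiches.\<close>

lemma B_B: "B i k k \<star> B j k k \<doteq> (if i = j then eps i k else 0) + (C i k k * C j k k) *\<^sub>c u k k"
proof -
  obtain l where l: "l \<noteq> k" using third_index by blast
  obtain m where m: "m \<noteq> k" "m \<noteq> l" using third_index by blast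
  have d: "distinct [k, l, m]" using l m by auto
  have off: "B i k n \<star> B j n k \<doteq> (C i k n * C j n k) *\<^sub>c u k k" if "n \<noteq> k" for n
  proof -
    have "B i k n \<star> B j n k \<doteq> (C i k n *\<^sub>c e k n) \<star> (C j n k *\<^sub>c e n k)"
      by (intro congs B_eq_e) (use that in auto)
    also have "\<dots> = (C i k n * C j n k) *\<^sub>c (e k n \<star> e n k)"
      by (simp add: distribs mult.commute)
    also have "\<dots> \<doteq> (C i k n * C j n k) *\<^sub>c u k k"
      by (intro congs cong_sym[OF u_diag] that)
    finally show ?thesis .
  qed
  have "C i k k * C j k k + C i k l * C j l k + C i k m * C j m k = (if i = j then C i k k else 0)"
    using C_comp[of i k j k] by (simp add: sum_3_distinct[OF d])
  then have c: "C i k l * C j l k + C i k m * C j m k = (if i = j then C i k k else 0) - C i k k * C j k k"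
    by (simp add: algebra_simps)
  have "B i k k \<star> B j k k =
      (\<Sum>n\<in>UNIV. B i k n \<star> B j n k) - (B i k l \<star> B j l k + B i k m \<star> B j m k)"
    by (simp add: sum_3_distinct[OF d])
  also have "\<dots> \<doteq> (if i = j then B i k k else 0)
      - ((C i k l * C j l k) *\<^sub>c u k k + (C i k m * C j m k) *\<^sub>c u k k)"
    by (intro congs B_comp off l m)
  also have "\<dots> = (if i = j then eps i k else 0) + (C i k k * C j k k) *\<^sub>c u k k"
    unfolding scale_add_left[symmetric] c by (simp add: eps_def scale_diff_left)
  finally show ?thesis .
qed

lemma eps_eps: "eps i k \<star> eps j l \<doteq> (if i = j \<and> k = l then eps i k else 0)"
proof (cases "k = l")
  case True
  have "eps i k \<star> eps j k = eps i k \<star> B j k k - C j k k *\<^sub>c (eps i k \<star> u k k)"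
    unfolding eps_def[of j k] by (simp only: distribs)
  also have "\<dots> = B i k k \<star> B j k k - C i k k *\<^sub>c (u k k \<star> B j k k) - C j k k *\<^sub>c (eps i k \<star> u k k)"
    unfolding eps_def[of i k] by (simp only: distribs)
  also have "\<dots> \<doteq> ((if i = j then eps i k else 0) + (C i k k * C j k k) *\<^sub>c u k k)
      - C i k k *\<^sub>c (C j k k *\<^sub>c u k k) - C j k k *\<^sub>c 0"
    by (intro congs B_B u_B eps_u)
  finally show ?thesis using True by simp
next
  case False
  then show ?thesis using orthogonal[OF eps_p p_eps] by simp
qed

text \<open>The matrix unit parts removed in the eps add up to \<open>u k k\<close>, because the
  diagonal entries \<open>C i k k\<close> sum to 1 over i.\<close>

lemma p_span: "p k \<doteq> (\<Sum>i\<in>UNIV. eps i k) + u k k"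
proof -
  have "(\<Sum>i\<in>UNIV. eps i k) + u k k = (\<Sum>i\<in>UNIV. B i k k)"
    using gh[of k k] by (simp add: eps_def sum_subtractf scale_sum_left[symmetric] C_def)
  also have "\<dots> \<doteq> p k" using B_sum[of k k] by simp
  finally show ?thesis by (rule cong_sym)
qed

text \<open>Split \<open>q j\<close> by the complete system of p's on both sides. Diagonal
  sandwiches contribute an eps and a multiple of u, off-diagonal ones only a multiple of u.\<close>

lemma q_span: "q j \<doteq> (\<Sum>k\<in>UNIV. eps j k) + (\<Sum>k\<in>UNIV. \<Sum>l\<in>UNIV. C j k l *\<^sub>c u k l)"
proof -
  have "q j = (\<Sum>k\<in>UNIV. p k) \<star> (q j \<star> (\<Sum>l\<in>UNIV. p l))" by (simp add: p_sum)
  also have "\<dots> = (\<Sum>k\<in>UNIV. \<Sum>l\<in>UNIV. B j k l)"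
    by (simp add: mult_sum_left mult_sum_right B_def) (rule sum.swap)
  also have "\<dots> \<doteq> (\<Sum>k\<in>UNIV. \<Sum>l\<in>UNIV. (if k = l then eps j k else 0) + C j k l *\<^sub>c u k l)"
  proof (intro cong_sum)
    fix k l :: 3
    show "B j k l \<doteq> (if k = l then eps j k else 0) + C j k l *\<^sub>c u k l"
      using B_eq_e[of k l j] by (auto simp: u_off eps_def)
  qed
  also have "\<dots> = (\<Sum>k\<in>UNIV. eps j k) + (\<Sum>k\<in>UNIV. \<Sum>l\<in>UNIV. C j k l *\<^sub>c u k l)"
    by (simp add: sum.distrib)
  finally show ?thesis .
qed

end

subsection \<open>Monoid algebras\<close>

lemma poly_mapping_sum_single:
  "f = (\<Sum>a\<in>Poly_Mapping.keys f. Poly_Mapping.single a (Poly_Mapping.lookup f a))"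
  by (rule poly_mapping_eqI)
     (simp add: lookup_sum lookup_single when_def in_keys_iff)

lemma keys_add_subset:
  "Poly_Mapping.keys f \<subseteq> S \<Longrightarrow> Poly_Mapping.keys g \<subseteq> S \<Longrightarrow> Poly_Mapping.keys (f + g) \<subseteq> S"
  by (rule order_trans[OF keys_add]) simp

text \<open>Additive statements are reduced to single basis elements. The support condition is
  carried along because the laws of a monoid hold on its carrier only.\<close>

lemma poly_mapping_single_induct [consumes 1, case_names zero single add]:
  assumes "Poly_Mapping.keys f \<subseteq> S"
    and "prop 0"
    and single: "\<And>a c. a \<in> S \<Longrightarrow> prop (Poly_Mapping.single a c)"
    and add: "\<And>f g. Poly_Mapping.keys f \<subseteq> S \<Longrightarrow> Poly_Mapping.keys g \<subseteq> S \<Longrightarrow>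
      prop f \<Longrightarrow> prop g \<Longrightarrow> prop (f + g)"
  shows "prop (f :: 'a \<Rightarrow>\<^sub>0 'b :: comm_monoid_add)"
proof -
  have "prop (\<Sum>a\<in>A. Poly_Mapping.single a (Poly_Mapping.lookup f a)) \<and>
      Poly_Mapping.keys (\<Sum>a\<in>A. Poly_Mapping.single a (Poly_Mapping.lookup f a)) \<subseteq> S"
    if "finite A" "A \<subseteq> S" for A
    using that
  proof (induction A)
    case (insert x A)
    moreover have "Poly_Mapping.keys (Poly_Mapping.single x (Poly_Mapping.lookup f x)) \<subseteq> S"
      using insert by simp
    ultimately show ?case
      using single[of x] by (simp add: add keys_add_subset)
  qed (simp add: \<open>prop 0\<close>)
  from this[of "Poly_Mapping.keys f"] assms(1) show ?thesis
    by (simp flip: poly_mapping_sum_single)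
qed

lemma monoid_algebra_simps [simp]:
  "carrier (monoid_algebra G) = {f. Poly_Mapping.keys f \<subseteq> carrier G}"
  "\<one>\<^bsub>monoid_algebra G\<^esub> = Poly_Mapping.single \<one>\<^bsub>G\<^esub> 1"
  "\<zero>\<^bsub>monoid_algebra G\<^esub> = 0"
  "f \<oplus>\<^bsub>monoid_algebra G\<^esub> g = f + g"
  "c \<odot>\<^bsub>monoid_algebra G\<^esub> f = Poly_Mapping.map ((*) c) f"
  by (simp_all add: monoid_algebra_def)

text \<open>Enlarging the ranges of summation lets several products be summed over common finite
  sets, which makes distributivity a termwise statement.\<close>

lemma monoid_algebra_mult_eq_sum:
  assumes "finite A" "finite B" "Poly_Mapping.keys f \<subseteq> A" "Poly_Mapping.keys g \<subseteq> B"
  shows "f \<otimes>\<^bsub>monoid_algebra G\<^esub> g = (\<Sum>a\<in>A. \<Sum>b\<in>B.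
    Poly_Mapping.single (a \<otimes>\<^bsub>G\<^esub> b) (Poly_Mapping.lookup f a * Poly_Mapping.lookup g b))"
proof -
  have "f \<otimes>\<^bsub>monoid_algebra G\<^esub> g = (\<Sum>a\<in>Poly_Mapping.keys f. \<Sum>b\<in>B.
      Poly_Mapping.single (a \<otimes>\<^bsub>G\<^esub> b) (Poly_Mapping.lookup f a * Poly_Mapping.lookup g b))"
    unfolding monoid_algebra_def monoid.simps
    by (intro sum.cong refl sum.mono_neutral_left assms) (simp add: in_keys_iff)
  also have "\<dots> = (\<Sum>a\<in>A. \<Sum>b\<in>B.
      Poly_Mapping.single (a \<otimes>\<^bsub>G\<^esub> b) (Poly_Mapping.lookup f a * Poly_Mapping.lookup g b))"
    by (intro sum.mono_neutral_left assms) (simp add: in_keys_iff)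
  finally show ?thesis .
qed

lemma monoid_algebra_mult_distrib_right:
  "(f + f') \<otimes>\<^bsub>monoid_algebra G\<^esub> g = f \<otimes>\<^bsub>monoid_algebra G\<^esub> g + f' \<otimes>\<^bsub>monoid_algebra G\<^esub> g"
proof -
  let ?A = "Poly_Mapping.keys f \<union> Poly_Mapping.keys f'"
  note * = monoid_algebra_mult_eq_sum[where A = ?A and B = "Poly_Mapping.keys g"]
  show ?thesis
    by (simp add: * keys_add lookup_add distrib_right single_add sum.distrib)
qed

lemma monoid_algebra_mult_distrib_left:
  "f \<otimes>\<^bsub>monoid_algebra G\<^esub> (g + g') = f \<otimes>\<^bsub>monoid_algebra G\<^esub> g + f \<otimes>\<^bsub>monoid_algebra G\<^esub> g'"
proof -
  let ?B = "Poly_Mapping.keys g \<union> Poly_Mapping.keys g'"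
  note * = monoid_algebra_mult_eq_sum[where A = "Poly_Mapping.keys f" and B = ?B]
  show ?thesis
    by (simp add: * keys_add lookup_add distrib_left single_add sum.distrib)
qed

lemma monoid_algebra_mult_single [simp]:
  "Poly_Mapping.single a c \<otimes>\<^bsub>monoid_algebra G\<^esub> Poly_Mapping.single b d =
    Poly_Mapping.single (a \<otimes>\<^bsub>G\<^esub> b) (c * d)"
  by (subst monoid_algebra_mult_eq_sum[where A = "{a}" and B = "{b}"]) auto

lemma monoid_algebra_mult_zero [simp]:
  "0 \<otimes>\<^bsub>monoid_algebra G\<^esub> f = 0" "f \<otimes>\<^bsub>monoid_algebra G\<^esub> 0 = 0"
  by (simp_all add: monoid_algebra_def)

lemma monoid_algebra_mult_closed:
  assumes "monoid G" "Poly_Mapping.keys f \<subseteq> carrier G" "Poly_Mapping.keys g \<subseteq> carrier G"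
  shows "Poly_Mapping.keys (f \<otimes>\<^bsub>monoid_algebra G\<^esub> g) \<subseteq> carrier G"
  using assms(2)
proof (induction f rule: poly_mapping_single_induct)
  case (single a c)
  from assms(3) show ?case
  proof (induction g rule: poly_mapping_single_induct)
    case (single b d)
    with \<open>a \<in> carrier G\<close> show ?case
      using monoid.m_closed[OF assms(1)] by auto
  next
    case (add g1 g2)
    then show ?case by (simp only: monoid_algebra_mult_distrib_left keys_add_subset)
  qed simp
next
  case (add f1 f2)
  then show ?case by (simp only: monoid_algebra_mult_distrib_right keys_add_subset)
qed simp

lemma monoid_algebra_mult_assoc:
  assumes "monoid G"
    and fgh: "Poly_Mapping.keys f \<subseteq> carrier G" "Poly_Mapping.keys g \<subseteq> carrier G"
      "Poly_Mapping.keys h \<subseteq> carrier G"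
  shows "(f \<otimes>\<^bsub>monoid_algebra G\<^esub> g) \<otimes>\<^bsub>monoid_algebra G\<^esub> h =
    f \<otimes>\<^bsub>monoid_algebra G\<^esub> (g \<otimes>\<^bsub>monoid_algebra G\<^esub> h)"
  using fgh(1)
proof (induction f rule: poly_mapping_single_induct)
  case (single a)
  from fgh(2) show ?case
  proof (induction g rule: poly_mapping_single_induct)
    case (single b)
    from fgh(3) show ?case
      by (induction h rule: poly_mapping_single_induct)
         (use \<open>a \<in> _\<close> \<open>b \<in> _\<close> in \<open>simp_all add: monoid_algebra_mult_distrib_left mult.assoc
            monoid.m_assoc[OF assms(1)]\<close>)
  qed (simp_all add: monoid_algebra_mult_distrib_left monoid_algebra_mult_distrib_right)
qed (simp_all add: monoid_algebra_mult_distrib_right)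

lemma monoid_algebra_mult_one:
  assumes "monoid G" "Poly_Mapping.keys f \<subseteq> carrier G"
  shows "Poly_Mapping.single \<one>\<^bsub>G\<^esub> 1 \<otimes>\<^bsub>monoid_algebra G\<^esub> f = f"
    and "f \<otimes>\<^bsub>monoid_algebra G\<^esub> Poly_Mapping.single \<one>\<^bsub>G\<^esub> 1 = f"
  by (use assms(2) in \<open>induction f rule: poly_mapping_single_induct\<close>;
      simp add: monoid_algebra_mult_distrib_left monoid_algebra_mult_distrib_right
        monoid.l_one[OF assms(1)] monoid.r_one[OF assms(1)])+

lemma ring_monoid_algebra:
  assumes "monoid G"
  shows "ring (monoid_algebra G :: ('c :: comm_ring_1, _) module)"
proof (rule ringI)
  show "abelian_group (monoid_algebra G :: ('c, _) module)"
  proof (rule abelian_groupI)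
    fix f :: "_ \<Rightarrow>\<^sub>0 'c"
    assume "f \<in> carrier (monoid_algebra G)"
    then show "\<exists>g\<in>carrier (monoid_algebra G). g \<oplus>\<^bsub>monoid_algebra G\<^esub> f = \<zero>\<^bsub>monoid_algebra G\<^esub>"
      by (intro bexI[of _ "- f"]) (auto simp: in_keys_iff)
  qed (simp_all add: keys_add_subset algebra_simps)
  show "Group.monoid (monoid_algebra G :: ('c, _) module)"
    by (rule monoidI)
       (simp_all add: monoid_algebra_mult_closed monoid_algebra_mult_assoc monoid_algebra_mult_one
         monoid.one_closed assms)
qed (simp_all add: monoid_algebra_mult_distrib_left monoid_algebra_mult_distrib_right)

lemma monoid_algebra_minus:
  fixes f g :: "'g \<Rightarrow>\<^sub>0 'c :: comm_ring_1"
  assumes "monoid G" "Poly_Mapping.keys f \<subseteq> carrier G" "Poly_Mapping.keys g \<subseteq> carrier G"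
  shows "f \<ominus>\<^bsub>monoid_algebra G\<^esub> g = f - g"
proof -
  interpret ring "monoid_algebra G :: ('c, _) module" by (rule ring_monoid_algebra[OF assms(1)])
  have "\<ominus>\<^bsub>monoid_algebra G\<^esub> g = - g"
    by (rule minus_equality) (use assms(3) in \<open>auto simp: in_keys_iff\<close>)
  then show ?thesis by (simp add: a_minus_def)
qed

text \<open>The scaling \<open>s\<close> is a parameter because two instances occur: field scalars
  for the free algebra, and integer multiples for the monoid ring underlying the tensor
  product.\<close>

definition lin_ext :: "('c \<Rightarrow> 'b \<Rightarrow> 'b) \<Rightarrow> ('g \<Rightarrow> 'b) \<Rightarrow> ('g \<Rightarrow>\<^sub>0 'c :: comm_ring_1) \<Rightarrow> 'b :: ab_group_add"
  where "lin_ext s \<phi> f = (\<Sum>a\<in>Poly_Mapping.keys f. s (Poly_Mapping.lookup f a) (\<phi> a))"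

lemma lin_ext_add:
  assumes s: "\<And>c d x. s (c + d) x = s c x + s d x"
  shows "lin_ext s \<phi> (f + g) = lin_ext s \<phi> f + lin_ext s \<phi> g"
proof -
  have [simp]: "s 0 x = 0" for x using s[of 0 0 x] by simp
  let ?A = "Poly_Mapping.keys f \<union> Poly_Mapping.keys g"
  have *: "lin_ext s \<phi> h = (\<Sum>a\<in>?A. s (Poly_Mapping.lookup h a) (\<phi> a))"
    if "Poly_Mapping.keys h \<subseteq> ?A" for h
    unfolding lin_ext_def by (intro sum.mono_neutral_left that) (auto simp: in_keys_iff)
  show ?thesis by (simp add: * keys_add lookup_add s sum.distrib)
qed

lemma lin_ext_single:
  assumes s: "\<And>c d x. s (c + d) x = s c x + s d x"
  shows "lin_ext s \<phi> (Poly_Mapping.single a c) = s c (\<phi> a)"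
  using s[of 0 0 "\<phi> a"] by (simp add: lin_ext_def)

text \<open>Universal property of the monoid algebra. Both sides of the multiplicativity claim are
  additive in each argument, so they are compared on single basis elements, where
  \<open>\<phi>_mult\<close> and \<open>s_mult\<close> apply.\<close>

lemma ring_hom_lin_ext:
  fixes S (structure) and s :: "'c :: comm_ring_1 \<Rightarrow> 'b \<Rightarrow> 'b :: ab_group_add" and \<phi> :: "'g \<Rightarrow> 'b"
  assumes G: "monoid G" and S: "ring S" and add: "\<And>x y. x \<oplus> y = x + y" and zero: "\<zero> = 0"
    and \<phi>_closed: "\<And>a. a \<in> carrier G \<Longrightarrow> \<phi> a \<in> carrier S"
    and \<phi>_mult: "\<And>a b. a \<in> carrier G \<Longrightarrow> b \<in> carrier G \<Longrightarrow> \<phi> (a \<otimes>\<^bsub>G\<^esub> b) = \<phi> a \<otimes> \<phi> b"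
    and \<phi>_one: "\<phi> \<one>\<^bsub>G\<^esub> = \<one>"
    and s_closed: "\<And>c x. x \<in> carrier S \<Longrightarrow> s c x \<in> carrier S"
    and s_add: "\<And>c d x. s (c + d) x = s c x + s d x"
    and s_mult: "\<And>c d x y. x \<in> carrier S \<Longrightarrow> y \<in> carrier S \<Longrightarrow> s (c * d) (x \<otimes> y) = s c x \<otimes> s d y"
    and s_one: "\<And>x. s 1 x = x"
  shows "lin_ext s \<phi> \<in> ring_hom (monoid_algebra G) S"
proof -
  interpret S: ring S by fact
  note ext = lin_ext_add[of s, OF s_add] lin_ext_single[of s, OF s_add]
  have ext0 [simp]: "lin_ext s \<phi> 0 = \<zero>" by (simp add: lin_ext_def zero)
  have closed: "lin_ext s \<phi> f \<in> carrier S" if "Poly_Mapping.keys f \<subseteq> carrier G" for f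
    using that
    by (induction f rule: poly_mapping_single_induct)
       (simp_all add: ext s_closed \<phi>_closed flip: add)
  show ?thesis
  proof (rule ring_hom_memI)
    fix f g :: "'g \<Rightarrow>\<^sub>0 'c"
    assume "f \<in> carrier (monoid_algebra G)" "g \<in> carrier (monoid_algebra G)"
    then have f: "Poly_Mapping.keys f \<subseteq> carrier G" and g: "Poly_Mapping.keys g \<subseteq> carrier G"
      by simp_all
    show "lin_ext s \<phi> (f \<otimes>\<^bsub>monoid_algebra G\<^esub> g) = lin_ext s \<phi> f \<otimes> lin_ext s \<phi> g"
      using f
    proof (induction f rule: poly_mapping_single_induct)
      case (single a c)
      from g show ?case
        by (induction g rule: poly_mapping_single_induct)
           (use single in \<open>simp_all add: monoid_algebra_mult_distrib_left ext \<phi>_mult s_mult closed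
              \<phi>_closed s_closed S.r_distr flip: add\<close>)
    qed (use g in \<open>simp_all add: monoid_algebra_mult_distrib_right ext closed S.l_distr flip: add\<close>)
  qed (simp_all add: closed ext add s_one \<phi>_one)
qed

subsection \<open>Quotient algebras\<close>

lemma extend_simps [simp]:
  "carrier (ring.extend A m) = carrier A"
  "x \<otimes>\<^bsub>ring.extend A m\<^esub> y = x \<otimes>\<^bsub>A\<^esub> y"
  "\<one>\<^bsub>ring.extend A m\<^esub> = \<one>\<^bsub>A\<^esub>"
  "x \<oplus>\<^bsub>ring.extend A m\<^esub> y = x \<oplus>\<^bsub>A\<^esub> y"
  "\<zero>\<^bsub>ring.extend A m\<^esub> = \<zero>\<^bsub>A\<^esub>"
  by (simp_all add: ring.extend_def)

lemma extend_smult [simp]: "c \<odot>\<^bsub>ring.extend A (module.fields s)\<^esub> x = s c x"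
  by (simp add: ring.extend_def module.fields_def)

lemma ring_hom_extend [simp]: "ring_hom (ring.extend A m) B = ring_hom A B"
  by (simp add: ring_hom_def)

lemma ring_iso_extend [simp]: "ring_iso (ring.extend A m) B = ring_iso A B"
  by (simp add: ring_iso_def)

lemma ring_extend [simp]:
  assumes "ring A"
  shows "ring (ring.extend A m)"
proof -
  interpret ring A by (rule assms)
  have "\<exists>y\<in>carrier A. y \<oplus>\<^bsub>A\<^esub> x = \<zero>\<^bsub>A\<^esub>" if "x \<in> carrier A" for x
    using that l_neg by blast
  then show ?thesis
    by (intro ringI abelian_groupI monoidI) (simp_all add: m_assoc a_ac l_distr r_distr)
qed

text \<open>First isomorphism theorem, with the kernel prescribed as a set; that \<open>I\<close> is
  an ideal is then a conclusion.\<close>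

lemma quot_iso:
  assumes A: "ring A" and S: "ring S" and h: "h \<in> ring_hom A S"
    and surj: "h ` carrier A = carrier S"
    and ker: "\<And>a. a \<in> carrier A \<Longrightarrow> h a = \<zero>\<^bsub>S\<^esub> \<longleftrightarrow> a \<in> I" and I: "I \<subseteq> carrier A"
  shows "(\<lambda>Y. the_elem (h ` Y)) \<in> ring_iso (A Quot I) S"
    and "\<And>a. a \<in> carrier A \<Longrightarrow> the_elem (h ` (I +>\<^bsub>A\<^esub> a)) = h a"
    and "ideal I A"
proof -
  interpret ring_hom_ring A S h by (rule ring_hom_ringI2) fact+
  have *: "a_kernel A S h = I"
    unfolding a_kernel_def' using ker I by blast
  show "(\<lambda>Y. the_elem (h ` Y)) \<in> ring_iso (A Quot I) S"
    using FactRing_iso_set[OF surj] by (simp add: *)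
  show "the_elem (h ` (I +>\<^bsub>A\<^esub> a)) = h a" if "a \<in> carrier A" for a
    using the_elem_simp[OF that] by (simp add: *)
  show "ideal I A" using kernel_is_ideal by (simp add: *)
qed

text \<open>Scalar multiplication of cosets is a union over all representatives. It is a single
  coset because representatives of one coset have equal images under h, hence so do their scalar
  multiples, which therefore differ by an element of the kernel.\<close>

lemma alg_quot_smult:
  assumes A: "ring A" and S: "ring S" and h: "h \<in> ring_hom A S"
    and surj: "h ` carrier A = carrier S"
    and ker: "\<And>a. a \<in> carrier A \<Longrightarrow> h a = \<zero>\<^bsub>S\<^esub> \<longleftrightarrow> a \<in> I" and I: "I \<subseteq> carrier A"
    and closed: "\<And>a. a \<in> carrier A \<Longrightarrow> c \<odot>\<^bsub>A\<^esub> a \<in> carrier A"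
    and smult: "\<And>a. a \<in> carrier A \<Longrightarrow> h (c \<odot>\<^bsub>A\<^esub> a) = c \<odot>\<^bsub>S\<^esub> h a"
    and a: "a \<in> carrier A"
  shows "c \<odot>\<^bsub>A QuotA I\<^esub> (I +>\<^bsub>A\<^esub> a) = I +>\<^bsub>A\<^esub> (c \<odot>\<^bsub>A\<^esub> a)"
proof -
  interpret ideal I A by (rule quot_iso(3)[OF A S h surj ker I])
  interpret h: ring_hom_ring A S h by (rule ring_hom_ringI2) fact+
  let ?Y = "I +>\<^bsub>A\<^esub> a"
  have *: "h b = h a" "b \<in> carrier A" if "b \<in> ?Y" for b
  proof -
    from that obtain i where i: "i \<in> I" "b = i \<oplus>\<^bsub>A\<^esub> a" by (auto simp: a_r_coset_def')
    then show "h b = h a" "b \<in> carrier A" using a ker[of i] I by auto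
  qed
  have "I +>\<^bsub>A\<^esub> (c \<odot>\<^bsub>A\<^esub> b) = I +>\<^bsub>A\<^esub> (c \<odot>\<^bsub>A\<^esub> a)" if "b \<in> ?Y" for b
  proof (rule a_repr_independence'[symmetric])
    have "h (c \<odot>\<^bsub>A\<^esub> b) = h (c \<odot>\<^bsub>A\<^esub> a)"
      using *[OF that] a by (simp add: smult)
    then have "h ((c \<odot>\<^bsub>A\<^esub> b) \<ominus>\<^bsub>A\<^esub> (c \<odot>\<^bsub>A\<^esub> a)) = \<zero>\<^bsub>S\<^esub>"
      using *[OF that] a closed by (simp add: a_minus_def h.S.r_neg)
    then have "(c \<odot>\<^bsub>A\<^esub> b) \<ominus>\<^bsub>A\<^esub> (c \<odot>\<^bsub>A\<^esub> a) \<in> I"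
      using ker *[OF that] a closed by simp
    then show "c \<odot>\<^bsub>A\<^esub> b \<in> I +>\<^bsub>A\<^esub> (c \<odot>\<^bsub>A\<^esub> a)"
      using *[OF that] a closed by (subst a_rcos_module_minus[OF A]) simp_all
    show "c \<odot>\<^bsub>A\<^esub> a \<in> carrier A" using a closed by simp
  qed
  moreover have "a \<in> ?Y" using a a_rcos_self by simp
  ultimately have "(\<Union>b\<in>?Y. I +>\<^bsub>A\<^esub> (c \<odot>\<^bsub>A\<^esub> b)) = I +>\<^bsub>A\<^esub> (c \<odot>\<^bsub>A\<^esub> a)" by blast
  then show ?thesis by (simp add: alg_quot_def)
qed

lemma alg_quot_coset:
  assumes "Y \<in> carrier (A QuotA I)"
  obtains a where "a \<in> carrier A" "Y = I +>\<^bsub>A\<^esub> a"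
  using assms by (auto simp: alg_quot_def FactRing_def A_RCOSETS_def')

lemma alg_quot_coset_closed: "a \<in> carrier A \<Longrightarrow> I +>\<^bsub>A\<^esub> a \<in> carrier (A QuotA I)"
  by (auto simp: alg_quot_def FactRing_def A_RCOSETS_def')

lemma alg_isomorphic_quot:
  assumes A: "ring A" and S: "ring S" and h: "h \<in> ring_hom A S"
    and surj: "h ` carrier A = carrier S"
    and ker: "\<And>a. a \<in> carrier A \<Longrightarrow> h a = \<zero>\<^bsub>S\<^esub> \<longleftrightarrow> a \<in> I" and I: "I \<subseteq> carrier A"
    and closed: "\<And>c a. c \<in> carrier R \<Longrightarrow> a \<in> carrier A \<Longrightarrow> c \<odot>\<^bsub>A\<^esub> a \<in> carrier A"
    and smult: "\<And>c a. c \<in> carrier R \<Longrightarrow> a \<in> carrier A \<Longrightarrow> h (c \<odot>\<^bsub>A\<^esub> a) = c \<odot>\<^bsub>S\<^esub> h a"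
  shows "alg_isomorphic R (A QuotA I) S"
    and "\<And>c Y. c \<in> carrier R \<Longrightarrow> Y \<in> carrier (A QuotA I) \<Longrightarrow>
      c \<odot>\<^bsub>A QuotA I\<^esub> Y \<in> carrier (A QuotA I)"
proof -
  note iso = quot_iso[OF A S h surj ker I]
  have smult_coset: "c \<odot>\<^bsub>A QuotA I\<^esub> (I +>\<^bsub>A\<^esub> a) = I +>\<^bsub>A\<^esub> (c \<odot>\<^bsub>A\<^esub> a)"
    if "c \<in> carrier R" "a \<in> carrier A" for c a
    by (rule alg_quot_smult[OF A S h surj ker I]) (use that closed smult in simp_all)
  show "alg_isomorphic R (A QuotA I) S"
    unfolding alg_isomorphic_def
  proof (intro bexI ballI)
    show "(\<lambda>Y. the_elem (h ` Y)) \<in> ring_iso (A QuotA I) S"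
      by (simp add: alg_quot_def iso(1))
    fix c Y
    assume c: "c \<in> carrier R" and Y: "Y \<in> carrier (A QuotA I)"
    from Y obtain a where "a \<in> carrier A" "Y = I +>\<^bsub>A\<^esub> a" by (rule alg_quot_coset)
    then show "the_elem (h ` (c \<odot>\<^bsub>A QuotA I\<^esub> Y)) = c \<odot>\<^bsub>S\<^esub> the_elem (h ` Y)"
      using c closed by (simp add: smult_coset iso(2) smult)
  qed
  fix c Y
  assume c: "c \<in> carrier R" and Y: "Y \<in> carrier (A QuotA I)"
  from Y obtain a where "a \<in> carrier A" "Y = I +>\<^bsub>A\<^esub> a" by (rule alg_quot_coset)
  then show "c \<odot>\<^bsub>A QuotA I\<^esub> Y \<in> carrier (A QuotA I)"
    using c closed by (simp only: smult_coset alg_quot_coset_closed)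
qed

subsection \<open>The split algebra\<close>

lemma split_simps [simp]:
  "carrier (split_9_3 K) = {(v, M). (\<forall>i. v $ i \<in> K) \<and> (\<forall>i j. M $ i $ j \<in> K)}"
  "(v, M) \<otimes>\<^bsub>split_9_3 K\<^esub> (v', M') = (v * v', M ** M')"
  "\<one>\<^bsub>split_9_3 K\<^esub> = (1, Finite_Cartesian_Product.mat 1)"
  "\<zero>\<^bsub>split_9_3 K\<^esub> = 0"
  "a \<oplus>\<^bsub>split_9_3 K\<^esub> b = a + b"
  "c \<odot>\<^bsub>split_9_3 K\<^esub> (v, M) = (c *s v, \<chi> i j. c * M $ i $ j)"
  by (auto simp: split_9_3_def alg_dirprod_def diag_algebra_def mat_algebra_def RDirProd_def
      DirProd_def monoid.extend_def ring.fields_def zero_prod_def split: prod.splits)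

lemma subring_type_closed:
  fixes K :: "'a :: field set"
  assumes "subring K ring_of_type_algebra"
  shows "0 \<in> K" "1 \<in> K" "a \<in> K \<Longrightarrow> b \<in> K \<Longrightarrow> a + b \<in> K" "a \<in> K \<Longrightarrow> b \<in> K \<Longrightarrow> a * b \<in> K"
    and "a \<in> K \<Longrightarrow> - a \<in> K"
proof -
  interpret ring "ring_of_type_algebra :: 'a ring" by (rule ring_from_type_algebra)
  note K = subringE[OF assms]
  show "0 \<in> K" "1 \<in> K" "a \<in> K \<Longrightarrow> b \<in> K \<Longrightarrow> a + b \<in> K" "a \<in> K \<Longrightarrow> b \<in> K \<Longrightarrow> a * b \<in> K"
    using K(2,3,6,7) by (simp_all add: ring_of_type_algebra_def)
  have "\<ominus>\<^bsub>ring_of_type_algebra\<^esub> a = - a"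
    by (rule minus_equality) (simp_all add: ring_of_type_algebra_def)
  then show "a \<in> K \<Longrightarrow> - a \<in> K" using K(5)[of a] by simp
qed

lemma ring_split:
  assumes "subring K (ring_of_type_algebra :: 'a :: field ring)"
  shows "ring (split_9_3 K)"
proof -
  note [simp] = subring_type_closed[OF assms]
  have sum_closed: "(\<Sum>i\<in>A. f i) \<in> K" if "\<And>i. f i \<in> K" for A :: "3 set" and f
    using that by (induction A rule: infinite_finite_induct) simp_all
  have [simp]: "(M ** N) $ i $ j \<in> K"
    if "\<forall>i j. M $ i $ j \<in> K" "\<forall>i j. N $ i $ j \<in> K" for M N :: "'a ^ 3 ^ 3" and i j
    using that by (auto simp: matrix_matrix_mult_def intro: sum_closed)
  have [simp]: "(Finite_Cartesian_Product.mat 1 :: 'a ^ 3 ^ 3) $ i $ j \<in> K" for i j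
    by (simp add: Finite_Cartesian_Product.mat_def)
  have matrix_add_right: "(A + B) ** C = A ** C + B ** C" for A B C :: "'a ^ 3 ^ 3"
    by (simp add: vec_eq_iff matrix_matrix_mult_def distrib_right sum.distrib)
  show ?thesis
  proof (rule ringI)
    show "abelian_group (split_9_3 K)"
    proof (rule abelian_groupI)
      fix x assume "x \<in> carrier (split_9_3 K)"
      then show "\<exists>y\<in>carrier (split_9_3 K). y \<oplus>\<^bsub>split_9_3 K\<^esub> x = \<zero>\<^bsub>split_9_3 K\<^esub>"
        by (intro bexI[of _ "- x"]) auto
    qed (auto simp: algebra_simps zero_prod_def)
    show "Group.monoid (split_9_3 K)"
      by (rule monoidI)
         (auto simp: matrix_mul_assoc mult.assoc)
  qed (auto simp: matrix_add_ldistrib matrix_add_right algebra_simps)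
qed

section \<open>Scalars in monoid algebras and the free algebra\<close>

lemma map_scale_lookup [simp]:
  "Poly_Mapping.lookup (Poly_Mapping.map ((*) c) f) k = (c :: 'c :: comm_ring_1) * Poly_Mapping.lookup f k"
  by (simp add: Poly_Mapping.map.rep_eq when_def)

lemma map_scale_simps:
  fixes c d :: "'c :: comm_ring_1"
  shows "Poly_Mapping.map ((*) (c + d)) f = Poly_Mapping.map ((*) c) f + Poly_Mapping.map ((*) d) f"
    and "Poly_Mapping.map ((*) c) (f + g) = Poly_Mapping.map ((*) c) f + Poly_Mapping.map ((*) c) g"
    and "Poly_Mapping.map ((*) c) (Poly_Mapping.map ((*) d) f) = Poly_Mapping.map ((*) (c * d)) f"
    and "Poly_Mapping.map ((*) 1) f = f"
    and "Poly_Mapping.map ((*) c) 0 = 0"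
  by (rule poly_mapping_eqI; simp add: lookup_add algebra_simps)+

lemma monoid_algebra_mult_scale:
  fixes f :: "'g \<Rightarrow>\<^sub>0 'c :: comm_ring_1"
  shows "Poly_Mapping.map ((*) c) f \<otimes>\<^bsub>monoid_algebra G\<^esub> g =
      Poly_Mapping.map ((*) c) (f \<otimes>\<^bsub>monoid_algebra G\<^esub> g)"
    and "f \<otimes>\<^bsub>monoid_algebra G\<^esub> Poly_Mapping.map ((*) c) g =
      Poly_Mapping.map ((*) c) (f \<otimes>\<^bsub>monoid_algebra G\<^esub> g)"
proof -
  have f: "Poly_Mapping.keys f \<subseteq> UNIV" and g: "Poly_Mapping.keys g \<subseteq> UNIV" by auto
  note dist = monoid_algebra_mult_distrib_left monoid_algebra_mult_distrib_right map_scale_simps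
  have single: "Poly_Mapping.single a (c * d) \<otimes>\<^bsub>monoid_algebra G\<^esub> g =
      Poly_Mapping.map ((*) c) (Poly_Mapping.single a d \<otimes>\<^bsub>monoid_algebra G\<^esub> g)" for a d
    using g by (induction g rule: poly_mapping_single_induct) (simp_all add: dist mult.assoc)
  from f show "Poly_Mapping.map ((*) c) f \<otimes>\<^bsub>monoid_algebra G\<^esub> g =
      Poly_Mapping.map ((*) c) (f \<otimes>\<^bsub>monoid_algebra G\<^esub> g)"
    by (induction f rule: poly_mapping_single_induct) (simp_all add: dist single)
  have single': "f \<otimes>\<^bsub>monoid_algebra G\<^esub> Poly_Mapping.single a (c * d) =
      Poly_Mapping.map ((*) c) (f \<otimes>\<^bsub>monoid_algebra G\<^esub> Poly_Mapping.single a d)" for a d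
    using f by (induction f rule: poly_mapping_single_induct)
      (simp_all add: dist mult.left_commute)
  from g show "f \<otimes>\<^bsub>monoid_algebra G\<^esub> Poly_Mapping.map ((*) c) g =
      Poly_Mapping.map ((*) c) (f \<otimes>\<^bsub>monoid_algebra G\<^esub> g)"
    by (induction g rule: poly_mapping_single_induct) (simp_all add: dist single')
qed

lemma monoid_free_monoid: "Group.monoid free_monoid"
  by (rule monoidI) (simp_all add: free_monoid_def)

lemma free_monoid_simps [simp]:
  "carrier free_monoid = UNIV" "\<one>\<^bsub>free_monoid\<^esub> = []" "a \<otimes>\<^bsub>free_monoid\<^esub> b = a @ b"
  by (simp_all add: free_monoid_def)

lemmas ring_free_algebra = ring_monoid_algebra[OF monoid_free_monoid]

lemma free_algebra_minus [simp]: "f \<ominus>\<^bsub>free_algebra\<^esub> g = f - g"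
  by (rule monoid_algebra_minus[OF monoid_free_monoid]) simp_all

text \<open>The free monoid has full carrier, so the free algebra is the whole type of finitely
  supported functions and its operations meet the carrier-free axioms.\<close>

lemma cong_algebra_free_algebra:
  fixes I :: "('x list \<Rightarrow>\<^sub>0 'c :: field) set"
  assumes "ideal I free_algebra"
  shows "cong_algebra (\<lambda>f g. f \<otimes>\<^bsub>free_algebra\<^esub> g) (Poly_Mapping.single [] 1)
    (\<lambda>c. Poly_Mapping.map ((*) c)) I"
proof -
  interpret ideal I "free_algebra :: ('c, _) module" by (rule assms)
  show ?thesis
  proof
    show "0 \<in> I" using additive_subgroup.zero_closed[OF additive_subgroup_axioms] by simp
    show "a + b \<in> I" if "a \<in> I" "b \<in> I" for a b using additive_subgroup.a_closed[OF additive_subgroup_axioms that] by simp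
    show "b \<otimes>\<^bsub>free_algebra\<^esub> a \<in> I" "a \<otimes>\<^bsub>free_algebra\<^esub> b \<in> I" if "a \<in> I" for a b
      using I_l_closed[OF that] I_r_closed[OF that] by simp_all
  qed (simp_all add: monoid_algebra_mult_distrib_left monoid_algebra_mult_distrib_right
      map_scale_simps monoid_algebra_mult_scale monoid_algebra_mult_assoc[OF monoid_free_monoid]
      monoid_algebra_mult_one[OF monoid_free_monoid, simplified])
qed

subsection \<open>The coefficients of the three-dimensional representation\<close>

text \<open>Cyclic indexing writes the components of a cross product without signs that depend on
  the component.\<close>

definition nxt :: "3 \<Rightarrow> 3" where "nxt k = (if k = 1 then 2 else if k = 2 then 3 else 1)"

lemma nxt_simps [simp]: "nxt 1 = 2" "nxt 2 = 3" "nxt 3 = 1"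
  by (simp_all add: nxt_def)

text \<open>Row and column \<open>3\<close> belong to \<open>1 - p\<^sub>1 - p\<^sub>2\<close> and \<open>1 - q\<^sub>1 - q\<^sub>2\<close>.\<close>

definition pad :: "'c ^ (2 \<times> 2) \<Rightarrow> 3 \<Rightarrow> 3 \<Rightarrow> 'c :: zero"
  where "pad x k l =
    (if k = 3 \<or> l = 3 then 0 else x $ (if k = 1 then 1 else 2, if l = 1 then 1 else 2))"

text \<open>
  For \<open>{k, l, m} = {1, 2, 3}\<close>, row \<open>m\<close> of \<open>nu x\<close> is, up to sign, the cross product of \<open>(1, 1, 1)\<close> with
  the difference of the rows \<open>k\<close> and \<open>l\<close> of \<open>pad x\<close>.  It is thus proportional to the vector of
  coefficients of the relations \<open>p\<^sub>k q\<^sub>j p\<^sub>l = C\<^sub>j e\<^sub>k\<^sub>l\<close>.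
\<close>

definition nu :: "'c ^ (2 \<times> 2) \<Rightarrow> 3 \<Rightarrow> 3 \<Rightarrow> 'c :: comm_ring_1"
  where "nu x k l = pad x (nxt k) (nxt l) - pad x (nxt k) (nxt (nxt l))
    - pad x (nxt (nxt k)) (nxt l) + pad x (nxt (nxt k)) (nxt (nxt l))"

definition det2 :: "'c ^ (2 \<times> 2) \<Rightarrow> 'c :: comm_ring_1"
  where "det2 x = x $ (1, 1) * x $ (2, 2) - x $ (1, 2) * x $ (2, 1)"

text \<open>\<open>gmat x k j\<close> is the product of column j of \<open>nu x\<close> with entry k
  left out; up to the denominator, \<open>hmat x j l\<close> is likewise the product of row l with
  entry j left out. For distinct k, l, m their product is thus \<open>nu x m j\<close> times a
  factor independent of j, as the commutator relation demands.\<close>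

definition gmat :: "'c ^ (2 \<times> 2) \<Rightarrow> 3 \<Rightarrow> 3 \<Rightarrow> 'c :: field"
  where "gmat x k j = nu x (nxt k) j * nu x (nxt (nxt k)) j"

text \<open>Dividing by the square of the determinant makes the two matrices inverse to each
  other.\<close>

definition hmat :: "'c ^ (2 \<times> 2) \<Rightarrow> 3 \<Rightarrow> 3 \<Rightarrow> 'c :: field"
  where "hmat x j l = nu x l (nxt j) * nu x l (nxt (nxt j)) / (det2 x)\<^sup>2"

text \<open>The complement of one quadric and nine hyperplanes. The determinant makes g and h
  inverse matrices, and the entries of nu make all of their entries nonzero.\<close>

definition good :: "'c :: field ^ (2 \<times> 2) \<Rightarrow> bool"
  where "good x \<longleftrightarrow> det2 x \<noteq> 0 \<and> (\<forall>k l. nu x k l \<noteq> 0)"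

lemma nu_sum_right: "nu x k 3 = - nu x k 1 - nu x k 2"
  by (simp add: nu_def)

lemma nu_sum_left: "nu x 3 l = - nu x 1 l - nu x 2 l"
  by (simp add: nu_def)

lemma nu_det: "nu x 1 1 * nu x 2 2 - nu x 1 2 * nu x 2 1 = det2 x"
  by (simp add: nu_def pad_def det2_def algebra_simps)

text \<open>The rows of nu sum to zero, so exchanging a row for the third one changes the minor at
  most by a sign, which the square removes.\<close>

lemma nu_minor:
  assumes "k \<noteq> l"
  shows "(nu x k 1 * nu x l 2 - nu x k 2 * nu x l 1)\<^sup>2 = (det2 x)\<^sup>2"
  using assms exhaust_3[of k] exhaust_3[of l]
  by (elim disjE) (simp_all add: nu_sum_left nu_det[symmetric] power2_eq_square algebra_simps)

lemma gmat_eq: "distinct [k, l, m] \<Longrightarrow> gmat x k j = nu x l j * nu x m j"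
  using exhaust_3[of k] exhaust_3[of l] exhaust_3[of m]
  by (elim disjE) (simp_all add: gmat_def)

lemma nu_sum_cols: "nu x k 1 + nu x k 2 + nu x k 3 = 0"
  by (simp add: nu_sum_right)

lemma nu_sum_rows: "distinct [k, l, m] \<Longrightarrow> nu x m j = - nu x k j - nu x l j"
  using exhaust_3[of k] exhaust_3[of l] exhaust_3[of m]
  by (elim disjE) (simp_all add: nu_sum_left)

text \<open>The diagonal case of \<open>gmat_hmat\<close> in coordinates: (a, b) and (c, d) begin
  rows k and m of nu, and the remaining row and column have been eliminated by the zero
  sums.\<close>

lemma minor_square_identity:
  fixes a b :: "'c :: comm_ring_1"
  shows "c * (- a - c) * (b * (- a - b)) + d * (- b - d) * ((- a - b) * a)
    + (- c - d) * ((a + b) + (c + d)) * (a * b) = (a * d - b * c)\<^sup>2"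
  by (simp add: power2_eq_square algebra_simps)

text \<open>On the diagonal the numerator is the square of a 2 by 2 minor of nu, hence equal to the
  denominator. Off the diagonal the entries of row l give a common factor, and what remains is the
  vanishing sum of row m.\<close>

lemma gmat_hmat:
  assumes "det2 x \<noteq> 0"
  shows "(\<Sum>j\<in>UNIV. gmat x k j * hmat x j l) = (if k = l then 1 else 0)"
proof (cases "k = l")
  case True
  obtain m n where d: "distinct [k, m, n]"
    using third_index[of k k] third_index[of k] by (metis distinct_length_2_or_more distinct_singleton)
  have "(\<Sum>j\<in>UNIV. gmat x k j * hmat x j k) =
      (nu x m 1 * nu x n 1 * (nu x k 2 * nu x k 3) + nu x m 2 * nu x n 2 * (nu x k 3 * nu x k 1)
        + nu x m 3 * nu x n 3 * (nu x k 1 * nu x k 2)) / (det2 x)\<^sup>2"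
    by (simp add: sum_3 gmat_eq[OF d] hmat_def add_divide_distrib)
  also have "\<dots> = (nu x k 1 * nu x m 2 - nu x k 2 * nu x m 1)\<^sup>2 / (det2 x)\<^sup>2"
    unfolding minor_square_identity[symmetric] nu_sum_rows[OF d] nu_sum_right by (simp add: algebra_simps)
  also have "\<dots> = 1" using nu_minor[of k m x] assms d by simp
  finally show ?thesis using True by simp
next
  case False
  obtain m where m: "m \<noteq> k" "m \<noteq> l" using third_index by blast
  with False have d: "distinct [k, l, m]" by auto
  have "(\<Sum>j\<in>UNIV. gmat x k j * hmat x j l) =
      nu x l 1 * nu x l 2 * nu x l 3 * (nu x m 1 + nu x m 2 + nu x m 3) / (det2 x)\<^sup>2"
    by (simp add: sum_3 gmat_eq[OF d] hmat_def add_divide_distrib algebra_simps)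
  then show ?thesis using False by (simp add: nu_sum_cols)
qed

text \<open>A right inverse of a square matrix is also a left inverse.\<close>

lemma hmat_gmat:
  assumes "det2 x \<noteq> 0"
  shows "(\<Sum>k\<in>UNIV. hmat x i k * gmat x k j) = (if i = j then 1 else 0)"
proof -
  let ?G = "\<chi> k j. gmat x k j" and ?H = "\<chi> j k. hmat x j k"
  have "?G ** ?H = Finite_Cartesian_Product.mat 1"
    using gmat_hmat[OF assms]
    by (simp add: vec_eq_iff matrix_matrix_mult_def Finite_Cartesian_Product.mat_def)
  then have "?H ** ?G = Finite_Cartesian_Product.mat 1"
    by (simp add: matrix_left_right_inverse)
  then show ?thesis
    by (simp add: vec_eq_iff matrix_matrix_mult_def Finite_Cartesian_Product.mat_def)
qed

text \<open>Up to a common factor the coefficients are \<open>nu x m j\<close>, and row m of nu,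
  being a cross product with the difference of rows k and l, is orthogonal to that
  difference.\<close>

lemma pad_gmat_hmat:
  assumes "k \<noteq> l"
  shows "(\<Sum>j\<in>UNIV. (pad x k j - pad x l j) * (gmat x k j * hmat x j l)) = 0"
proof -
  obtain m where m: "m \<noteq> k" "m \<noteq> l" using third_index by blast
  have "(\<Sum>j\<in>UNIV. (pad x k j - pad x l j) * nu x m j) = 0"
    using assms m exhaust_3[of k] exhaust_3[of l] exhaust_3[of m]
    by (elim disjE; simp add: sum_3 nu_def pad_def; simp add: algebra_simps)
  moreover have "(pad x k j - pad x l j) * (gmat x k j * hmat x j l) =
      (pad x k j - pad x l j) * nu x m j * (nu x l 1 * nu x l 2 * nu x l 3 / (det2 x)\<^sup>2)" for j
    using assms m exhaust_3[of j] gmat_eq[of k l m x j] by (auto simp: hmat_def)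
  ultimately show ?thesis by (simp flip: sum_distrib_right sum_divide_distrib)
qed

text \<open>The difference of the two sides is, up to sign, the first component
  \<open>nu x m 1\<close> of the cross product.\<close>

lemma pad_ne:
  assumes "good x" "k \<noteq> l"
  shows "pad x k 2 - pad x l 2 \<noteq> pad x k 3 - pad x l 3"
proof -
  obtain m where m: "m \<noteq> k" "m \<noteq> l" using third_index by blast
  let ?d = "(pad x k 2 - pad x l 2) - (pad x k 3 - pad x l 3)"
  have "nu x m 1 = ?d \<or> nu x m 1 = - ?d"
    using assms(2) m exhaust_3[of k] exhaust_3[of l] exhaust_3[of m]
    by (elim disjE; simp add: nu_def algebra_simps)
  moreover have "nu x m 1 \<noteq> 0" using assms by (simp add: good_def)
  ultimately show ?thesis by auto
qed

text \<open>The minor factors, up to sign, into two entries of row m of nu and a minor of nu in rows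
  k and l.\<close>

lemma gmat_minor:
  assumes "good x" "k \<noteq> l"
  shows "gmat x k 1 * gmat x l 2 \<noteq> gmat x l 1 * gmat x k 2"
proof -
  obtain m where m: "m \<noteq> k" "m \<noteq> l" using third_index by blast
  then have d: "distinct [k, l, m]" "distinct [l, k, m]" using assms by auto
  have "gmat x k 1 * gmat x l 2 - gmat x l 1 * gmat x k 2 =
      - (nu x m 1 * nu x m 2 * (nu x k 1 * nu x l 2 - nu x k 2 * nu x l 1))"
    by (simp add: gmat_eq[OF d(1)] gmat_eq[OF d(2)] algebra_simps)
  moreover have "nu x k 1 * nu x l 2 - nu x k 2 * nu x l 1 \<noteq> 0"
    using nu_minor[OF assms(2), of x] assms(1) by (auto simp: good_def)
  ultimately show ?thesis using assms(1) by (auto simp: good_def)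
qed

text \<open>After clearing denominators, the factors are the entries of column 3 of nu in rows k and
  l, together with the same minor of nu.\<close>

lemma hmat_minor:
  assumes "good x" "k \<noteq> l"
  shows "hmat x 1 k * hmat x 2 l \<noteq> hmat x 1 l * hmat x 2 k"
proof -
  have "(hmat x 1 k * hmat x 2 l - hmat x 1 l * hmat x 2 k) * (det2 x)\<^sup>2 * (det2 x)\<^sup>2 =
      - (nu x k 3 * nu x l 3 * (nu x k 1 * nu x l 2 - nu x k 2 * nu x l 1))"
    using assms(1) by (simp add: hmat_def good_def field_simps)
  moreover have "nu x k 1 * nu x l 2 - nu x k 2 * nu x l 1 \<noteq> 0"
    using nu_minor[OF assms(2), of x] assms(1) by (auto simp: good_def)
  ultimately show ?thesis using assms(1) by (auto simp: good_def)
qed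

section \<open>Completing two orthogonal idempotents to three\<close>

context cong_algebra
begin

definition third_idem :: "(2 \<Rightarrow> 'r) \<Rightarrow> 3 \<Rightarrow> 'r"
  where "third_idem v k = (if k = 3 then unit - v 1 - v 2 else v (if k = 1 then 1 else 2))"

lemma third_idem_sum: "(\<Sum>k\<in>UNIV. third_idem v k) = unit"
  by (simp add: sum_3 third_idem_def)

lemma third_idem_mult:
  assumes v: "\<And>i j. v i \<star> v j \<doteq> (if i = j then v i else 0)"
  shows "third_idem v k \<star> third_idem v l \<doteq> (if k = l then third_idem v k else 0)"
proof -
  let ?c = "unit - v 1 - v 2"
  have right: "v i \<star> ?c \<doteq> 0" for i
  proof -
    have "v i \<star> ?c = v i - v i \<star> v 1 - v i \<star> v 2" by (simp add: distribs)
    also have "\<dots> \<doteq> v i - (if i = 1 then v i else 0) - (if i = 2 then v i else 0)"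
      by (intro congs cong_refl v)
    also have "\<dots> = 0" using exhaust_2[of i] by auto
    finally show ?thesis .
  qed
  have left: "?c \<star> v i \<doteq> 0" for i
  proof -
    have "?c \<star> v i = v i - v 1 \<star> v i - v 2 \<star> v i" by (simp add: distribs)
    also have "\<dots> \<doteq> v i - (if 1 = i then v 1 else 0) - (if 2 = i then v 2 else 0)"
      by (intro congs cong_refl v)
    also have "\<dots> = 0" using exhaust_2[of i] by auto
    finally show ?thesis .
  qed
  have "?c \<star> ?c = ?c - ?c \<star> v 1 - ?c \<star> v 2" by (simp add: distribs)
  also have "\<dots> \<doteq> ?c - 0 - 0" by (intro congs cong_refl left)
  finally have diag: "?c \<star> ?c \<doteq> ?c" by simp
  show ?thesis
    using right left diag v[of 1 1] v[of 1 2] v[of 2 1] v[of 2 2] exhaust_3[of k] exhaust_3[of l]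
    by (elim disjE) (simp_all add: third_idem_def)
qed

end

section \<open>The linear span of the 18 elements\<close>

context idem_pairs
begin

definition Psi :: "(3 \<Rightarrow> 3 \<Rightarrow> 'c) \<Rightarrow> (3 \<Rightarrow> 3 \<Rightarrow> 'c) \<Rightarrow> 'r"
  where "Psi a b = (\<Sum>j\<in>UNIV. \<Sum>k\<in>UNIV. a j k *\<^sub>c eps j k) + (\<Sum>k\<in>UNIV. \<Sum>l\<in>UNIV. b k l *\<^sub>c u k l)"

lemma Psi_add: "Psi a b + Psi a' b' = Psi (\<lambda>j k. a j k + a' j k) (\<lambda>k l. b k l + b' k l)"
  by (simp add: Psi_def scale_add_left sum.distrib)

lemma Psi_scale: "s *\<^sub>c Psi a b = Psi (\<lambda>j k. s * a j k) (\<lambda>k l. s * b k l)"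
  by (simp add: Psi_def scale_sum_right scale_add_right)

text \<open>The coordinates multiply as in nine copies of the field plus 3 by 3 matrices: the mixed
  blocks vanish because the eps annihilate the matrix units.\<close>

lemma Psi_mult:
  "Psi a b \<star> Psi a' b' \<doteq> Psi (\<lambda>j k. a j k * a' j k) (\<lambda>k l. \<Sum>m\<in>UNIV. b k m * b' m l)"
proof -
  let ?E = "\<lambda>a. \<Sum>j\<in>UNIV. \<Sum>k\<in>UNIV. a j k *\<^sub>c eps j k"
  let ?U = "\<lambda>b. \<Sum>k\<in>UNIV. \<Sum>l\<in>UNIV. b k l *\<^sub>c u k l"
  \<comment> \<open>Deltas are moved outside the inner sums so that each of them collapses one
    summation.\<close>
  have scale_if: "s *\<^sub>c (if A then x else 0) = (if A then s *\<^sub>c x else 0)" for s A x by simp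
  have sum_if: "(\<Sum>i\<in>S. if A then v i else 0) = (if A then \<Sum>i\<in>S. v i else 0)"
    for S :: "3 set" and A and v :: "3 \<Rightarrow> 'r" by simp
  have EE: "?E a \<star> ?E a' \<doteq> ?E (\<lambda>j k. a j k * a' j k)"
  proof -
    have "?E a \<star> ?E a' = (\<Sum>i\<in>UNIV. \<Sum>k\<in>UNIV. \<Sum>j\<in>UNIV. \<Sum>l\<in>UNIV.
        (a i k * a' j l) *\<^sub>c (eps i k \<star> eps j l))"
      by (simp only: mult_sum_left, simp only: mult_sum_right, simp add: distribs mult.commute)
    also have "\<dots> \<doteq> (\<Sum>i\<in>UNIV. \<Sum>k\<in>UNIV. \<Sum>j\<in>UNIV. \<Sum>l\<in>UNIV.
        (a i k * a' j l) *\<^sub>c (if i = j then if k = l then eps i k else 0 else 0))"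
      by (intro congs cong_eq_trans[OF eps_eps]) simp
    also have "\<dots> = ?E (\<lambda>j k. a j k * a' j k)"
      by (simp only: scale_if sum_if sum.delta' finite UNIV_I if_True)
    finally show ?thesis .
  qed
  have UU: "?U b \<star> ?U b' \<doteq> ?U (\<lambda>k l. \<Sum>m\<in>UNIV. b k m * b' m l)"
  proof -
    have "?U b \<star> ?U b' = (\<Sum>k\<in>UNIV. \<Sum>l\<in>UNIV. \<Sum>m\<in>UNIV. \<Sum>n\<in>UNIV.
        (b k l * b' m n) *\<^sub>c (u k l \<star> u m n))"
      by (simp only: mult_sum_left, simp only: mult_sum_right, simp add: distribs mult.commute)
    also have "\<dots> \<doteq> (\<Sum>k\<in>UNIV. \<Sum>l\<in>UNIV. \<Sum>m\<in>UNIV. \<Sum>n\<in>UNIV.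
        (b k l * b' m n) *\<^sub>c (if l = m then u k n else 0))"
      by (intro congs u_u)
    also have "\<dots> = (\<Sum>k\<in>UNIV. \<Sum>l\<in>UNIV. \<Sum>n\<in>UNIV. (b k l * b' l n) *\<^sub>c u k n)"
      by (simp only: scale_if sum_if sum.delta' finite UNIV_I if_True)
    also have "\<dots> = ?U (\<lambda>k l. \<Sum>m\<in>UNIV. b k m * b' m l)"
      unfolding scale_sum_left by (rule sum.cong[OF refl sum.swap])
    finally show ?thesis .
  qed
  have EU: "?E a \<star> ?U b' \<doteq> 0"
  proof -
    have "?E a \<star> ?U b' = (\<Sum>i\<in>UNIV. \<Sum>k\<in>UNIV. \<Sum>m\<in>UNIV. \<Sum>n\<in>UNIV.
        (a i k * b' m n) *\<^sub>c (eps i k \<star> u m n))"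
      by (simp only: mult_sum_left, simp only: mult_sum_right, simp add: distribs mult.commute)
    also have "\<dots> \<doteq> (\<Sum>i\<in>UNIV. \<Sum>k\<in>UNIV. \<Sum>m\<in>UNIV. \<Sum>n\<in>UNIV. (a i k * b' m n) *\<^sub>c 0)"
      by (intro congs eps_u)
    finally show ?thesis by simp
  qed
  have UE: "?U b \<star> ?E a' \<doteq> 0"
  proof -
    have "?U b \<star> ?E a' = (\<Sum>k\<in>UNIV. \<Sum>l\<in>UNIV. \<Sum>i\<in>UNIV. \<Sum>m\<in>UNIV.
        (b k l * a' i m) *\<^sub>c (u k l \<star> eps i m))"
      by (simp only: mult_sum_left, simp only: mult_sum_right, simp add: distribs mult.commute)
    also have "\<dots> \<doteq> (\<Sum>k\<in>UNIV. \<Sum>l\<in>UNIV. \<Sum>i\<in>UNIV. \<Sum>m\<in>UNIV. (b k l * a' i m) *\<^sub>c 0)"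
      by (intro congs u_eps)
    finally show ?thesis by simp
  qed
  have "Psi a b \<star> Psi a' b' = (?E a \<star> ?E a' + ?U b \<star> ?E a') + (?E a \<star> ?U b' + ?U b \<star> ?U b')"
    by (simp only: Psi_def mult_distrib_left mult_distrib_right)
  also have "\<dots> \<doteq> (?E (\<lambda>j k. a j k * a' j k) + 0) + (0 + ?U (\<lambda>k l. \<Sum>m\<in>UNIV. b k m * b' m l))"
    by (intro congs EE UU EU UE)
  finally show ?thesis by (simp add: Psi_def)
qed

lemma p_Psi: "\<exists>a b. p k \<doteq> Psi a b"
proof -
  have "Psi (\<lambda>_ l. if l = k then 1 else 0) (\<lambda>l m. if l = k then if m = k then 1 else 0 else 0) =
      (\<Sum>i\<in>UNIV. eps i k) + u k k"
    using exhaust_3[of k] by (auto simp: Psi_def sum_3)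
  with p_span[of k] show ?thesis by metis
qed

lemma q_Psi: "\<exists>a b. q j \<doteq> Psi a b"
proof -
  have "Psi (\<lambda>i _. if i = j then 1 else 0) (C j) =
      (\<Sum>k\<in>UNIV. eps j k) + (\<Sum>k\<in>UNIV. \<Sum>l\<in>UNIV. C j k l *\<^sub>c u k l)"
    using exhaust_3[of j] by (auto simp: Psi_def sum_3)
  with q_span[of j] show ?thesis by metis
qed

end

subsection \<open>The isomorphism for points in general position\<close>

text \<open>An enumeration of the nine characters: \<open>ix n = (k, j)\<close> if the \<open>n\<close>-th one maps \<open>p\<^sub>k\<close> and \<open>q\<^sub>j\<close> to \<open>1\<close>.\<close>

definition ix :: "9 \<Rightarrow> 3 \<times> 3" where "ix = (SOME f. bij f)"

lemma bij_ix: "bij ix"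
proof -
  have "card (UNIV :: 9 set) = card (UNIV :: (3 \<times> 3) set)" by simp
  then have "\<exists>f :: 9 \<Rightarrow> 3 \<times> 3. bij f" by (intro finite_same_card_bij) simp_all
  then show ?thesis unfolding ix_def by (rule someI_ex)
qed

definition munit :: "3 \<Rightarrow> 3 \<Rightarrow> 'c :: comm_ring_1 ^ 3 ^ 3"
  where "munit k l = (\<chi> i j. if i = k \<and> j = l then 1 else 0)"

lemma munit_nth: "munit k l $ i $ j = (if i = k \<and> j = l then 1 else 0)"
  by (simp add: munit_def)

lemma munit_mult_left: "munit k m ** A = (\<chi> i j. if i = k then A $ m $ j else 0)"
proof -
  have *: "(\<Sum>n\<in>UNIV. (if i = k \<and> n = m then 1 else 0) * A $ n $ j) = (if i = k then A $ m $ j else 0)"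
    for i j
    by (cases "i = k") (simp_all add: if_distrib[of "\<lambda>t. t * _"] cong: if_cong)
  show ?thesis by (simp add: matrix_matrix_mult_def munit_nth *)
qed

lemma munit_mult_right: "A ** munit m l = (\<chi> i j. if j = l then A $ i $ m else 0)"
proof -
  have *: "(\<Sum>n\<in>UNIV. A $ i $ n * (if n = m \<and> j = l then 1 else 0)) = (if j = l then A $ i $ m else 0)"
    for i j
    by (cases "j = l") (simp_all add: if_distrib[of "\<lambda>t. _ * t"] cong: if_cong)
  show ?thesis by (simp add: matrix_matrix_mult_def munit_nth *)
qed

abbreviation split_UNIV :: "('c :: field, ('c ^ 9) \<times> ('c ^ 3 ^ 3)) module"
  where "split_UNIV \<equiv> split_9_3 UNIV"

lemma split_UNIV_mult: "a \<otimes>\<^bsub>split_9_3 K\<^esub> b = (fst a * fst b, snd a ** snd b)"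
  by (cases a; cases b) simp

lemma split_UNIV_smult: "c \<odot>\<^bsub>split_9_3 K\<^esub> a = (c *s fst a, \<chi> i j. c * snd a $ i $ j)"
  by (cases a) simp

definition p_img :: "3 \<Rightarrow> ('c :: field ^ 9) \<times> ('c ^ 3 ^ 3)"
  where "p_img k = (\<chi> n. if fst (ix n) = k then 1 else 0, munit k k)"

definition q_img :: "'c ^ (2 \<times> 2) \<Rightarrow> 3 \<Rightarrow> ('c :: field ^ 9) \<times> ('c ^ 3 ^ 3)"
  where "q_img x j = (\<chi> n. if snd (ix n) = j then 1 else 0, \<chi> k l. gmat x k j * hmat x j l)"

text \<open>\<open>B\<close>, \<open>e\<close>, \<open>u\<close> and \<open>eps\<close> are actual
  expressions in p and q rather than classes, so a multiplicative linear map evaluates them exactly.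
  They go to the standard basis, and the coordinates of a combination can be read off from its
  image.\<close>

lemma (in idem_pairs) image_Psi:
  fixes \<Phi> :: "'r \<Rightarrow> ('c ^ 9) \<times> ('c ^ 3 ^ 3)"
  assumes add: "\<And>a b. \<Phi> (a + b) = \<Phi> a + \<Phi> b"
    and mult: "\<And>a b. \<Phi> (a \<star> b) = \<Phi> a \<otimes>\<^bsub>split_UNIV\<^esub> \<Phi> b"
    and scale: "\<And>s a. \<Phi> (s *\<^sub>c a) = s \<odot>\<^bsub>split_UNIV\<^esub> \<Phi> a"
    and p: "\<And>k. \<Phi> (p k) = p_img k"
    and q: "\<And>j. \<Phi> (q j) = (\<chi> n. if snd (ix n) = j then 1 else 0, \<chi> k l. g k j * h j l)"
  shows "\<Phi> (Psi a b) = (\<chi> n. a (snd (ix n)) (fst (ix n)), \<chi> k l. b k l)"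
proof -
  have \<Phi>0: "\<Phi> 0 = 0" using add[of 0 0] by simp
  have sum: "\<Phi> (\<Sum>i\<in>A. f i) = (\<Sum>i\<in>A. \<Phi> (f i))" for f and A :: "3 set"
    by (induction A rule: infinite_finite_induct) (simp_all add: add \<Phi>0)
  have diff: "\<Phi> (a - b) = \<Phi> a - \<Phi> b" for a b
    using add[of "a - b" b] by simp
  note simps = split_UNIV_mult split_UNIV_smult
  have B: "\<Phi> (B j k l) = (\<chi> n. if k = l \<and> ix n = (k, j) then 1 else 0, \<chi> i m. C j k l * munit k l $ i $ m)" for j k l
    by (auto simp: B_def mult p q p_img_def simps munit_mult_left munit_mult_right C_def
        vec_eq_iff munit_nth prod_eq_iff)
  \<comment> \<open>The character part is zero since k and l differ, and the scaling in
    \<open>e\<close> cancels the coefficient.\<close>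
  have e: "\<Phi> (e k l) = (0, munit k l)" if "k \<noteq> l" for k l
    using that by (auto simp: e_def scale B simps vec_eq_iff munit_nth)
  have u: "\<Phi> (u k l) = (0, munit k l)" for k l
    using e[of k l] e[of k "k + 1"] e[of "k + 1" k]
    by (auto simp: u_def mult simps munit_mult_left vec_eq_iff munit_nth)
  have eps: "\<Phi> (eps j k) = (\<chi> n. if ix n = (k, j) then 1 else 0, 0)" for j k
    by (auto simp: eps_def diff scale B u simps vec_eq_iff munit_nth)
  have "\<Phi> (Psi a b) = (\<Sum>j\<in>UNIV. \<Sum>k\<in>UNIV. (\<chi> n. if ix n = (k, j) then a j k else 0, 0))
      + (\<Sum>k\<in>UNIV. \<Sum>l\<in>UNIV. (0, \<chi> i m. if i = k \<and> m = l then b k l else 0))"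
    by (auto simp: Psi_def add sum scale eps u simps vec_eq_iff munit_nth intro!: arg_cong2[of _ _ _ _ "(+)"] sum.cong)
  also have "\<dots> = (\<chi> n. a (snd (ix n)) (fst (ix n)), \<chi> k l. b k l)"
  proof -
    have "(\<Sum>j\<in>UNIV. \<Sum>k\<in>UNIV. if ix n = (k, j) then a j k else 0) = a (snd (ix n)) (fst (ix n))" for n
      using exhaust_3[of "fst (ix n)"] exhaust_3[of "snd (ix n)"]
      by (cases "ix n") (auto simp: sum_3)
    moreover have "(\<Sum>k\<in>UNIV. \<Sum>l\<in>UNIV. if i = k \<and> m = l then b k l else 0) = b i m" for i m
      using exhaust_3[of i] exhaust_3[of m] by (auto simp: sum_3)
    ultimately show ?thesis
      by (simp add: prod_eq_iff fst_sum snd_sum vec_eq_iff)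
  qed
  finally show ?thesis .
qed

definition word_img :: "'c ^ (2 \<times> 2) \<Rightarrow> pq list \<Rightarrow> ('c :: field ^ 9) \<times> ('c ^ 3 ^ 3)"
  where "word_img x w = foldr (\<lambda>v a. (case v of P i \<Rightarrow> p_img (if i = 1 then 1 else 2)
      | Q j \<Rightarrow> q_img x (if j = 1 then 1 else 2)) \<otimes>\<^bsub>split_UNIV\<^esub> a) w \<one>\<^bsub>split_UNIV\<^esub>"

definition S_map :: "'c ^ (2 \<times> 2) \<Rightarrow> (pq list \<Rightarrow>\<^sub>0 'c) \<Rightarrow> ('c :: field ^ 9) \<times> ('c ^ 3 ^ 3)"
  where "S_map x = lin_ext (\<lambda>c a. c \<odot>\<^bsub>split_UNIV\<^esub> a) (word_img x)"

lemma ring_split_UNIV: "ring (split_UNIV :: ('c :: field, _) module)"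
proof (rule ring_split)
  interpret ring "ring_of_type_algebra :: 'c ring" by (rule ring_from_type_algebra)
  show "subring UNIV (ring_of_type_algebra :: 'c ring)"
    using carrier_is_subring by (simp add: ring_of_type_algebra_def)
qed

lemma split_UNIV_smult_add: "(c + d) \<odot>\<^bsub>split_UNIV\<^esub> a = c \<odot>\<^bsub>split_UNIV\<^esub> a + d \<odot>\<^bsub>split_UNIV\<^esub> a"
  by (simp add: split_UNIV_smult prod_eq_iff vec_eq_iff algebra_simps)

lemma split_UNIV_smult_mult:
  "(c * d) \<odot>\<^bsub>split_UNIV\<^esub> (a \<otimes>\<^bsub>split_UNIV\<^esub> b) =
    (c \<odot>\<^bsub>split_UNIV\<^esub> a) \<otimes>\<^bsub>split_UNIV\<^esub> (d \<odot>\<^bsub>split_UNIV\<^esub> b)"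
  by (simp add: split_UNIV_mult split_UNIV_smult prod_eq_iff vec_eq_iff matrix_matrix_mult_def
      sum_distrib_left mult_ac)

lemma word_img_append: "word_img x (v @ w) = word_img x v \<otimes>\<^bsub>split_UNIV\<^esub> word_img x w"
proof (induction v)
  case Nil
  then show ?case by (cases "word_img x w") (simp add: word_img_def)
next
  case (Cons a v)
  then show ?case
    by (simp add: word_img_def split_UNIV_mult matrix_mul_assoc mult.assoc del: split_simps(2))
qed

lemma S_map_hom: "S_map x \<in> ring_hom free_algebra split_UNIV"
  unfolding S_map_def
proof (rule ring_hom_lin_ext[OF monoid_free_monoid ring_split_UNIV])
  fix c d and a b :: "('a ^ 9) \<times> ('a ^ 3 ^ 3)"
  show "word_img x \<one>\<^bsub>free_monoid\<^esub> = \<one>\<^bsub>split_UNIV\<^esub>" by (simp add: word_img_def)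
  show "(c + d) \<odot>\<^bsub>split_UNIV\<^esub> a = c \<odot>\<^bsub>split_UNIV\<^esub> a + d \<odot>\<^bsub>split_UNIV\<^esub> a"
    by (rule split_UNIV_smult_add)
  show "(c * d) \<odot>\<^bsub>split_UNIV\<^esub> (a \<otimes>\<^bsub>split_UNIV\<^esub> b) =
      (c \<odot>\<^bsub>split_UNIV\<^esub> a) \<otimes>\<^bsub>split_UNIV\<^esub> (d \<odot>\<^bsub>split_UNIV\<^esub> b)"
    by (rule split_UNIV_smult_mult)
  show "1 \<odot>\<^bsub>split_UNIV\<^esub> a = a"
    by (simp add: split_UNIV_smult vec_eq_iff prod_eq_iff)
qed (simp_all add: word_img_append case_prod_beta)

lemma S_map_add: "S_map x (f + g) = S_map x f + S_map x g"
  using ring_hom_add[OF S_map_hom, of f g x] by simp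

lemma S_map_mult: "S_map x (f \<otimes>\<^bsub>free_algebra\<^esub> g) = S_map x f \<otimes>\<^bsub>split_UNIV\<^esub> S_map x g"
  using ring_hom_mult[OF S_map_hom, of f g x] by simp

lemma S_map_one: "S_map x (Poly_Mapping.single [] 1) = (1, Finite_Cartesian_Product.mat 1)"
  using ring_hom_one[OF S_map_hom, of x] by simp

lemma S_map_diff: "S_map x (f - g) = S_map x f - S_map x g"
  using S_map_add[of x "f - g" g] by simp

lemma S_map_single: "S_map x (Poly_Mapping.single w c) = c \<odot>\<^bsub>split_UNIV\<^esub> word_img x w"
  unfolding S_map_def by (rule lin_ext_single) (rule split_UNIV_smult_add)

lemma S_map_scale: "S_map x (Poly_Mapping.map ((*) c) f) = c \<odot>\<^bsub>split_UNIV\<^esub> S_map x f"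
proof -
  have "Poly_Mapping.map ((*) c) f = Poly_Mapping.single [] c \<otimes>\<^bsub>free_algebra\<^esub> f"
    using monoid_algebra_mult_scale(1)[where c = c and f = "Poly_Mapping.single [] 1" and G = free_monoid and g = f]
    by (simp add: monoid_algebra_mult_one[OF monoid_free_monoid, simplified])
  then have "S_map x (Poly_Mapping.map ((*) c) f) =
      (c * 1) \<odot>\<^bsub>split_UNIV\<^esub> (\<one>\<^bsub>split_UNIV\<^esub> \<otimes>\<^bsub>split_UNIV\<^esub> S_map x f)"
    by (simp only: split_UNIV_smult_mult S_map_mult S_map_single)
       (simp add: word_img_def split_UNIV_smult vec_eq_iff)
  then show ?thesis by (cases "S_map x f") simp
qed

lemma S_map_gen:
  "S_map x (gen (P i)) = p_img (if i = 1 then 1 else 2)"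
  "S_map x (gen (Q j)) = q_img x (if j = 1 then 1 else 2)"
  by (simp_all add: gen_def S_map_single word_img_def split_UNIV_mult split_UNIV_smult vec_eq_iff
      del: split_simps(2,6))

section \<open>The ideal of relations and the images of the relations\<close>

lemma ideal_ring_hom_vanish:
  assumes A: "ring A" and S: "ring S" and h: "h \<in> ring_hom A S" and rels: "T \<subseteq> carrier A"
    and vanish: "\<And>t. t \<in> T \<Longrightarrow> h t = \<zero>\<^bsub>S\<^esub>" and a: "a \<in> Idl\<^bsub>A\<^esub> T"
  shows "h a = \<zero>\<^bsub>S\<^esub>"
proof -
  interpret ring_hom_ring A S h by (rule ring_hom_ringI2) fact+
  have "Idl\<^bsub>A\<^esub> T \<subseteq> a_kernel A S h"
  proof (rule R.genideal_minimal[OF kernel_is_ideal])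
    show "T \<subseteq> a_kernel A S h" unfolding a_kernel_def' using rels vanish by blast
  qed
  then show ?thesis using a unfolding a_kernel_def' by blast
qed

definition S_rels :: "'c ^ (2 \<times> 2) \<Rightarrow> (pq list \<Rightarrow>\<^sub>0 'c :: comm_ring_1) set"
  where "S_rels x = idem_rels P \<union> idem_rels Q \<union> {comm_rel x}"

definition S_ideal :: "'c ^ (2 \<times> 2) \<Rightarrow> (pq list \<Rightarrow>\<^sub>0 'c :: comm_ring_1) set"
  where "S_ideal x = Idl\<^bsub>free_algebra\<^esub> (S_rels x)"

lemma ideal_S_ideal: "ideal (S_ideal x) free_algebra"
  unfolding S_ideal_def by (rule ring.genideal_ideal[OF ring_free_algebra]) simp

lemma S_rels_ideal: "S_rels x \<subseteq> S_ideal x"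
  unfolding S_ideal_def by (rule ring.genideal_self[OF ring_free_algebra]) simp

lemma if_1_2_inj: "(if i = 1 then 1 else 2 :: 3) = (if j = 1 then 1 else 2) \<longleftrightarrow> i = (j :: 2)"
  using exhaust_2[of i] exhaust_2[of j] by auto

lemma p_img_mult: "p_img k \<otimes>\<^bsub>split_UNIV\<^esub> p_img l = (if k = l then p_img k else 0)"
  by (auto simp: p_img_def split_UNIV_mult munit_mult_left vec_eq_iff munit_nth prod_eq_iff)

lemma q_img_mult:
  assumes "det2 x \<noteq> 0"
  shows "q_img x i \<otimes>\<^bsub>split_UNIV\<^esub> q_img x j = (if i = j then q_img x i else 0)"
proof -
  have "(\<Sum>m\<in>UNIV. gmat x k i * hmat x i m * (gmat x m j * hmat x j l)) =
      gmat x k i * (\<Sum>m\<in>UNIV. hmat x i m * gmat x m j) * hmat x j l" for k l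
    by (simp add: sum_distrib_left sum_distrib_right mult.assoc)
  then show ?thesis
    by (auto simp: q_img_def split_UNIV_mult matrix_matrix_mult_def vec_eq_iff prod_eq_iff
        hmat_gmat[OF assms])
qed

text \<open>In the first component everything commutes. In the matrix component, entry (k, l) of the
  sum is the expression in \<open>pad_gmat_hmat\<close>, whose coefficients are zero on the
  diagonal.\<close>

lemma pq_img_rel:
  "(\<Sum>i\<in>UNIV. \<Sum>j\<in>UNIV. pad x i j \<odot>\<^bsub>split_UNIV\<^esub>
    (p_img i \<otimes>\<^bsub>split_UNIV\<^esub> q_img x j - q_img x j \<otimes>\<^bsub>split_UNIV\<^esub> p_img i)) = 0"
proof -
  have "(\<Sum>i\<in>UNIV. \<Sum>j\<in>UNIV. pad x i j * ((if k = i then gmat x i j * hmat x j l else 0)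
      - (if l = i then gmat x k j * hmat x j i else 0))) = 0" for k l
  proof -
    have "(\<Sum>i\<in>UNIV. \<Sum>j\<in>UNIV. pad x i j * ((if k = i then gmat x i j * hmat x j l else 0)
      - (if l = i then gmat x k j * hmat x j i else 0))) =
      (\<Sum>j\<in>UNIV. (pad x k j - pad x l j) * (gmat x k j * hmat x j l))"
      by (subst sum.swap) (simp add: right_diff_distrib left_diff_distrib sum_subtractf
          if_distrib[of "\<lambda>t. _ * t"] cong: if_cong)
    then show ?thesis using pad_gmat_hmat[of k l x] by (cases "k = l") simp_all
  qed
  then show ?thesis
    by (simp add: p_img_def q_img_def split_UNIV_mult split_UNIV_smult munit_mult_left munit_mult_right
        vec_eq_iff prod_eq_iff fst_sum snd_sum mult.commute cong: if_cong)
qed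

text \<open>\<open>S_map x\<close> kills the relations, every element is congruent to a combination
  \<open>Psi a b\<close>, and the image of \<open>Psi a b\<close> determines a and b. Hence the
  kernel is exactly the ideal of relations.\<close>

lemma S_alg_split:
  fixes x :: "'c :: field ^ (2 \<times> 2)"
  assumes good: "good x" and two: "(2 :: 'c) \<noteq> 0"
  shows "alg_isomorphic ring_of_type_algebra (S_alg x) split_UNIV"
    and "\<And>c a. a \<in> carrier (S_alg x) \<Longrightarrow> c \<odot>\<^bsub>S_alg x\<^esub> a \<in> carrier (S_alg x)"
proof -
  have det: "det2 x \<noteq> 0" using good by (simp add: good_def)
  interpret A: cong_algebra "\<lambda>f g. f \<otimes>\<^bsub>free_algebra\<^esub> g" "Poly_Mapping.single [] 1"
    "\<lambda>c :: 'c. Poly_Mapping.map ((*) c)" "S_ideal x"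
    by (rule cong_algebra_free_algebra[OF ideal_S_ideal])
  define p where "p = A.third_idem (\<lambda>i. gen (P i))"
  define q where "q = A.third_idem (\<lambda>i. gen (Q i))"
  have rel: "A.cong f 0" if "f \<in> S_rels x" for f
    using S_rels_ideal[of x] that by (simp add: A.cong_def subset_iff)
  have idem: "A.cong (gen (v i) \<otimes>\<^bsub>free_algebra\<^esub> gen (v j)) (if i = j then gen (v i) else 0)"
    if "idem_rels v \<subseteq> S_rels x" for v i j
  proof -
    have "gen (v i) \<otimes>\<^bsub>free_algebra\<^esub> gen (v j) - (if i = j then gen (v i) else 0) \<in> idem_rels v"
      unfolding idem_rels_def free_algebra_minus by blast
    with that show ?thesis by (subst A.cong_iff_diff) (blast intro: rel)
  qed
  \<comment> \<open>Row and column 3 of \<open>pad x\<close> are zero, so extending the sum to the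
    third idempotents adds nothing.\<close>
  have comm: "(\<Sum>i\<in>UNIV. \<Sum>j\<in>UNIV. Poly_Mapping.map ((*) (pad x i j))
      (p i \<otimes>\<^bsub>free_algebra\<^esub> q j - q j \<otimes>\<^bsub>free_algebra\<^esub> p i)) = comm_rel x"
    by (simp add: comm_rel_def sum_3 sum_2 pad_def p_def q_def A.third_idem_def ring_commutator_def)
  interpret B: idem_pairs "\<lambda>f g. f \<otimes>\<^bsub>free_algebra\<^esub> g" "Poly_Mapping.single [] 1"
    "\<lambda>c :: 'c. Poly_Mapping.map ((*) c)" "S_ideal x" p q "pad x" "gmat x" "hmat x"
  proof
    show "A.cong (p i \<otimes>\<^bsub>free_algebra\<^esub> p j) (if i = j then p i else 0)" for i j
      unfolding p_def by (intro A.third_idem_mult idem) (auto simp: S_rels_def)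
    show "A.cong (q i \<otimes>\<^bsub>free_algebra\<^esub> q j) (if i = j then q i else 0)" for i j
      unfolding q_def by (intro A.third_idem_mult idem) (auto simp: S_rels_def)
    show "sum p UNIV = Poly_Mapping.single [] 1" "sum q UNIV = Poly_Mapping.single [] 1"
      by (simp_all add: p_def q_def A.third_idem_sum)
    show "A.cong (\<Sum>i\<in>UNIV. \<Sum>j\<in>UNIV. Poly_Mapping.map ((*) (pad x i j))
      (p i \<otimes>\<^bsub>free_algebra\<^esub> q j - q j \<otimes>\<^bsub>free_algebra\<^esub> p i)) 0"
      unfolding comm by (rule rel) (simp add: S_rels_def)
    show "gmat x k j \<noteq> 0" "hmat x j k \<noteq> 0" for k j
      using good by (simp_all add: good_def gmat_def hmat_def)
  qed (use gmat_hmat[OF det] hmat_gmat[OF det] pad_gmat_hmat pad_ne[OF good] gmat_minor[OF good]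
        hmat_minor[OF good] two in \<open>simp_all\<close>)
  have S0: "S_map x 0 = 0" using S_map_add[of x 0 0] by simp
  have S_sum: "S_map x (\<Sum>i\<in>A. f i) = (\<Sum>i\<in>A. S_map x (f i))" for f and A :: "3 set"
    by (induction A rule: infinite_finite_induct) (simp_all add: S_map_add S0)
  have S_p: "S_map x (p k) = p_img k" for k
  proof -
    \<comment> \<open>The value at the third idempotent follows from the other two, because the
      three images add up to one.\<close>
    have "p_img 1 + p_img 2 + p_img 3 = (1, Finite_Cartesian_Product.mat 1 :: 'c ^ 3 ^ 3)"
      using exhaust_3
      by (auto simp: p_img_def vec_eq_iff prod_eq_iff Finite_Cartesian_Product.mat_def munit_nth forall_3)
    then have "(1, Finite_Cartesian_Product.mat 1 :: 'c ^ 3 ^ 3) - p_img 1 - p_img 2 = p_img 3"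
      by (metis add_diff_cancel_left' diff_diff_add)
    then show ?thesis
      using exhaust_3[of k] by (auto simp: p_def A.third_idem_def S_map_diff S_map_one S_map_gen)
  qed
  have S_q: "S_map x (q k) = q_img x k" for k
  proof -
    have "q_img x 1 + q_img x 2 + q_img x 3 = (1, Finite_Cartesian_Product.mat 1)"
      using gmat_hmat[OF det] exhaust_3
      by (auto simp: q_img_def vec_eq_iff prod_eq_iff Finite_Cartesian_Product.mat_def sum_3)
    then have "(1, Finite_Cartesian_Product.mat 1) - q_img x 1 - q_img x 2 = q_img x 3"
      by (metis add_diff_cancel_left' diff_diff_add)
    then show ?thesis
      using exhaust_3[of k] by (auto simp: q_def A.third_idem_def S_map_diff S_map_one S_map_gen)
  qed
  have S_rels: "S_map x f = \<zero>\<^bsub>split_UNIV\<^esub>" if "f \<in> S_rels x" for f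
  proof -
    have "S_map x (gen (P i) \<otimes>\<^bsub>free_algebra\<^esub> gen (P j) - (if i = j then gen (P i) else 0)) = 0"
      "S_map x (gen (Q i) \<otimes>\<^bsub>free_algebra\<^esub> gen (Q j) - (if i = j then gen (Q i) else 0)) = 0" for i j
      by (simp_all add: S_map_diff S_map_mult S_map_gen p_img_mult q_img_mult[OF det] if_1_2_inj S0
          del: split_simps)
    moreover have "S_map x (comm_rel x) = 0"
      unfolding comm[symmetric] S_sum S_map_scale S_map_diff S_map_mult S_p S_q by (rule pq_img_rel)
    ultimately show ?thesis using that by (auto simp: idem_rels_def S_rels_def)
  qed
  have image: "S_map x (B.Psi a b) = (\<chi> n. a (snd (ix n)) (fst (ix n)), \<chi> k l. b k l)" for a b
    by (rule B.image_Psi) (simp_all add: S_map_add S_map_mult S_map_scale S_p S_q q_img_def)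
  \<comment> \<open>\<open>T\<close> collects the elements that have a normal form. It is a
    subalgebra containing the generators, hence everything.\<close>
  define T where "T = {f. \<exists>a b. A.cong f (B.Psi a b)}"
  have T_I: "f \<in> T" if "A.cong f (B.Psi a b)" for f a b
    using that by (auto simp: T_def)
  have T_add: "f + g \<in> T" if fg: "f \<in> T" "g \<in> T" for f g
  proof -
    from fg obtain a b a' b' where "A.cong f (B.Psi a b)" "A.cong g (B.Psi a' b')"
      by (auto simp: T_def)
    from A.cong_add[OF this] show ?thesis unfolding B.Psi_add by (rule T_I)
  qed
  have T_mult: "f \<otimes>\<^bsub>free_algebra\<^esub> g \<in> T" if fg: "f \<in> T" "g \<in> T" for f g
  proof -
    from fg obtain a b a' b' where "A.cong f (B.Psi a b)" "A.cong g (B.Psi a' b')"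
      by (auto simp: T_def)
    from A.cong_trans[OF A.cong_mult[OF this] B.Psi_mult] show ?thesis by (rule T_I)
  qed
  have T_scale: "Poly_Mapping.map ((*) c) f \<in> T" if f: "f \<in> T" for f c
  proof -
    from f obtain a b where "A.cong f (B.Psi a b)" by (auto simp: T_def)
    from A.cong_scale[OF this] show ?thesis unfolding B.Psi_scale by (rule T_I)
  qed
  have T_p: "p k \<in> T" and T_q: "q k \<in> T" for k
    using B.p_Psi B.q_Psi by (auto simp: T_def)
  have T_gen: "gen v \<in> T" for v
  proof (cases v)
    case (P i)
    then show ?thesis using T_p[of "if i = 1 then 1 else 2"] exhaust_2[of i]
      by (auto simp: p_def A.third_idem_def)
  next
    case (Q i)
    then show ?thesis using T_q[of "if i = 1 then 1 else 2"] exhaust_2[of i]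
      by (auto simp: q_def A.third_idem_def)
  qed
  have T_one: "Poly_Mapping.single [] 1 \<in> T"
    using B.p_sum T_p T_add by (metis (no_types, lifting) sum_3)
  have T_word: "Poly_Mapping.single w 1 \<in> T" for w
  proof (induction w)
    case (Cons v w)
    have "Poly_Mapping.single (v # w) 1 = gen v \<otimes>\<^bsub>free_algebra\<^esub> Poly_Mapping.single w (1 :: 'c)"
      by (simp add: gen_def)
    then show ?case using T_mult[OF T_gen Cons] by simp
  qed (rule T_one)
  have "f \<in> T" for f
  proof -
    have "Poly_Mapping.keys f \<subseteq> UNIV" by simp
    then show ?thesis
    proof (induction f rule: poly_mapping_single_induct)
      case zero
      then show ?case using T_scale[OF T_one, of 0] by simp
    next
      case (single w c)
      then show ?case using T_scale[OF T_word, of c w] by simp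
    qed (rule T_add)
  qed
  then have reduce: "\<exists>a b. A.cong f (B.Psi a b)" for f
    by (simp add: T_def)
  have surj: "S_map x ` carrier free_algebra = carrier split_UNIV"
  proof -
    have "(v, M) \<in> range (S_map x)" for v :: "'c ^ 9" and M :: "'c ^ 3 ^ 3"
    proof
      \<comment> \<open>The preimage distributes the entries of v over the pairs of indices by
        inverting \<open>ix\<close>.\<close>
      show "(v, M) = S_map x (B.Psi (\<lambda>j k. v $ inv_into UNIV ix (k, j)) (\<lambda>k l. M $ k $ l))"
        using bij_ix by (simp add: image vec_eq_iff bij_is_inj)
    qed simp
    then show ?thesis by auto
  qed
  have ker: "S_map x f = \<zero>\<^bsub>split_UNIV\<^esub> \<longleftrightarrow> f \<in> S_ideal x" for f
  proof
    assume "f \<in> S_ideal x"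
    then show "S_map x f = \<zero>\<^bsub>split_UNIV\<^esub>"
      using ideal_ring_hom_vanish[OF ring_free_algebra ring_split_UNIV S_map_hom _ S_rels]
      by (simp add: S_ideal_def)
  next
    assume f: "S_map x f = \<zero>\<^bsub>split_UNIV\<^esub>"
    obtain a b where ab: "A.cong f (B.Psi a b)" using reduce by blast
    then have "f - B.Psi a b \<in> S_ideal x" by (simp add: A.cong_def)
    then have "S_map x (f - B.Psi a b) = \<zero>\<^bsub>split_UNIV\<^esub>"
      using ideal_ring_hom_vanish[OF ring_free_algebra ring_split_UNIV S_map_hom _ S_rels]
      by (simp add: S_ideal_def)
    then have "S_map x (B.Psi a b) = 0"
      using f by (simp add: S_map_diff)
    then have *: "a (snd (ix n)) (fst (ix n)) = 0" "b k l = 0" for n k l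
      by (simp_all add: image prod_eq_iff vec_eq_iff)
    \<comment> \<open>As \<open>ix\<close> is onto, every pair of indices is the position of some
      character.\<close>
    have "a j k = 0" for j k
      using *(1)[of "inv_into UNIV ix (k, j)"] bij_ix by (simp add: bij_is_surj surj_f_inv_f)
    then have "B.Psi a b = 0" using *(2) by (simp add: B.Psi_def)
    then show "f \<in> S_ideal x" using ab by (simp add: A.cong_def)
  qed
  have S_alg: "S_alg x = free_algebra QuotA S_ideal x"
    by (simp add: S_alg_def S_ideal_def S_rels_def)
  note iso = alg_isomorphic_quot[OF ring_free_algebra ring_split_UNIV S_map_hom surj ker,
      where R = "ring_of_type_algebra :: 'c ring"]
  show "alg_isomorphic ring_of_type_algebra (S_alg x) split_UNIV"
    unfolding S_alg by (rule iso(1)) (simp_all add: S_map_scale)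
  show "c \<odot>\<^bsub>S_alg x\<^esub> a \<in> carrier (S_alg x)" if "a \<in> carrier (S_alg x)" for c a
    unfolding S_alg
    by (rule iso(2)) (use that in \<open>simp_all add: S_map_scale S_alg ring_of_type_algebra_def\<close>)
qed

lemma ring_S_alg: "ring (S_alg x)"
proof -
  interpret ideal "S_ideal x" free_algebra by (rule ideal_S_ideal)
  have "ring (free_algebra Quot S_ideal x)" by (rule quotient_is_ring)
  then show ?thesis
    unfolding S_alg_def S_ideal_def[symmetric, unfolded S_rels_def] alg_quot_def by simp
qed

subsection \<open>Base change\<close>

lemma ext_algebra_simps [simp]:
  "carrier (ext_algebra K) = K"
  "b \<otimes>\<^bsub>ext_algebra K\<^esub> b' = b * b'"
  "\<one>\<^bsub>ext_algebra K\<^esub> = 1"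
  "b \<oplus>\<^bsub>ext_algebra K\<^esub> b' = b + b'"
  "r \<odot>\<^bsub>ext_algebra K\<^esub> b = to_ac r * b"
  by (simp_all add: ext_algebra_def subfield_ring_def ring_of_type_algebra_def)

definition ac_split :: "('f :: field ^ 9) \<times> ('f ^ 3 ^ 3) \<Rightarrow> ('f alg_closure ^ 9) \<times> ('f alg_closure ^ 3 ^ 3)"
  where "ac_split a = (\<chi> i. to_ac (fst a $ i), \<chi> i j. to_ac (snd a $ i $ j))"

lemma ac_split_simps:
  "ac_split (a + b) = ac_split a + ac_split b"
  "ac_split (a \<otimes>\<^bsub>split_UNIV\<^esub> b) = ac_split a \<otimes>\<^bsub>split_9_3 K\<^esub> ac_split b"
  "ac_split \<one>\<^bsub>split_UNIV\<^esub> = \<one>\<^bsub>split_9_3 K\<^esub>"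
  "ac_split (r \<odot>\<^bsub>split_UNIV\<^esub> a) = to_ac r \<odot>\<^bsub>split_9_3 K\<^esub> ac_split a"
  by (auto simp: ac_split_def split_UNIV_mult split_UNIV_smult vec_eq_iff prod_eq_iff
      matrix_matrix_mult_def to_ac_sum Finite_Cartesian_Product.mat_def)

lemma split_carrier_iff:
  "a \<in> carrier (split_9_3 K) \<longleftrightarrow> (\<forall>i. fst a $ i \<in> K) \<and> (\<forall>i j. snd a $ i $ j \<in> K)"
  by (cases a) simp

lemma split_smult_closed:
  assumes "subring K ring_of_type_algebra" "c \<in> K" "a \<in> carrier (split_9_3 K)"
  shows "c \<odot>\<^bsub>split_9_3 K\<^esub> a \<in> carrier (split_9_3 K)"
  using assms(2,3) by (simp add: split_carrier_iff split_UNIV_smult subring_type_closed[OF assms(1)] del: split_simps(1))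

lemma split_smult_simps:
  "(c + d) \<odot>\<^bsub>split_9_3 K\<^esub> a = c \<odot>\<^bsub>split_9_3 K\<^esub> a + d \<odot>\<^bsub>split_9_3 K\<^esub> a"
  "c \<odot>\<^bsub>split_9_3 K\<^esub> (a + b) = c \<odot>\<^bsub>split_9_3 K\<^esub> a + c \<odot>\<^bsub>split_9_3 K\<^esub> b"
  "1 \<odot>\<^bsub>split_9_3 K\<^esub> a = a"
  "c \<odot>\<^bsub>split_9_3 K\<^esub> (d \<odot>\<^bsub>split_9_3 K\<^esub> a) = (c * d) \<odot>\<^bsub>split_9_3 K\<^esub> a"
  "(c * d) \<odot>\<^bsub>split_9_3 K\<^esub> (a \<otimes>\<^bsub>split_9_3 K\<^esub> b) =
    (c \<odot>\<^bsub>split_9_3 K\<^esub> a) \<otimes>\<^bsub>split_9_3 K\<^esub> (d \<odot>\<^bsub>split_9_3 K\<^esub> b)"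
  by (simp_all add: split_UNIV_smult split_UNIV_mult vec_eq_iff prod_eq_iff algebra_simps
      matrix_matrix_mult_def sum_distrib_left)

lemma of_int_subring:
  assumes "subring K (ring_of_type_algebra :: 'a :: field ring)"
  shows "of_int n \<in> K"
proof -
  note K = subring_type_closed[OF assms]
  have nat: "of_nat k \<in> K" for k
    by (induction k) (simp_all add: K)
  show ?thesis
    by (cases n rule: int_cases2) (simp_all add: nat K(5))
qed

lemma ideal_uminus_closed:
  assumes "monoid G" "ideal I (monoid_algebra G)" "f \<in> I"
  shows "- f \<in> I"
proof -
  interpret ideal I "monoid_algebra G" by (rule assms)
  have "\<zero>\<^bsub>monoid_algebra G\<^esub> \<ominus>\<^bsub>monoid_algebra G\<^esub> f = 0 - f"
    using monoid_algebra_minus[OF assms(1), of 0 f] Icarr[OF assms(3)] by simp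
  moreover have "\<zero>\<^bsub>monoid_algebra G\<^esub> \<ominus>\<^bsub>monoid_algebra G\<^esub> f \<in> I"
    using additive_subgroup.a_inv_closed[OF additive_subgroup_axioms assms(3)] Icarr
    by (simp add: a_minus_def del: monoid_algebra_simps)
  ultimately show ?thesis by simp
qed

lemma split_basis_sum:
  fixes c :: "('f :: field ^ 9) \<times> ('f ^ 3 ^ 3)"
  shows "c = (\<Sum>i\<in>UNIV. (fst c $ i) \<odot>\<^bsub>split_9_3 K\<^esub> (axis i 1, 0)) +
      (\<Sum>k\<in>UNIV. \<Sum>l\<in>UNIV. (snd c $ k $ l) \<odot>\<^bsub>split_9_3 K\<^esub> (0, munit k l))"
proof -
  have "(\<Sum>k\<in>UNIV. \<Sum>l\<in>UNIV. snd c $ k $ l * (if i = k \<and> j = l then 1 else 0)) = snd c $ i $ j" for i j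
      using exhaust_3[of i] exhaust_3[of j] by (auto simp: sum_3)
  moreover have "(\<Sum>i\<in>UNIV. fst c $ i * (if j = i then 1 else 0)) = fst c $ j" for j
      by (simp add: if_distrib[of "\<lambda>t. _ * t"] cong: if_cong)
  ultimately show ?thesis
      by (simp add: split_UNIV_smult prod_eq_iff vec_eq_iff fst_sum snd_sum munit_nth axis_def)
qed

text \<open>Additivity reduces a property to multiples of basis vectors; its validity at zero, which
  starts the induction over sums, is the multiple by 0.\<close>

lemma split_basis_induct [case_names add diag mat]:
  fixes c :: "('f :: field ^ 9) \<times> ('f ^ 3 ^ 3)"
  assumes add: "\<And>a b. Pr a \<Longrightarrow> Pr b \<Longrightarrow> Pr (a + b)"
    and diag: "\<And>i r. Pr (r \<odot>\<^bsub>split_UNIV\<^esub> (axis i 1, 0))"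
    and mat: "\<And>k l r. Pr (r \<odot>\<^bsub>split_UNIV\<^esub> (0, munit k l))"
  shows "Pr c"
proof -
  have zero: "Pr 0" using diag[of 0] by (simp add: split_UNIV_smult zero_prod_def zero_vec_def)
  have sum: "Pr (\<Sum>i\<in>A. f i)" if "finite A" "\<And>i. Pr (f i)" for A and f :: "'i \<Rightarrow> _"
    using that by (induction A rule: finite_induct) (simp_all add: zero add)
  have "c = (\<Sum>i\<in>UNIV. (fst c $ i) \<odot>\<^bsub>split_UNIV\<^esub> (axis i 1, 0)) +
      (\<Sum>k\<in>UNIV. \<Sum>l\<in>UNIV. (snd c $ k $ l) \<odot>\<^bsub>split_UNIV\<^esub> (0, munit k l))"
    by (rule split_basis_sum)
  also have "Pr \<dots>" by (intro add sum diag mat) simp_all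
  finally show ?thesis .
qed

text \<open>Sending (a, b) to b times the image of a extends to a ring homomorphism from the
  integral monoid ring of pairs onto the split algebra over \<open>K\<close>. Its kernel is the
  tensor ideal because, modulo the balancing relations, every tensor is determined by its
  coordinates in a basis of \<open>A\<close>.\<close>

lemma base_change_split:
  fixes A :: "('f :: field, 'a) module" and K :: "'f alg_closure set"
  assumes A: "ring A"
    and A_smult: "\<And>c a. a \<in> carrier A \<Longrightarrow> c \<odot>\<^bsub>A\<^esub> a \<in> carrier A"
    and A_split: "alg_isomorphic (ring_of_type_algebra :: 'f ring) A split_UNIV"
    and K: "subring K ring_of_type_algebra" and to_ac_K: "range to_ac \<subseteq> K"
  shows "alg_isomorphic (subfield_ring K)
    (base_change (ring_of_type_algebra :: 'f ring) A (ext_algebra K)) (split_9_3 K)"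
proof -
  interpret A: ring A by (rule A)
  note Kc = subring_type_closed[OF K]
  have toK [simp]: "to_ac r \<in> K" for r using to_ac_K by auto
  define S where "S = (split_9_3 K)"
  have ring_S: "ring S" unfolding S_def by (rule ring_split[OF K])
  note S_smult = split_smult_simps[where K = K, folded S_def]
  have S_closed: "c \<odot>\<^bsub>S\<^esub> a \<in> carrier S" if "c \<in> K" "a \<in> carrier S" for c a
    using split_smult_closed[OF K] that by (simp add: S_def)
  have S_add: "x \<oplus>\<^bsub>S\<^esub> y = x + y" and S_zero: "\<zero>\<^bsub>S\<^esub> = 0" for x y by (simp_all add: S_def)
  from A_split obtain h where h: "h \<in> ring_iso A split_UNIV"
    and h_smult: "\<And>c a. a \<in> carrier A \<Longrightarrow> h (c \<odot>\<^bsub>A\<^esub> a) = c \<odot>\<^bsub>split_UNIV\<^esub> h a"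
    by (auto simp: alg_isomorphic_def ring_of_type_algebra_def)
  have h_hom: "h \<in> ring_hom A split_UNIV" and h_bij: "bij_betw h (carrier A) UNIV"
    using h by (auto simp: ring_iso_def)
  \<comment> \<open>The inverse of h carries the standard basis back to a basis of
    \<open>A\<close>.\<close>
  define g where "g = inv_into (carrier A) h"
  have g_closed [simp]: "g c \<in> carrier A" and h_g [simp]: "h (g c) = c" for c
    using h_bij by (auto simp: g_def bij_betw_def inv_into_into f_inv_into_f)
  have g_eqI: "g c = a" if "a \<in> carrier A" "h a = c" for a c
    using h_bij that by (auto simp: g_def bij_betw_def inv_into_f_f)
  have g_add: "g (c + d) = g c \<oplus>\<^bsub>A\<^esub> g d" for c d
    using ring_hom_add[OF h_hom] by (intro g_eqI) simp_all
  have g_smult: "g (r \<odot>\<^bsub>split_UNIV\<^esub> c) = r \<odot>\<^bsub>A\<^esub> g c" for r c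
    by (intro g_eqI A_smult) (simp_all only: h_smult g_closed h_g)

  define G where "G = A \<times>\<times> ext_algebra K"
  have "Group.monoid (ext_algebra K)" by (rule monoidI) (simp_all add: Kc mult.assoc)
  then have G: "Group.monoid G" unfolding G_def by (rule DirProd_monoid[OF A.monoid_axioms])
  have G_simps [simp]: "carrier G = carrier A \<times> K"
      "(a, b) \<otimes>\<^bsub>G\<^esub> (a', b') = (a \<otimes>\<^bsub>A\<^esub> a', b * b')" "\<one>\<^bsub>G\<^esub> = (\<one>\<^bsub>A\<^esub>, 1)" for a b a' b'
    by (simp_all add: G_def DirProd_def)
  let ?M = "monoid_algebra G :: (int, _) module"
  have ring_M: "ring ?M" by (rule ring_monoid_algebra[OF G])
  \<comment> \<open>This is multiplicative on pairs because scalars are central in the split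
    algebra.\<close>
  define \<phi> where "\<phi> = (\<lambda>(a, b). b \<odot>\<^bsub>S\<^esub> ac_split (h a))"
  define \<Phi> where "\<Phi> = lin_ext (\<lambda>n :: int. (\<odot>\<^bsub>S\<^esub>) (of_int n)) \<phi>"
  have ac_closed: "ac_split c \<in> carrier S" for c
    by (simp add: S_def split_carrier_iff ac_split_def del: split_simps(1))
  have \<Phi>_hom: "\<Phi> \<in> ring_hom ?M S"
    unfolding \<Phi>_def
  proof (rule ring_hom_lin_ext[OF G ring_S S_add S_zero])
    fix c d :: int and x y and a b
    show "\<phi> a \<in> carrier S" if "a \<in> carrier G"
      using that by (auto simp: \<phi>_def intro!: S_closed ac_closed)
    show "\<phi> (a \<otimes>\<^bsub>G\<^esub> b) = \<phi> a \<otimes>\<^bsub>S\<^esub> \<phi> b" if "a \<in> carrier G" "b \<in> carrier G"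
      using that ring_hom_mult[OF h_hom]
      by (auto simp: \<phi>_def S_smult ac_split_simps(2)[where K = K, folded S_def])
    show "\<phi> \<one>\<^bsub>G\<^esub> = \<one>\<^bsub>S\<^esub>"
      using ring_hom_one[OF h_hom] ac_split_simps(3)[where K = K, folded S_def] by (simp add: \<phi>_def S_smult)
    show "of_int c \<odot>\<^bsub>S\<^esub> x \<in> carrier S" if "x \<in> carrier S"
      using that of_int_subring[OF K] by (intro S_closed)
    show "of_int (c + d) \<odot>\<^bsub>S\<^esub> x = of_int c \<odot>\<^bsub>S\<^esub> x + of_int d \<odot>\<^bsub>S\<^esub> x"
      by (simp only: of_int_add S_smult)
    show "of_int (c * d) \<odot>\<^bsub>S\<^esub> (x \<otimes>\<^bsub>S\<^esub> y) = (of_int c \<odot>\<^bsub>S\<^esub> x) \<otimes>\<^bsub>S\<^esub> (of_int d \<odot>\<^bsub>S\<^esub> y)"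
      by (simp only: of_int_mult S_smult)
    show "of_int 1 \<odot>\<^bsub>S\<^esub> x = x" by (simp only: of_int_1 S_smult)
  qed
  have \<Phi>_add: "\<Phi> (f + f') = \<Phi> f + \<Phi> f'" for f f'
    unfolding \<Phi>_def by (rule lin_ext_add) (simp only: of_int_add S_smult)
  have \<Phi>_0: "\<Phi> 0 = 0" using \<Phi>_add[of 0 0] by simp
  have \<Phi>_diff: "\<Phi> (f - f') = \<Phi> f - \<Phi> f'" for f f' using \<Phi>_add[of "f - f'" f'] by simp
  have \<Phi>_uminus: "\<Phi> (- f) = - \<Phi> f" for f using \<Phi>_diff[of 0 f] by (simp add: \<Phi>_0)
  have \<Phi>_sum: "\<Phi> (\<Sum>i\<in>W. f i) = (\<Sum>i\<in>W. \<Phi> (f i))" for f and W :: "'i set"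
    by (induction W rule: infinite_finite_induct) (simp_all add: \<Phi>_add \<Phi>_0)
  have \<Phi>_pure: "\<Phi> (pure a b) = b \<odot>\<^bsub>S\<^esub> ac_split (h a)" for a b
    unfolding \<Phi>_def by (subst lin_ext_single) (simp_all only: of_int_add of_int_1 S_smult \<phi>_def prod.case mult_1)
  have \<Phi>_closed: "\<Phi> f \<in> carrier S" if "Poly_Mapping.keys f \<subseteq> carrier G" for f
    using ring_hom_closed[OF \<Phi>_hom, of f] that by simp

  define T where "T = tensor_rels (ring_of_type_algebra :: 'f ring) A (ext_algebra K)"
  define J where "J = tensor_ideal (ring_of_type_algebra :: 'f ring) A (ext_algebra K)"
  have J_eq: "J = Idl\<^bsub>?M\<^esub> T" by (simp add: J_def T_def tensor_ideal_def G_def)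
  have keys_pure: "Poly_Mapping.keys (pure a b) \<subseteq> carrier G" if "a \<in> carrier A" "b \<in> K" for a b
    using that by simp
  have keys_diff': "Poly_Mapping.keys (f - f') \<subseteq> carrier G"
    if "Poly_Mapping.keys f \<subseteq> carrier G" "Poly_Mapping.keys f' \<subseteq> carrier G"
    for f f' :: "'a \<times> 'f alg_closure \<Rightarrow>\<^sub>0 int"
    using keys_add_subset[OF that(1), of "- f'"] that(2) by simp
  have "Poly_Mapping.keys t \<subseteq> carrier G" if "t \<in> T" for t
    using that unfolding T_def tensor_rels_def
    by (elim UnE CollectE exE conjE; hypsubst; intro keys_diff' keys_pure; simp add: Kc A_smult)
  then have T_carrier: "T \<subseteq> carrier ?M" by auto
  have J_ideal: "ideal J ?M" unfolding J_eq by (rule ring.genideal_ideal[OF ring_M T_carrier])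
  have T_J: "T \<subseteq> J" unfolding J_eq by (rule ring.genideal_self[OF ring_M T_carrier])
  have \<Phi>_T: "\<Phi> t = \<zero>\<^bsub>S\<^esub>" if "t \<in> T" for t
    using that unfolding T_def tensor_rels_def S_zero
    by (auto simp: \<Phi>_diff \<Phi>_pure ring_hom_add[OF h_hom] ac_split_simps(1) S_smult h_smult
        ac_split_simps(4)[where K = K, folded S_def] mult.commute simp del: split_simps(1,2,6))
  have \<Phi>_J: "\<Phi> f = 0" if "f \<in> J" for f
    using ideal_ring_hom_vanish[OF ring_M ring_S \<Phi>_hom T_carrier \<Phi>_T, of f] that by (simp add: J_eq S_zero)

  interpret J: ideal J ?M by (rule J_ideal)
  have J_0: "0 \<in> J" using additive_subgroup.zero_closed[OF J.additive_subgroup_axioms] by simp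
  have J_add: "f + f' \<in> J" if "f \<in> J" "f' \<in> J" for f f'
    using additive_subgroup.a_closed[OF J.additive_subgroup_axioms that] by simp
  have J_uminus: "- f \<in> J" if "f \<in> J" for f by (rule ideal_uminus_closed[OF G J_ideal that])
  \<comment> \<open>Reducing a tensor to its basis expansion involves only sums and the balancing
    relations, so it is carried out with additive congruence modulo \<open>J\<close>.\<close>
  define cg where "cg f f' \<longleftrightarrow> f - f' \<in> J" for f f'
  have cg_refl: "cg f f" for f by (simp add: cg_def J_0)
  have cg_sym: "cg f' f" if "cg f f'" for f f' using J_uminus[of "f - f'"] that by (simp add: cg_def)
  have cg_trans: "cg f f''" if "cg f f'" "cg f' f''" for f f' f''
    using J_add[of "f - f'" "f' - f''"] that by (simp add: cg_def)
  have cg_add: "cg (f + k) (f' + k')" if "cg f f'" "cg k k'" for f f' k k'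
    using J_add[of "f - f'" "k - k'"] that by (simp add: cg_def algebra_simps)
  have cg_uminus: "cg (- f) (- f')" if "cg f f'" for f f'
    using J_uminus[of "f - f'"] that by (simp add: cg_def)
  have cg_sum: "cg (\<Sum>i\<in>W. f i) (\<Sum>i\<in>W. f' i)" if "\<And>i. cg (f i) (f' i)" for f f' and W :: "'i set"
    by (induction W rule: infinite_finite_induct) (simp_all add: cg_refl cg_add that)
  have cg_T: "cg f f'" if "f - f' \<in> T" for f f' using that T_J by (auto simp: cg_def)
  have pure_add_left: "cg (pure (a \<oplus>\<^bsub>A\<^esub> a') b) (pure a b + pure a' b)"
    if "a \<in> carrier A" "a' \<in> carrier A" "b \<in> K" for a a' b
    using that
    by (intro cg_T) (unfold T_def tensor_rels_def ext_algebra_simps diff_diff_eq[symmetric], blast)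
  have pure_add_right: "cg (pure a (b + b')) (pure a b + pure a b')"
    if "a \<in> carrier A" "b \<in> K" "b' \<in> K" for a b b'
    using that
    by (intro cg_T) (unfold T_def tensor_rels_def ext_algebra_simps diff_diff_eq[symmetric], blast)
  have pure_smult: "cg (pure (r \<odot>\<^bsub>A\<^esub> a) b) (pure a (to_ac r * b))"
    if "a \<in> carrier A" "b \<in> K" for r a b
  proof (rule cg_T)
    have "r \<in> carrier ring_of_type_algebra" by (simp add: ring_of_type_algebra_def)
    then show "pure (r \<odot>\<^bsub>A\<^esub> a) b - pure a (to_ac r * b) \<in> T"
      using that unfolding T_def tensor_rels_def ext_algebra_simps by blast
  qed
  \<comment> \<open>Apply additivity in the second factor to 0 + 0 and cancel.\<close>
  have pure_zero: "cg (pure a 0) 0" if "a \<in> carrier A" for a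
    using cg_add[OF pure_add_right[OF that Kc(1) Kc(1)] cg_refl[of "- pure a 0"]] by (auto intro: cg_sym)

  \<comment> \<open>Every tensor is congruent to its expansion in a basis of \<open>A\<close>, so the kernel of \<open>\<Phi>\<close> is \<open>J\<close>.\<close>
  define N :: "('f alg_closure ^ 9) \<times> ('f alg_closure ^ 3 ^ 3) \<Rightarrow> 'a \<times> 'f alg_closure \<Rightarrow>\<^sub>0 int"
    where "N y = (\<Sum>i\<in>UNIV. pure (g (axis i 1, 0)) (fst y $ i)) +
    (\<Sum>k\<in>UNIV. \<Sum>l\<in>UNIV. pure (g (0, munit k l)) (snd y $ k $ l))" for y
  have N_add: "cg (N (y + y')) (N y + N y')" if "y \<in> carrier S" "y' \<in> carrier S" for y y'
  proof -
    have "N y + N y' = (\<Sum>i\<in>UNIV. pure (g (axis i 1, 0)) (fst y $ i) + pure (g (axis i 1, 0)) (fst y' $ i)) +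
      (\<Sum>k\<in>UNIV. \<Sum>l\<in>UNIV. pure (g (0, munit k l)) (snd y $ k $ l) + pure (g (0, munit k l)) (snd y' $ k $ l))"
      by (simp add: N_def sum.distrib algebra_simps)
    moreover have "fst y $ i \<in> K" "fst y' $ i \<in> K" "snd y $ k $ l \<in> K" "snd y' $ k $ l \<in> K" for i k l
      using that by (simp_all add: S_def split_carrier_iff del: split_simps(1))
    ultimately show ?thesis
      unfolding N_def[of "y + y'"] by (auto intro!: cg_add cg_sum pure_add_right)
  qed
  have N_0: "cg (N 0) 0"
  proof -
    have "cg (N 0) ((\<Sum>i :: 9 \<in> UNIV. 0) + (\<Sum>k :: 3 \<in> UNIV. \<Sum>l :: 3 \<in> UNIV. 0))"
      unfolding N_def by (intro cg_add cg_sum) (simp_all add: pure_zero)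
    then show ?thesis by simp
  qed
  have N_uminus: "cg (N (- y)) (- N y)" if y: "y \<in> carrier S" for y
  proof -
    have "- y \<in> carrier S"
      using y by (simp add: S_def split_carrier_iff Kc del: split_simps(1))
    from N_add[OF this y] have "cg (N 0) (N (- y) + N y)" by simp
    from cg_add[OF cg_trans[OF cg_sym[OF this] N_0] cg_refl[of "- N y"]] show ?thesis by simp
  qed
  \<comment> \<open>Induction on \<open>c\<close> over the base field: a scalar \<open>r\<close> in
    front of a basis vector crosses to the second factor, and all other basis tensors have second
    factor 0.\<close>
  have pure_N: "cg (pure (g c) b) (N (b \<odot>\<^bsub>S\<^esub> ac_split c))" if b: "b \<in> K" for b c
  proof (induction c rule: split_basis_induct)
    case (add c d)
    have bc: "b \<odot>\<^bsub>S\<^esub> ac_split c \<in> carrier S" for c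
      by (intro S_closed b ac_closed)
    have "cg (pure (g (c + d)) b) (pure (g c) b + pure (g d) b)"
      unfolding g_add by (intro pure_add_left g_closed b)
    from cg_trans[OF cg_trans[OF this cg_add[OF add]] cg_sym[OF N_add[OF bc bc]]]
    show ?case by (simp only: ac_split_simps(1) S_smult)
  next
    case (diag i r)
    let ?c = "b \<odot>\<^bsub>S\<^esub> ac_split (r \<odot>\<^bsub>split_UNIV\<^esub> (axis i 1, 0))"
    have c: "fst ?c $ j = (if j = i then to_ac r * b else 0)" "snd ?c = 0" for j
      by (simp_all add: S_def split_UNIV_smult ac_split_def axis_def vec_eq_iff mult.commute)
    have "cg (N ?c) ((\<Sum>j\<in>UNIV. if j = i then pure (g (axis i 1, 0)) (to_ac r * b) else 0) +
        (\<Sum>k :: 3 \<in> UNIV. \<Sum>l :: 3 \<in> UNIV. 0))"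
      unfolding N_def c by (intro cg_add cg_sum) (auto simp: pure_zero cg_refl)
    then have "cg (N ?c) (pure (g (axis i 1, 0)) (to_ac r * b))" by simp
    from cg_trans[OF pure_smult[OF g_closed b] cg_sym[OF this]] show ?case
      unfolding g_smult .
  next
    case (mat k l r)
    let ?c = "b \<odot>\<^bsub>S\<^esub> ac_split (r \<odot>\<^bsub>split_UNIV\<^esub> (0, munit k l))"
    have c: "fst ?c = 0" "snd ?c $ i $ j = (if i = k then if j = l then to_ac r * b else 0 else 0)" for i j
      by (auto simp: S_def split_UNIV_smult ac_split_def munit_nth vec_eq_iff mult.commute)
    have "cg (N ?c) ((\<Sum>j :: 9 \<in> UNIV. 0) + (\<Sum>i\<in>UNIV. \<Sum>j\<in>UNIV.
        if i = k then if j = l then pure (g (0, munit k l)) (to_ac r * b) else 0 else 0))"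
      unfolding N_def c by (intro cg_add cg_sum) (auto simp: pure_zero cg_refl)
    moreover have "(\<Sum>i\<in>UNIV. \<Sum>j\<in>UNIV. if i = k then if j = l then x else 0 else 0) = x"
      for x :: "'a \<times> 'f alg_closure \<Rightarrow>\<^sub>0 int"
      using exhaust_3[of k] exhaust_3[of l] by (auto simp: sum_3)
    ultimately have "cg (N ?c) (pure (g (0, munit k l)) (to_ac r * b))" by simp
    from cg_trans[OF pure_smult[OF g_closed b] cg_sym[OF this]] show ?case
      unfolding g_smult .
  qed
  \<comment> \<open>The elements congruent to their own expansion form an additive group containing
    all pairs; integer coefficients follow by repeated addition and negation.\<close>
  define R where "R = {f. Poly_Mapping.keys f \<subseteq> carrier G \<and> cg f (N (\<Phi> f))}"
  have R_add: "f + f' \<in> R" if "f \<in> R" "f' \<in> R" for f f'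
  proof -
    have keys: "Poly_Mapping.keys f \<subseteq> carrier G" "Poly_Mapping.keys f' \<subseteq> carrier G"
      and cg: "cg f (N (\<Phi> f))" "cg f' (N (\<Phi> f'))"
      using that by (simp_all add: R_def)
    from cg_trans[OF cg_add[OF cg] cg_sym[OF N_add[OF keys[THEN \<Phi>_closed]]]] keys_add_subset[OF keys]
    show ?thesis by (simp add: R_def \<Phi>_add)
  qed
  have R_uminus: "- f \<in> R" if "f \<in> R" for f
  proof -
    have keys: "Poly_Mapping.keys f \<subseteq> carrier G" and cg: "cg f (N (\<Phi> f))"
      using that by (simp_all add: R_def)
    from cg_trans[OF cg_uminus[OF cg] cg_sym[OF N_uminus[OF \<Phi>_closed[OF keys]]]] keys
    show ?thesis by (simp add: R_def \<Phi>_uminus)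
  qed
  have R_0: "0 \<in> R" using cg_sym[OF N_0] by (simp add: R_def \<Phi>_0)
  have R_pure: "pure a b \<in> R" if "a \<in> carrier A" "b \<in> K" for a b
    using pure_N[OF that(2), of "h a"] that g_eqI[OF that(1) refl] by (simp add: R_def \<Phi>_pure)
  have R_single: "Poly_Mapping.single (a, b) n \<in> R" if "a \<in> carrier A" "b \<in> K" for a b n
  proof -
    have nat: "Poly_Mapping.single (a, b) (int k) \<in> R" for k
      by (induction k) (simp_all add: R_0 single_add R_add R_pure that)
    show ?thesis
      by (cases n rule: int_cases2) (simp_all add: nat R_uminus single_uminus)
  qed
  have reduce: "cg f (N (\<Phi> f))" if "Poly_Mapping.keys f \<subseteq> carrier G" for f
  proof -
    have "f \<in> R"
      using that by (induction f rule: poly_mapping_single_induct) (auto simp: R_0 R_single R_add)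
    then show ?thesis by (simp add: R_def)
  qed
  \<comment> \<open>\<open>N\<close> is a section of \<open>\<Phi>\<close>. This yields
    surjectivity, just as \<open>reduce\<close> yields the kernel.\<close>
  have \<Phi>_N: "\<Phi> (N y) = y" for y
  proof -
    have "ac_split (axis i 1, 0 :: 'f ^ 3 ^ 3) = (axis i 1, 0)"
      "ac_split (0 :: 'f ^ 9, munit k l) = (0, munit k l)" for i k l
      by (auto simp: ac_split_def axis_def munit_nth vec_eq_iff)
    then have "\<Phi> (N y) = (\<Sum>i\<in>UNIV. (fst y $ i) \<odot>\<^bsub>S\<^esub> (axis i 1, 0)) +
      (\<Sum>k\<in>UNIV. \<Sum>l\<in>UNIV. (snd y $ k $ l) \<odot>\<^bsub>S\<^esub> (0, munit k l))"
      by (simp only: N_def \<Phi>_add \<Phi>_sum \<Phi>_pure h_g)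
    also have "\<dots> = y" unfolding S_def by (rule split_basis_sum[symmetric])
    finally show ?thesis .
  qed
  have N_closed: "Poly_Mapping.keys (N y) \<subseteq> carrier G" if "y \<in> carrier S" for y
  proof -
    have sum: "Poly_Mapping.keys (\<Sum>i\<in>W. f i) \<subseteq> carrier G"
      if "\<And>i. Poly_Mapping.keys (f i) \<subseteq> carrier G"
      for W :: "'i set" and f :: "'i \<Rightarrow> 'a \<times> 'f alg_closure \<Rightarrow>\<^sub>0 int"
      using that by (induction W rule: infinite_finite_induct) (simp_all del: G_simps add: keys_add_subset)
    show ?thesis
      unfolding N_def using that
      by (intro keys_add_subset sum keys_pure g_closed)
         (simp_all add: S_def split_carrier_iff del: split_simps(1))
  qed

  have surj: "\<Phi> ` carrier ?M = carrier S"
  proof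
    show "\<Phi> ` carrier ?M \<subseteq> carrier S" using \<Phi>_closed by auto
    show "carrier S \<subseteq> \<Phi> ` carrier ?M"
      using \<Phi>_N N_closed by (metis (mono_tags, lifting) image_eqI mem_Collect_eq monoid_algebra_simps(1) subsetI)
  qed
  have ker: "\<Phi> f = \<zero>\<^bsub>S\<^esub> \<longleftrightarrow> f \<in> J" if "f \<in> carrier ?M" for f
  proof
    assume "\<Phi> f = \<zero>\<^bsub>S\<^esub>"
    then have "cg f (N 0)" using reduce[of f] that by (simp add: S_zero)
    from cg_trans[OF this N_0] show "f \<in> J" by (simp add: cg_def)
  qed (simp add: \<Phi>_J S_zero)
  have J_carrier: "J \<subseteq> carrier ?M" using J.Icarr by blast
  note iso = quot_iso[OF ring_M ring_S \<Phi>_hom surj ker J_carrier]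
  let ?h = "\<lambda>Y. the_elem (\<Phi> ` Y)"
  have tensor: "tensor_ring (ring_of_type_algebra :: 'f ring) A (ext_algebra K) = ?M Quot J"
    by (simp add: tensor_ring_def J_def G_def)
  show ?thesis
    unfolding alg_isomorphic_def S_def[symmetric]
  proof (intro bexI ballI)
    show h_iso: "?h \<in> ring_iso (base_change ring_of_type_algebra A (ext_algebra K)) S"
      using iso(1) by (simp add: base_change_def tensor)
    fix b t
    assume "b \<in> carrier (subfield_ring K)"
      and t: "t \<in> carrier (base_change ring_of_type_algebra A (ext_algebra K))"
    then have b: "b \<in> K" by (simp add: subfield_ring_def)
    have one: "pure \<one>\<^bsub>A\<^esub> b \<in> carrier ?M" using b by simp
    have mk: "tensor_mk ring_of_type_algebra A (ext_algebra K) \<one>\<^bsub>A\<^esub> b = J +>\<^bsub>?M\<^esub> pure \<one>\<^bsub>A\<^esub> b"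
      by (simp add: tensor_mk_def J_def G_def)
    have closed: "J +>\<^bsub>?M\<^esub> pure \<one>\<^bsub>A\<^esub> b \<in> carrier (?M Quot J)"
      using one by (simp add: FactRing_def A_RCOSETS_def' del: monoid_algebra_simps) blast
    \<comment> \<open>By definition b acts as multiplication by the class of the pair (1, b), and
      that class is mapped to b times the identity.\<close>
    have "?h (b \<odot>\<^bsub>base_change ring_of_type_algebra A (ext_algebra K)\<^esub> t) =
        ?h ((J +>\<^bsub>?M\<^esub> pure \<one>\<^bsub>A\<^esub> b) \<otimes>\<^bsub>?M Quot J\<^esub> t)"
      by (simp add: base_change_def mk tensor)
    also have "\<dots> = ?h (J +>\<^bsub>?M\<^esub> pure \<one>\<^bsub>A\<^esub> b) \<otimes>\<^bsub>S\<^esub> ?h t"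
      using ring_hom_mult[of ?h "?M Quot J" S, OF _ closed] iso(1) t
      by (simp add: ring_iso_def base_change_def tensor)
    also have "?h (J +>\<^bsub>?M\<^esub> pure \<one>\<^bsub>A\<^esub> b) = b \<odot>\<^bsub>S\<^esub> \<one>\<^bsub>S\<^esub>"
      using iso(2)[OF _ one] ring_hom_one[OF h_hom] ac_split_simps(3)[where K = K, folded S_def]
      by (simp add: \<Phi>_pure)
    also have "(b \<odot>\<^bsub>S\<^esub> \<one>\<^bsub>S\<^esub>) \<otimes>\<^bsub>S\<^esub> ?h t = b \<odot>\<^bsub>S\<^esub> ?h t"
      by (simp add: S_def split_UNIV_mult split_UNIV_smult prod_eq_iff vec_eq_iff matrix_matrix_mult_def
          Finite_Cartesian_Product.mat_def if_distrib[of "\<lambda>t. _ * t"] if_distrib[of "\<lambda>t. t * _"] cong: if_cong)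
    finally show "?h (b \<odot>\<^bsub>base_change ring_of_type_algebra A (ext_algebra K)\<^esub> t) = b \<odot>\<^bsub>S\<^esub> ?h t" .
  qed
qed

subsection \<open>Zariski-open sets of points\<close>

lemma mpol_eval_eq_sum:
  assumes "finite S" "Poly_Mapping.keys f \<subseteq> S"
  shows "mpol_eval f x = (\<Sum>m\<in>S. Poly_Mapping.lookup f m * (\<Prod>i\<in>UNIV. (x $ i) ^ Poly_Mapping.lookup m i))"
  unfolding mpol_eval_def by (intro sum.mono_neutral_left assms) (simp add: in_keys_iff)

lemma mpol_eval_add [simp]: "mpol_eval (f + g) x = mpol_eval f x + mpol_eval g x"
proof -
  note * = mpol_eval_eq_sum[where S = "Poly_Mapping.keys f \<union> Poly_Mapping.keys g"]
  show ?thesis by (simp add: * keys_add lookup_add algebra_simps sum.distrib)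
qed

lemma mpol_eval_zero [simp]: "mpol_eval 0 x = 0"
  by (simp add: mpol_eval_def)

lemma mpol_eval_single [simp]:
  "mpol_eval (Poly_Mapping.single m c) x = c * (\<Prod>i\<in>UNIV. (x $ i) ^ Poly_Mapping.lookup m i)"
  by (subst mpol_eval_eq_sum[of "{m}"]) simp_all

lemma mpol_eval_mult [simp]: "mpol_eval (f * g) x = mpol_eval f x * mpol_eval g x"
proof -
  have f: "Poly_Mapping.keys f \<subseteq> UNIV" and g: "Poly_Mapping.keys g \<subseteq> UNIV" by auto
  have single: "mpol_eval (Poly_Mapping.single m c * g) x = mpol_eval (Poly_Mapping.single m c) x * mpol_eval g x" for m c
    using g by (induction g rule: poly_mapping_single_induct)
      (simp_all add: distrib_left mult_single lookup_add power_add prod.distrib algebra_simps)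
  from f show ?thesis
    by (induction f rule: poly_mapping_single_induct) (simp_all only: single distrib_right mpol_eval_add mpol_eval_zero mult_zero_left)
qed

lemma mpol_eval_uminus [simp]: "mpol_eval (- f) x = - mpol_eval f x"
  using mpol_eval_add[of f "- f" x] by (simp add: minus_unique)

lemma mpol_eval_diff [simp]: "mpol_eval (f - g) x = mpol_eval f x - mpol_eval g x"
  using mpol_eval_add[of f "- g" x] by simp

lemma mpol_eval_one [simp]: "mpol_eval 1 x = 1"
  using mpol_eval_single[of 0 1 x] by simp

lemma mpol_eval_prod [simp]: "mpol_eval (\<Prod>i\<in>A. f i) x = (\<Prod>i\<in>A. mpol_eval (f i) x)"
  by (induction A rule: infinite_finite_induct) simp_all

text \<open>The degree is an explicit parameter, so that it can be tracked through sums and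
  products. The zero polynomial has every degree.\<close>

definition homog :: "nat \<Rightarrow> ('n :: finite, 'k :: comm_ring_1) mpol \<Rightarrow> bool"
  where "homog d f \<longleftrightarrow> (\<forall>m\<in>Poly_Mapping.keys f. (\<Sum>i\<in>UNIV. Poly_Mapping.lookup m i) = d)"

lemma homog_add: "homog d f \<Longrightarrow> homog d g \<Longrightarrow> homog d (f + g)"
  using keys_add[of f g] by (auto simp: homog_def)

lemma homog_diff: "homog d f \<Longrightarrow> homog d g \<Longrightarrow> homog d (f - g)"
  using homog_add[of d f "- g"] by (simp add: homog_def in_keys_iff)

lemma homog_mult: "homog d f \<Longrightarrow> homog e g \<Longrightarrow> homog (d + e) (f * g)"
  using keys_mult[of f g] by (fastforce simp: homog_def lookup_add sum.distrib)

lemma homog_one: "homog 0 1"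
  by (simp add: homog_def)

lemma homog_prod:
  "(\<And>i. i \<in> A \<Longrightarrow> homog (d i) (f i)) \<Longrightarrow> homog (\<Sum>i\<in>A. d i) (\<Prod>i\<in>A. f i)"
  by (induction A rule: infinite_finite_induct) (simp_all add: homog_one homog_mult)

definition mvar :: "'n \<Rightarrow> ('n :: finite, 'k :: comm_ring_1) mpol"
  where "mvar i = Poly_Mapping.single (Poly_Mapping.single i 1) 1"

lemma mpol_eval_mvar [simp]: "mpol_eval (mvar i) x = x $ i"
proof -
  have "(\<Prod>j\<in>UNIV. (x $ j) ^ Poly_Mapping.lookup (Poly_Mapping.single i 1) j) =
      (\<Prod>j\<in>UNIV. if j = i then x $ i else 1)"
    by (intro prod.cong refl) (auto simp: lookup_single when_def)
  then show ?thesis by (simp add: mvar_def)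
qed

lemma homog_mvar: "homog (Suc 0) (mvar i)"
  by (simp add: homog_def mvar_def lookup_single when_def)

lemma homog_imp: "homog d f \<Longrightarrow> mpol_homogeneous f"
  by (auto simp: homog_def mpol_homogeneous_def)

lemma homog_eval_scale:
  assumes "homog d f"
  shows "mpol_eval f (c *s x) = c ^ d * mpol_eval f x"
proof -
  have "(\<Prod>i\<in>UNIV. ((c *s x) $ i) ^ Poly_Mapping.lookup m i) =
      c ^ d * (\<Prod>i\<in>UNIV. (x $ i) ^ Poly_Mapping.lookup m i)" if "m \<in> Poly_Mapping.keys f" for m
    using assms that by (simp add: homog_def power_mult_distrib prod.distrib flip: power_sum)
  then show ?thesis
    by (simp add: mpol_eval_def sum_distrib_left mult_ac)
qed

text \<open>Closed sets ask for vanishing at all representatives of a class, whereas the complement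
  here asks for vanishing at one of them. Homogeneity and nonemptiness of the classes make the two
  agree.\<close>

lemma zariski_open_basic:
  fixes f :: "('n :: finite, 'k :: field) mpol"
  assumes "homog d f"
  shows "zariski_open {Y \<in> proj_space. \<forall>x\<in>Y. mpol_eval f x \<noteq> 0}"
proof -
  have *: "mpol_eval f x = 0 \<longleftrightarrow> mpol_eval f y = 0"
    if "Y \<in> proj_space" "x \<in> Y" "y \<in> Y" for Y x y
  proof -
    from that obtain z where "Y = proj_rel `` {z}" by (auto simp: proj_space_def quotient_def)
    with that obtain a b where "a \<noteq> 0" "x = a *s z" "b \<noteq> 0" "y = b *s z"
      by (auto simp: proj_rel_def)
    then show ?thesis by (simp add: homog_eval_scale[OF assms])
  qed
  have ne: "Y \<noteq> {}" if "Y \<in> proj_space" for Y :: "('k ^ 'n) set"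
  proof -
    from that obtain z where "z \<noteq> 0" "Y = proj_rel `` {z}" by (auto simp: proj_space_def quotient_def)
    then have "z \<in> Y" by (auto simp: proj_rel_def intro: exI[of _ 1])
    then show ?thesis by auto
  qed
  have "proj_space - {Y \<in> proj_space. \<forall>x\<in>Y. mpol_eval f x \<noteq> 0} =
      {Y \<in> proj_space. \<forall>x\<in>Y. \<forall>f'\<in>{f}. mpol_eval f' x = 0}"
  proof -
    have "(\<exists>x\<in>Y. mpol_eval f x = 0) \<longleftrightarrow> (\<forall>x\<in>Y. mpol_eval f x = 0)" if "Y \<in> proj_space" for Y
      using *[OF that] ne[OF that] by blast
    then show ?thesis by blast
  qed
  moreover have "\<forall>f'\<in>{f}. mpol_homogeneous f'" using homog_imp[OF assms] by simp
  ultimately show ?thesis unfolding zariski_open_def zariski_closed_def by blast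
qed

section \<open>The polynomial cutting out the exceptional points\<close>

definition mpad :: "3 \<Rightarrow> 3 \<Rightarrow> (2 \<times> 2, 'k :: comm_ring_1) mpol"
  where "mpad k l =
    (if k = 3 \<or> l = 3 then 0 else mvar (if k = 1 then 1 else 2, if l = 1 then 1 else 2))"

definition mnu :: "3 \<Rightarrow> 3 \<Rightarrow> (2 \<times> 2, 'k :: comm_ring_1) mpol"
  where "mnu k l = mpad (nxt k) (nxt l) - mpad (nxt k) (nxt (nxt l))
    - mpad (nxt (nxt k)) (nxt l) + mpad (nxt (nxt k)) (nxt (nxt l))"

definition mdet :: "(2 \<times> 2, 'k :: comm_ring_1) mpol"
  where "mdet = mvar (1, 1) * mvar (2, 2) - mvar (1, 2) * mvar (2, 1)"

definition mgood :: "(2 \<times> 2, 'k :: comm_ring_1) mpol"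
  where "mgood = mdet * (\<Prod>k\<in>UNIV. \<Prod>l\<in>UNIV. mnu k l)"

lemma mpol_eval_mgood: "mpol_eval mgood (x :: 'k :: field ^ (2 \<times> 2)) \<noteq> 0 \<longleftrightarrow> good x"
proof -
  have "mpol_eval (mpad k l) x = pad x k l" for k l by (simp add: mpad_def pad_def)
  then show ?thesis by (simp add: mgood_def mdet_def mnu_def good_def det2_def nu_def)
qed

lemma homog_mgood: "homog ((Suc 0 + Suc 0) + (\<Sum>k :: 3 \<in> UNIV. \<Sum>l :: 3 \<in> UNIV. Suc 0)) mgood"
proof -
  \<comment> \<open>The zero entries of \<open>mpad\<close> count as forms of degree 1 too.\<close>
  have pad: "homog (Suc 0) (mpad k l)" for k l
    using homog_mvar by (auto simp: mpad_def homog_def[of _ 0])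
  show ?thesis
    unfolding mgood_def mdet_def mnu_def
    by (intro homog_mult homog_prod homog_add homog_diff pad homog_mvar)
qed

lemma good_example: "\<exists>x :: 'k :: field_char_0 ^ (2 \<times> 2). good x"
proof
  \<comment> \<open>The determinant is -1, and the nine values of nu are 5, -3, -2, -2, 1, 1, -3, 2
    and 1.\<close>
  show "good (\<chi> ij. if ij = (1, 1) then 1 else if ij = (1, 2) then 2
      else if ij = (2, 1) then 3 else (5 :: 'k))"
    by (simp add: good_def forall_3 nu_def pad_def det2_def)
qed

text \<open>Determinant and nu are polynomial expressions and commute with the embedding into
  fractions, so nonvanishing can be tested on polynomials.\<close>

lemma good_to_fract:
  fixes v :: "'a :: idom ^ (2 \<times> 2)"
  shows "good (\<chi> ij. to_fract (v $ ij)) \<longleftrightarrow> det2 v \<noteq> 0 \<and> (\<forall>k l. nu v k l \<noteq> 0)"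
proof -
  have "det2 (\<chi> ij. to_fract (v $ ij)) = to_fract (det2 v)"
    by (simp add: det2_def)
  moreover have "pad (\<chi> ij. to_fract (v $ ij)) k l = to_fract (pad v k l)" for k l
    by (simp add: pad_def)
  then have "nu (\<chi> ij. to_fract (v $ ij)) k l = to_fract (nu v k l)" for k l
    by (simp add: nu_def)
  ultimately show ?thesis by (simp add: good_def)
qed

lemma good_y_point: "good (y_point :: 'k :: field ratfun3 ^ (2 \<times> 2))"
proof -
  define v :: "'k poly poly poly ^ (2 \<times> 2)" where "v = (\<chi> ij. if ij = (1, 1) then 1 else if ij = (1, 2) then [:[:[:0, 1:]:]:]
      else if ij = (2, 1) then [:[:0, 1:]:] else ([:0, 1:] :: 'k poly poly poly))"
  have y: "y_point = (\<chi> ij. to_fract (v $ ij))"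
    by (simp add: y_point_def ratvar1_def ratvar2_def ratvar3_def vec_eq_iff v_def)
  \<comment> \<open>The determinant and the values of nu are nonempty signed sums of distinct
    monomials in the three variables.\<close>
  have "det2 v \<noteq> 0" by (simp add: det2_def one_pCons v_def)
  moreover have "nu v k l \<noteq> 0" for k l
    using exhaust_3[of k] exhaust_3[of l]
    by (elim disjE) (simp_all add: nu_def pad_def one_pCons v_def)
  ultimately show ?thesis unfolding y good_to_fract by blast
qed

theorem theorem19:
  shows
    "(\<forall>z1 z2 :: 'k :: {alg_closed_field, field_char_0} ratfun3 alg_closure.
        common_zero z1 z2 \<longrightarrow>
        (let K = field_adjoin2 z1 z2 in
          alg_isomorphic (subfield_ring K)
            (base_change ring_of_type_algebra (generic_S :: ('k ratfun3, _) module) (ext_algebra K))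
            (split_9_3 K))) \<and>
     (\<exists>U :: ('k ^ (2 \<times> 2)) set set.
        zariski_open U \<and> U \<noteq> {} \<and>
        (\<forall>Y\<in>U. \<forall>x\<in>Y.
          alg_isomorphic (ring_of_type_algebra :: 'k ring) (S_alg x) (split_9_3 (UNIV :: 'k set))))"
proof (intro conjI allI impI)
  fix z1 z2 :: "'k ratfun3 alg_closure"
  define K where "K = field_adjoin2 z1 z2"
  interpret field "ring_of_type_algebra :: 'k ratfun3 alg_closure ring"
    by (rule field_from_type_algebra)
  have "subfield K ring_of_type_algebra"
    unfolding K_def field_adjoin2_def
    by (rule generate_field_is_subfield) (simp add: ring_of_type_algebra_def)
  then have K: "subring K ring_of_type_algebra" by (rule subfieldE(1))
  have to_ac_K: "range to_ac \<subseteq> K"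
    unfolding K_def field_adjoin2_def by (auto intro: generate_field.incl)
  \<comment> \<open>2 is nonzero as a polynomial, hence also as a rational function; this is the
    condition on the characteristic in \<open>S_alg_split\<close>.\<close>
  have "to_fract (2 :: 'k poly poly poly) \<noteq> 0" by (simp only: to_fract_eq_0_iff) simp
  moreover have "to_fract (2 :: 'k poly poly poly) = 2"
    using to_fract_add[of 1 "1 :: 'k poly poly poly"] by simp
  ultimately have two: "(2 :: 'k ratfun3) \<noteq> 0" by metis
  note split = S_alg_split[OF good_y_point two]
  \<comment> \<open>The splitting over the rational functions comes first; passing to
    \<open>K\<close> is then extension of scalars.\<close>
  have "alg_isomorphic (subfield_ring K)
      (base_change ring_of_type_algebra (generic_S :: ('k ratfun3, _) module) (ext_algebra K)) (split_9_3 K)"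
    unfolding generic_S_def by (rule base_change_split[OF ring_S_alg split(2) split(1) K to_ac_K])
  then show "let K = field_adjoin2 z1 z2 in alg_isomorphic (subfield_ring K)
      (base_change ring_of_type_algebra (generic_S :: ('k ratfun3, _) module) (ext_algebra K)) (split_9_3 K)"
    by (simp add: Let_def K_def)
next
  let ?U = "{Y \<in> proj_space. \<forall>x\<in>Y. mpol_eval mgood (x :: 'k ^ (2 \<times> 2)) \<noteq> 0}"
  obtain x :: "'k ^ (2 \<times> 2)" where x: "good x" using good_example by blast
  then have "x \<noteq> 0" by (auto simp: good_def det2_def)
  then have "proj_rel `` {x} \<in> proj_space" by (auto simp: proj_space_def intro: quotientI)
  \<comment> \<open>\<open>good\<close> is known for one representative; homogeneity carries it to
    the whole class.\<close>
  moreover have "mpol_eval mgood y \<noteq> 0" if "y \<in> proj_rel `` {x}" for y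
    using that x mpol_eval_mgood[of x] by (auto simp: proj_rel_def homog_eval_scale[OF homog_mgood])
  ultimately have "proj_rel `` {x} \<in> ?U" by blast
  moreover have "zariski_open ?U" by (rule zariski_open_basic[OF homog_mgood])
  moreover have "alg_isomorphic (ring_of_type_algebra :: 'k ring) (S_alg x) (split_9_3 UNIV)"
    if "Y \<in> ?U" "x \<in> Y" for Y x
    using that mpol_eval_mgood[of x] by (intro S_alg_split) auto
  ultimately show "\<exists>U :: ('k ^ (2 \<times> 2)) set set. zariski_open U \<and> U \<noteq> {} \<and>
      (\<forall>Y\<in>U. \<forall>x\<in>Y. alg_isomorphic (ring_of_type_algebra :: 'k ring) (S_alg x) (split_9_3 UNIV))"
    by (intro exI[of _ ?U]) blast
qed

end
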